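(* Let $\mathcal X$ and $\mathcal Y$ be proper geodesic Morse center spaces that can be equipped with maximal almost HHS structures. Then a homeomorphism $\partial\mathcal X\to\partial\mathcal Y$ of Morse boundaries is induced by a quasi-isometry $\mathcal X\to\mathcal Y$ if and only if it and its inverse are $2$-stable and quasi-möbius.
   Context: **Quasi-geodesics, Morse.** $f:X\to Y$ is a $(\lambda,\varepsilon)$-quasi-isometric embedding ($\lambda\ge1,\varepsilon\ge0$) if $\frac1\lambda d_X(x,y)-\varepsilon\le d_Y(f(x),f(y))\le\lambda d_X(x,y)+\varepsilon$ for all $x,y$; it is a quasi-isometry if moreover there are $\hat f:Y\to X$ and $D\ge0$ with $d_X(\hat f f(x),x)\le D$, $d_Y(f\hat f(y),y)\le D$ for all $x,y$. A $(\lambda,\varepsilon)$-quasi-geodesic is a $(\lambda,\varepsilon)$-quasi-isometric embedding of a closed interval $I\subseteq\mathbb R$. A Morse gauge is a function $N:[1,\infty)\times[0,\infty)\to[0,\infty)$; a quasi-geodesic $\gamma$ is $N$-Morse if every $(\lambda,\varepsilon)$-quasi-geodesic with endpoints on $\gamma$ lies in the $N(\lambda,\varepsilon)$-neighborhood of $\gamma$. Convention: when a geodesic is said to be $N$-Morse, $N$ is assumed large enough that all its subgeodesics are also $N$-Morse. **Morse boundary.** Let $X$ be a proper geodesic metric space, $p\in X$. Rays are asymptotic if their images have finite Hausdorff distance. $\partial_vX_p$ is the set of asymptotism classes of geodesic rays based at $p$; $B\subseteq\partial_vX_p$ is closed iff: whenever $(b_n)$ is a sequence in $B$, $\beta_n$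 are rays based at $p$ with $[\beta_n]=b_n$, $b\in\partial_vX_p$, and every subsequence of $(\beta_n)$ has a further subsequence converging uniformly on compact sets to a ray in $b$, then $b\in B$. For a Morse gauge $N$, $\partial^NX_p\subseteq\partial_vX_p$ is the set of classes containing an $N$-Morse geodesic ray based at $p$, with the subspace topology. Gauges are partially ordered pointwise, and the Morse boundary is $\partial X=\partial_MX_p=\varinjlim_N\partial^NX_p=\bigcup_N\partial^NX_p$ with the direct limit topology. Changing the basepoint gives canonically homeomorphic boundaries (asymptotic rays correspond). A quasi-isometry $f:X\to Y$ induces a homeomorphism $f_*:\partial X\to\partial Y$ sending $[\gamma]$ to the class of geodesic rays at finite Hausdorff distance from $f(\gamma)$; $h$ is induced by $f$ if $h=f_*$. A bi-infinite (quasi-)geodesic $\gamma$ is from $a$ to $b$ ($a,b\in\partial X$) if $\gamma|_{(-\infty,0]}$ is asymptotic to a representative of $a$ and $\gamma|_{[0,\infty)}$ to a representative of $b$. **Centers, cross-ratio.** $\partial X^{(n,N)}$ is the set of $n$-tuples of pairwise distinct points of $\partial X$ such that every geodesic between any two of them is $N$-Morse. For $K>0$ and $(a,b,c)\in\partial X^{(3,N)}$, $m_X^{N,K}(a,b,c)$ is the set of $x\in X$ within $K$ of all three sides of some geodesic triangle with vertices $a,b,c$. For each gauge $N$, $K_N$ denotes a fixed constant such that every geodesic triangle (with vertices in the space or its Morse boundary) in either of the spaces all of whose sides are $N$-Morse has points $q_1,q_2,q_3$, one on each side, pairwise at distance at most $K_N$ (such constants exist); so $m_X^{N,K}$ takes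 non-empty values for $K\ge K_N$. The $N$-cross-ratio of $(a,b,c,d)\in\partial X^{(4,N)}$ is $[a,b,c,d]_N=\operatorname{diam}\big(m_X^{N,K_N}(a,b,c)\cup m_X^{N,K_N}(a,d,c)\big)$. **2-stable, quasi-möbius.** $h:\partial X\to\partial Y$ is $2$-stable if for every $N$ there is $N'$ with $h(\partial X^{(2,N)})\subseteq\partial Y^{(2,N')}$. A $2$-stable $h$ is quasi-möbius if for every pair of gauges $N,N'$ with $h(\partial X^{(2,N)})\subseteq\partial Y^{(2,N')}$ there is a continuous increasing $\psi:[0,\infty)\to[0,\infty)$ with $[h(a),h(b),h(c),h(d)]_{N'}\le\psi([a,b,c,d]_N)$ for all $(a,b,c,d)\in\partial X^{(4,N)}$. **Morse center space.** $X$ is an $N$-Morse center space if there is $K$ with $X=\bigcup_{(a,b,c)\in\partial X^{(3,N)}}m_X^{N,K}(a,b,c)$, and a Morse center space if this holds for some gauge $N$. **Almost HHS.** An almost hierarchically hyperbolic space structure on a geodesic metric space $(\mathcal X,d)$ consists of an index set $\mathfrak S$ and $\delta$-hyperbolic spaces $\{CW\}_{W\in\mathfrak S}$ (one $\delta$ for all; distances $d_W$; distances between sets are infima) such that, for some constants $\xi,\kappa_0\ge0$, $\lambda\ge1$, $E\ge\max\{\xi,\kappa_0\}$, $\alpha$, $n$, $M$, $K$: (1) Projections: maps $\pi_W:\mathcal X\to2^{CW}$ with non-empty values of diameter $\le\xi$, each $(K,K)$-coarsely Lipschitz, with $\pi_W(\mathcal X)$ $K$-quasiconvex. (2) Nesting: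 a partial order $\sqsubseteq$ on $\mathfrak S$ with a unique maximal element $S$; $\mathfrak S_W=\{V:V\sqsubseteq W\}$; for $V\sqsubsetneq W$ a specified $\rho^V_W\subseteq CW$ of diameter $\le\xi$ and a map $\rho^W_V:CW\to2^{CV}$. (3) Orthogonality: a symmetric anti-reflexive relation $\perp$; $V\sqsubseteq W$ and $W\perp U$ imply $V\perp U$; if $V\perp W$ then $V,W$ are not $\sqsubseteq$-comparable; sets of pairwise orthogonal elements have at most $M$ elements. (4) Transversality and consistency: $V,W$ are transverse ($V\pitchfork W$) if not orthogonal and not $\sqsubseteq$-comparable; then there are sets $\rho^V_W\subseteq CW$, $\rho^W_V\subseteq CV$ of diameter $\le\xi$ with $\min\{d_W(\pi_W(x),\rho^V_W),d_V(\pi_V(x),\rho^W_V)\}\le\kappa_0$ for all $x\in\mathcal X$. If $V\sqsubsetneq W$, then $\min\{d_W(\pi_W(x),\rho^V_W),\operatorname{diam}_{CV}(\pi_V(x)\cup\rho^W_V(\pi_W(x)))\}\le\kappa_0$ for all $x$. If $U\sqsubseteq V$, then $d_W(\rho^U_W,\rho^V_W)\le\kappa_0$ whenever $V\sqsubsetneq W$, or $V\pitchfork W$ and $W\not\perp U$. (5) Finite complexity: sets of pairwise $\sqsubseteq$-comparable elements have at most $n$ elements. (6) Large links: for $W\in\mathfrak S$, $x,x'\in\mathcal X$, with $P=\lambda d_W(\pi_W(x),\pi_W(x'))+\lambda$, there are $T_1,\dots,T_{\lfloor P\rfloor}\in\mathfrak S_W\setminus\{W\}$ such that every $T\in\mathfrak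 S_W\setminus\{W\}$ lies in some $\mathfrak S_{T_i}$ or satisfies $d_T(\pi_T(x),\pi_T(x'))<E$; and $d_W(\pi_W(x),\rho^{T_i}_W)\le P$ for each $i$. (7) Bounded geodesic image: for $V\sqsubsetneq W$ and every geodesic $\gamma$ of $CW$, $\operatorname{diam}_{CV}(\rho^W_V(\gamma))\le E$ or $\gamma$ meets the $E$-neighborhood of $\rho^V_W$. (8) Partial realization: for pairwise orthogonal $V_j$ and $p_j\in\pi_{V_j}(\mathcal X)$ there is $x\in\mathcal X$ with $d_{V_j}(\pi_{V_j}(x),p_j)\le\alpha$ for all $j$, and $d_V(\pi_V(x),\rho^{V_j}_V)\le\alpha$ whenever $V_j\sqsubsetneq V$ or $V\pitchfork V_j$. (9) Uniqueness: for each $\kappa\ge0$ there is $\theta(\kappa)$ such that $d(x,y)\ge\theta(\kappa)$ implies $d_V(\pi_V(x),\pi_V(y))\ge\kappa$ for some $V\in\mathfrak S$. **Maximal almost HHS.** An almost HHS $(\mathcal X,\mathfrak S)$ (with maximal element $S$) such that for every quasi-geodesic $\gamma$ in $\mathcal X$ the following are equivalent: (i) $\gamma$ is $N$-Morse for some gauge $N$; (ii) there is $B$ with $\operatorname{diam}_{CU}(\pi_U(\gamma))\le B$ for all $U\in\mathfrak S\setminus\{S\}$; (iii) $\pi_S\circ\gamma$ is an $(L,L)$-quasi-geodesic for some $L$; and moreover (for fixed quasi-geodesic constants of $\gamma$) $N$, $B$, $L$ determine each other. **Known fact used as background.** For almost HHSs the distance formula holds: for each sufficiently large $\sigma$ there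 are $A\ge1,B\ge0$ such that $\frac1A\Sigma-B\le d(x,y)\le A\Sigma+B$ for all $x,y\in\mathcal X$, where $\Sigma$ is the sum over $U\in\mathfrak S$ of those $d_U(\pi_U(x),\pi_U(y))$ that are at least $\sigma$. *)

theory Defs
  imports "HOL-Analysis.Analysis"
begin

section \<open>Quasi-isometries, quasi-geodesics and Morse gauges\<close>

definition qi_embedding_on :: "real \<Rightarrow> real \<Rightarrow> 'a::metric_space set \<Rightarrow> ('a \<Rightarrow> 'b::metric_space) \<Rightarrow> bool" where
  "qi_embedding_on L e S f \<longleftrightarrow> L \<ge> 1 \<and> e \<ge> 0 \<and>
     (\<forall>x\<in>S. \<forall>y\<in>S. (1 / L) * dist x y - e \<le> dist (f x) (f y) \<and> dist (f x) (f y) \<le> L * dist x y + e)"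

definition quasi_isometry :: "('a::metric_space \<Rightarrow> 'b::metric_space) \<Rightarrow> bool" where
  "quasi_isometry f \<longleftrightarrow> (\<exists>L e. qi_embedding_on L e UNIV f) \<and>
     (\<exists>g. \<exists>D\<ge>0. (\<forall>x. dist (g (f x)) x \<le> D) \<and> (\<forall>y. dist (f (g y)) y \<le> D))"

definition closed_interval :: "real set \<Rightarrow> bool" where
  "closed_interval I \<longleftrightarrow> is_interval I \<and> closed I \<and> I \<noteq> {}"

definition quasi_geodesic :: "real \<Rightarrow> real \<Rightarrow> real set \<Rightarrow> (real \<Rightarrow> 'a::metric_space) \<Rightarrow> bool" where
  "quasi_geodesic L e I \<gamma> \<longleftrightarrow> closed_interval I \<and> qi_embedding_on L e I \<gamma>"

definition geodesic_on :: "real set \<Rightarrow> (real \<Rightarrow> 'a::metric_space) \<Rightarrow> bool" where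
  "geodesic_on I \<gamma> \<longleftrightarrow> closed_interval I \<and> (\<forall>s\<in>I. \<forall>t\<in>I. dist (\<gamma> s) (\<gamma> t) = \<bar>s - t\<bar>)"

class proper_geodesic_space = metric_space +
  assumes compact_cball_proper: "compact (cball (x::'a::metric_space) r)"
    and geodesic_exists: "\<exists>\<gamma> :: real \<Rightarrow> 'a::metric_space.
      geodesic_on {0..dist x y} \<gamma> \<and> \<gamma> 0 = x \<and> \<gamma> (dist x y) = y"

instance proper_geodesic_space \<subseteq> heine_borel
proof
  fix f :: "nat \<Rightarrow> 'a"
  assume "bounded (range f)"
  then obtain x r where "range f \<subseteq> cball x r"
    unfolding bounded_def by (auto simp: subset_iff mem_cball)
  moreover have "seq_compact (cball x r)"
    using compact_cball_proper compact_imp_seq_compact by blast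
  ultimately show "\<exists>l r. strict_mono r \<and> (f \<circ> r) \<longlonglongrightarrow> l"
    unfolding seq_compact_def by blast
qed

text \<open>Gauges are total functions; only their values at \<open>L \<ge> 1\<close>, \<open>e \<ge> 0\<close> are ever inspected.\<close>

type_synonym gauge = "real \<Rightarrow> real \<Rightarrow> real"

definition morse_gauge :: "gauge \<Rightarrow> bool" where
  "morse_gauge N \<longleftrightarrow> (\<forall>L\<ge>1. \<forall>e\<ge>0. 0 \<le> N L e)"

text \<open>Throughout, the \<open>r\<close>-neighbourhood of a set is the closed one, of all points at distance
  at most \<open>r\<close> from the set.\<close>

definition morse :: "gauge \<Rightarrow> real set \<Rightarrow> (real \<Rightarrow> 'a::metric_space) \<Rightarrow> bool" where
  "morse N I \<gamma> \<longleftrightarrow> (\<forall>L\<ge>1. \<forall>e\<ge>0. \<forall>a b \<sigma>.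
     a \<le> b \<and> quasi_geodesic L e {a..b} \<sigma> \<and> \<sigma> a \<in> \<gamma> ` I \<and> \<sigma> b \<in> \<gamma> ` I \<longrightarrow>
     (\<forall>t\<in>{a..b}. infdist (\<sigma> t) (\<gamma> ` I) \<le> N L e))"

text \<open>Convention for geodesics: the gauge is required to serve all subgeodesics as well.\<close>

definition morse_geodesic :: "gauge \<Rightarrow> real set \<Rightarrow> (real \<Rightarrow> 'a::metric_space) \<Rightarrow> bool" where
  "morse_geodesic N I \<gamma> \<longleftrightarrow> geodesic_on I \<gamma> \<and> (\<forall>J\<subseteq>I. closed_interval J \<longrightarrow> morse N J \<gamma>)"


section \<open>The Morse boundary\<close>

definition finite_hausdorff :: "'a::metric_space set \<Rightarrow> 'a set \<Rightarrow> bool" where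
  "finite_hausdorff A B \<longleftrightarrow>
     (\<exists>D. (\<forall>a\<in>A. \<exists>b\<in>B. dist a b \<le> D) \<and> (\<forall>b\<in>B. \<exists>a\<in>A. dist b a \<le> D))"

text \<open>A ray is a function on all of the reals of which only the restriction to \<open>{0..}\<close> matters;
  since asymptotism only looks at that restriction, the classes below are unaffected.\<close>

definition geodesic_ray :: "'a::metric_space \<Rightarrow> (real \<Rightarrow> 'a) \<Rightarrow> bool" where
  "geodesic_ray p \<gamma> \<longleftrightarrow> geodesic_on {0..} \<gamma> \<and> \<gamma> 0 = p"

definition asymptotic_rays :: "'a::metric_space \<Rightarrow> ((real \<Rightarrow> 'a) \<times> (real \<Rightarrow> 'a)) set" where
  "asymptotic_rays p = {(\<gamma>, \<gamma>'). geodesic_ray p \<gamma> \<and> geodesic_ray p \<gamma>' \<and>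
     finite_hausdorff (\<gamma> ` {0..}) (\<gamma>' ` {0..})}"

type_synonym 'a ideal = "(real \<Rightarrow> 'a) set"

definition visual_boundary :: "'a::metric_space \<Rightarrow> 'a ideal set" where
  "visual_boundary p = {\<gamma>. geodesic_ray p \<gamma>} // asymptotic_rays p"

definition subseq_converges_to :: "(nat \<Rightarrow> real \<Rightarrow> 'a::metric_space) \<Rightarrow> 'a ideal \<Rightarrow> bool" where
  "subseq_converges_to \<beta> b \<longleftrightarrow> (\<forall>r::nat \<Rightarrow> nat. strict_mono r \<longrightarrow>
     (\<exists>r'::nat \<Rightarrow> nat. strict_mono r' \<and> (\<exists>\<gamma>\<in>b. \<forall>C. compact C \<and> C \<subseteq> {0..} \<longrightarrow>
        uniform_limit C (\<lambda>n. \<beta> (r (r' n))) \<gamma> sequentially)))"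

definition visual_closed :: "'a::metric_space \<Rightarrow> 'a ideal set \<Rightarrow> bool" where
  "visual_closed p B \<longleftrightarrow> B \<subseteq> visual_boundary p \<and>
     (\<forall>\<beta> b. (\<forall>n. geodesic_ray p (\<beta> n) \<and> asymptotic_rays p `` {\<beta> n} \<in> B) \<and>
        b \<in> visual_boundary p \<and> subseq_converges_to \<beta> b \<longrightarrow> b \<in> B)"

definition visual_topology :: "'a::metric_space \<Rightarrow> 'a ideal topology" where
  "visual_topology p =
     topology (\<lambda>U. U \<subseteq> visual_boundary p \<and> visual_closed p (visual_boundary p - U))"

definition morse_stratum :: "'a::metric_space \<Rightarrow> gauge \<Rightarrow> 'a ideal set" where
  "morse_stratum p N = {b \<in> visual_boundary p. \<exists>\<gamma>\<in>b. morse_geodesic N {0..} \<gamma>}"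

definition morse_boundary :: "'a::metric_space \<Rightarrow> 'a ideal set" where
  "morse_boundary p = (\<Union>N\<in>{N. morse_gauge N}. morse_stratum p N)"

definition morse_topology :: "'a::metric_space \<Rightarrow> 'a ideal topology" where
  "morse_topology p = topology (\<lambda>U. U \<subseteq> morse_boundary p \<and>
     (\<forall>N. morse_gauge N \<longrightarrow>
        openin (subtopology (visual_topology p) (morse_stratum p N)) (U \<inter> morse_stratum p N)))"

definition induced_boundary_map ::
  "'b::metric_space \<Rightarrow> ('a::metric_space \<Rightarrow> 'b) \<Rightarrow> 'a ideal \<Rightarrow> 'b ideal" where
  "induced_boundary_map q f a =
     {\<rho>. geodesic_ray q \<rho> \<and> (\<exists>\<gamma>\<in>a. finite_hausdorff (f ` \<gamma> ` {0..}) (\<rho> ` {0..}))}"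

definition induced_by ::
  "'a::metric_space \<Rightarrow> 'b::metric_space \<Rightarrow> ('a ideal \<Rightarrow> 'b ideal) \<Rightarrow> ('a \<Rightarrow> 'b) \<Rightarrow> bool" where
  "induced_by p q h f \<longleftrightarrow> (\<forall>a\<in>morse_boundary p. h a = induced_boundary_map q f a)"


section \<open>Triangles, centers and the cross-ratio\<close>

definition tends_to :: "'a::metric_space set \<Rightarrow> 'a ideal \<Rightarrow> bool" where
  "tends_to A a \<longleftrightarrow> (\<exists>\<rho>\<in>a. finite_hausdorff A (\<rho> ` {0..}))"

text \<open>Endpoints are points of the space (\<open>Inl\<close>) or of its boundary (\<open>Inr\<close>).\<close>

fun geodesic_from_to ::
  "'a::metric_space + 'a ideal \<Rightarrow> 'a + 'a ideal \<Rightarrow> real set \<Rightarrow> (real \<Rightarrow> 'a) \<Rightarrow> bool" where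
  "geodesic_from_to (Inl x) (Inl y) I \<gamma> \<longleftrightarrow>
     geodesic_on I \<gamma> \<and> (\<exists>l\<ge>0. I = {0..l} \<and> \<gamma> 0 = x \<and> \<gamma> l = y)"
| "geodesic_from_to (Inl x) (Inr b) I \<gamma> \<longleftrightarrow>
     geodesic_on I \<gamma> \<and> I = {0..} \<and> \<gamma> 0 = x \<and> tends_to (\<gamma> ` {0..}) b"
| "geodesic_from_to (Inr a) (Inl y) I \<gamma> \<longleftrightarrow>
     geodesic_on I \<gamma> \<and> I = {..0} \<and> tends_to (\<gamma> ` {..0}) a \<and> \<gamma> 0 = y"
| "geodesic_from_to (Inr a) (Inr b) I \<gamma> \<longleftrightarrow>
     geodesic_on I \<gamma> \<and> I = UNIV \<and> tends_to (\<gamma> ` {..0}) a \<and> tends_to (\<gamma> ` {0..}) b"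

definition boundary_tuples :: "'a::metric_space \<Rightarrow> nat \<Rightarrow> gauge \<Rightarrow> 'a ideal list set" where
  "boundary_tuples p n N = {as. length as = n \<and> distinct as \<and> set as \<subseteq> morse_boundary p \<and>
     (\<forall>a\<in>set as. \<forall>b\<in>set as. a \<noteq> b \<longrightarrow>
        (\<forall>I \<gamma>. geodesic_from_to (Inr a) (Inr b) I \<gamma> \<longrightarrow> morse_geodesic N I \<gamma>))}"

text \<open>The gauge enters the set of centers only through the triples it is applied to.\<close>

definition centers :: "real \<Rightarrow> 'a::metric_space ideal \<Rightarrow> 'a ideal \<Rightarrow> 'a ideal \<Rightarrow> 'a set" where
  "centers K a b c = {x. \<exists>I1 I2 I3 \<gamma>1 \<gamma>2 \<gamma>3.
     geodesic_from_to (Inr a) (Inr b) I1 \<gamma>1 \<and>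
     geodesic_from_to (Inr b) (Inr c) I2 \<gamma>2 \<and>
     geodesic_from_to (Inr c) (Inr a) I3 \<gamma>3 \<and>
     infdist x (\<gamma>1 ` I1) \<le> K \<and> infdist x (\<gamma>2 ` I2) \<le> K \<and> infdist x (\<gamma>3 ` I3) \<le> K}"

text \<open>\<open>kc N\<close> is an admissible choice, for one space, of the constant attached to the gauge \<open>N\<close>.\<close>

definition center_constants :: "'a::metric_space \<Rightarrow> (gauge \<Rightarrow> real) \<Rightarrow> bool" where
  "center_constants p kc \<longleftrightarrow> (\<forall>N. morse_gauge N \<longrightarrow> kc N > 0 \<and>
     (\<forall>u v w I1 I2 I3 \<gamma>1 \<gamma>2 \<gamma>3.
        {u, v, w} \<subseteq> range Inl \<union> Inr ` morse_boundary p \<and>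
        geodesic_from_to u v I1 \<gamma>1 \<and> geodesic_from_to v w I2 \<gamma>2 \<and> geodesic_from_to w u I3 \<gamma>3 \<and>
        morse_geodesic N I1 \<gamma>1 \<and> morse_geodesic N I2 \<gamma>2 \<and> morse_geodesic N I3 \<gamma>3 \<longrightarrow>
        (\<exists>q1\<in>\<gamma>1 ` I1. \<exists>q2\<in>\<gamma>2 ` I2. \<exists>q3\<in>\<gamma>3 ` I3.
           dist q1 q2 \<le> kc N \<and> dist q2 q3 \<le> kc N \<and> dist q3 q1 \<le> kc N)))"

text \<open>The diameter is that of a bounded set when \<open>[a, b, c, d] \<in> boundary_tuples p 4 N\<close>
  in a proper geodesic space.\<close>

definition cross_ratio ::
  "(gauge \<Rightarrow> real) \<Rightarrow> gauge \<Rightarrow> 'a::metric_space ideal \<Rightarrow> 'a ideal \<Rightarrow> 'a ideal \<Rightarrow> 'a ideal \<Rightarrow> real" where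
  "cross_ratio kc N a b c d = diameter (centers (kc N) a b c \<union> centers (kc N) a d c)"

definition two_stable ::
  "'a::metric_space \<Rightarrow> 'b::metric_space \<Rightarrow> ('a ideal \<Rightarrow> 'b ideal) \<Rightarrow> bool" where
  "two_stable p q h \<longleftrightarrow> (\<forall>N. morse_gauge N \<longrightarrow>
     (\<exists>N'. morse_gauge N' \<and> map h ` boundary_tuples p 2 N \<subseteq> boundary_tuples q 2 N'))"

definition quasi_mobius ::
  "(gauge \<Rightarrow> real) \<Rightarrow> 'a::metric_space \<Rightarrow> 'b::metric_space \<Rightarrow> ('a ideal \<Rightarrow> 'b ideal) \<Rightarrow> bool" where
  "quasi_mobius kc p q h \<longleftrightarrow> (\<forall>N N'. morse_gauge N \<and> morse_gauge N' \<and>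
     map h ` boundary_tuples p 2 N \<subseteq> boundary_tuples q 2 N' \<longrightarrow>
     (\<exists>\<psi> :: real \<Rightarrow> real. continuous_on {0..} \<psi> \<and> mono_on {0..} \<psi> \<and> \<psi> ` {0..} \<subseteq> {0..} \<and>
        (\<forall>a b c d. [a, b, c, d] \<in> boundary_tuples p 4 N \<longrightarrow>
           cross_ratio kc N' (h a) (h b) (h c) (h d) \<le> \<psi> (cross_ratio kc N a b c d))))"

definition morse_center_space :: "'a::metric_space \<Rightarrow> bool" where
  "morse_center_space p \<longleftrightarrow> (\<exists>N. morse_gauge N \<and> (\<exists>K>0.
     (UNIV :: 'a set) = \<Union>{centers K a b c | a b c. [a, b, c] \<in> boundary_tuples p 3 N}))"


section \<open>Hyperbolic spaces\<close>

definition mgeodesic :: "'c metric \<Rightarrow> real set \<Rightarrow> (real \<Rightarrow> 'c) \<Rightarrow> bool" where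
  "mgeodesic m I \<gamma> \<longleftrightarrow> closed_interval I \<and> \<gamma> ` I \<subseteq> mspace m \<and>
     (\<forall>s\<in>I. \<forall>t\<in>I. mdist m (\<gamma> s) (\<gamma> t) = \<bar>s - t\<bar>)"

definition msegment :: "'c metric \<Rightarrow> 'c \<Rightarrow> 'c \<Rightarrow> 'c set \<Rightarrow> bool" where
  "msegment m x y G \<longleftrightarrow>
     (\<exists>\<gamma>. \<exists>l\<ge>0. mgeodesic m {0..l} \<gamma> \<and> \<gamma> 0 = x \<and> \<gamma> l = y \<and> G = \<gamma> ` {0..l})"

definition hyperbolic :: "real \<Rightarrow> 'c metric \<Rightarrow> bool" where
  "hyperbolic \<delta> m \<longleftrightarrow> (\<forall>x\<in>mspace m. \<forall>y\<in>mspace m. \<exists>G. msegment m x y G) \<and>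
     (\<forall>x y z A B C. msegment m x y A \<and> msegment m y z B \<and> msegment m z x C \<longrightarrow>
        (\<forall>a\<in>A. \<exists>b\<in>B \<union> C. mdist m a b \<le> \<delta>))"

definition msetdist :: "'c metric \<Rightarrow> 'c set \<Rightarrow> 'c set \<Rightarrow> real" where
  "msetdist m A B = (INF (a, b)\<in>A \<times> B. mdist m a b)"

definition mdiam_le :: "'c metric \<Rightarrow> 'c set \<Rightarrow> real \<Rightarrow> bool" where
  "mdiam_le m A r \<longleftrightarrow> (\<forall>a\<in>A. \<forall>b\<in>A. mdist m a b \<le> r)"

definition mquasiconvex :: "'c metric \<Rightarrow> real \<Rightarrow> 'c set \<Rightarrow> bool" where
  "mquasiconvex m K Q \<longleftrightarrow>
     (\<forall>x\<in>Q. \<forall>y\<in>Q. \<forall>G. msegment m x y G \<longrightarrow> (\<forall>g\<in>G. msetdist m {g} Q \<le> K))"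


section \<open>Almost hierarchically hyperbolic structures\<close>

text \<open>\<open>hhs_rho H V W\<close> is the bounded set \<open>\<rho>\<^sup>V\<^sub>W\<close> in \<open>CW\<close> (for \<open>V\<close> properly nested in \<open>W\<close> or
  transverse to it); \<open>hhs_rho_map H W V\<close> is the map \<open>\<rho>\<^sup>W\<^sub>V\<close> from \<open>CW\<close> to subsets of \<open>CV\<close> (for
  \<open>V\<close> properly nested in \<open>W\<close>).  The spaces \<open>CW\<close> have carriers in one common type, which is no
  restriction as they may be taken disjoint.\<close>

record ('a, 'i, 'c) hhs =
  hhs_index :: "'i set"
  hhs_space :: "'i \<Rightarrow> 'c metric"
  hhs_proj :: "'i \<Rightarrow> 'a \<Rightarrow> 'c set"
  hhs_nest :: "'i rel"
  hhs_orth :: "'i rel"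
  hhs_rho :: "'i \<Rightarrow> 'i \<Rightarrow> 'c set"
  hhs_rho_map :: "'i \<Rightarrow> 'i \<Rightarrow> 'c \<Rightarrow> 'c set"

definition hhs_dist :: "('a, 'i, 'c) hhs \<Rightarrow> 'i \<Rightarrow> 'c set \<Rightarrow> 'c set \<Rightarrow> real" where
  "hhs_dist H W A B = msetdist (hhs_space H W) A B"

definition hhs_pdist :: "('a, 'i, 'c) hhs \<Rightarrow> 'i \<Rightarrow> 'a \<Rightarrow> 'a \<Rightarrow> real" where
  "hhs_pdist H W x y = hhs_dist H W (hhs_proj H W x) (hhs_proj H W y)"

definition hhs_below :: "('a, 'i, 'c) hhs \<Rightarrow> 'i \<Rightarrow> 'i \<Rightarrow> bool" where
  "hhs_below H V W \<longleftrightarrow> (V, W) \<in> hhs_nest H \<and> V \<noteq> W"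

definition hhs_comparable :: "('a, 'i, 'c) hhs \<Rightarrow> 'i \<Rightarrow> 'i \<Rightarrow> bool" where
  "hhs_comparable H V W \<longleftrightarrow> (V, W) \<in> hhs_nest H \<or> (W, V) \<in> hhs_nest H"

definition hhs_transverse :: "('a, 'i, 'c) hhs \<Rightarrow> 'i \<Rightarrow> 'i \<Rightarrow> bool" where
  "hhs_transverse H V W \<longleftrightarrow> V \<in> hhs_index H \<and> W \<in> hhs_index H \<and>
     (V, W) \<notin> hhs_orth H \<and> \<not> hhs_comparable H V W"

definition hhs_maximal :: "('a, 'i, 'c) hhs \<Rightarrow> 'i \<Rightarrow> bool" where
  "hhs_maximal H S \<longleftrightarrow> S \<in> hhs_index H \<and> (\<forall>W\<in>hhs_index H. (S, W) \<in> hhs_nest H \<longrightarrow> W = S)"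

definition hhs_top :: "('a, 'i, 'c) hhs \<Rightarrow> 'i" where
  "hhs_top H = (THE S. hhs_maximal H S)"

definition hhs_projections :: "('a::metric_space, 'i, 'c) hhs \<Rightarrow> real \<Rightarrow> real \<Rightarrow> bool" where
  "hhs_projections H \<xi> K \<longleftrightarrow> (\<forall>W\<in>hhs_index H.
     (\<forall>x. hhs_proj H W x \<noteq> {} \<and> hhs_proj H W x \<subseteq> mspace (hhs_space H W) \<and>
          mdiam_le (hhs_space H W) (hhs_proj H W x) \<xi>) \<and>
     (\<forall>x y. hhs_pdist H W x y \<le> K * dist x y + K) \<and>
     mquasiconvex (hhs_space H W) K (\<Union>x. hhs_proj H W x))"

text \<open>The sets \<open>\<rho>\<^sup>V\<^sub>W\<close> are required to be non-empty, so that distances to them are meaningful; with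
  the infimum over the empty set read as infinity this is forced by partial realization.\<close>

definition hhs_rho_bounded :: "('a, 'i, 'c) hhs \<Rightarrow> real \<Rightarrow> 'i \<Rightarrow> 'i \<Rightarrow> bool" where
  "hhs_rho_bounded H \<xi> V W \<longleftrightarrow> hhs_rho H V W \<noteq> {} \<and> hhs_rho H V W \<subseteq> mspace (hhs_space H W) \<and>
     mdiam_le (hhs_space H W) (hhs_rho H V W) \<xi>"

definition hhs_nesting :: "('a, 'i, 'c) hhs \<Rightarrow> real \<Rightarrow> bool" where
  "hhs_nesting H \<xi> \<longleftrightarrow> partial_order_on (hhs_index H) (hhs_nest H) \<and> (\<exists>!S. hhs_maximal H S) \<and>
     (\<forall>V W. hhs_below H V W \<longrightarrow> hhs_rho_bounded H \<xi> V W \<and>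
        (\<forall>c\<in>mspace (hhs_space H W). hhs_rho_map H W V c \<subseteq> mspace (hhs_space H V)))"

definition hhs_orthogonality :: "('a, 'i, 'c) hhs \<Rightarrow> nat \<Rightarrow> bool" where
  "hhs_orthogonality H M \<longleftrightarrow>
     hhs_orth H \<subseteq> hhs_index H \<times> hhs_index H \<and> sym (hhs_orth H) \<and> irrefl (hhs_orth H) \<and>
     (\<forall>U V W. (V, W) \<in> hhs_nest H \<and> (W, U) \<in> hhs_orth H \<longrightarrow> (V, U) \<in> hhs_orth H) \<and>
     (\<forall>V W. (V, W) \<in> hhs_orth H \<longrightarrow> \<not> hhs_comparable H V W) \<and>
     (\<forall>A\<subseteq>hhs_index H. pairwise (\<lambda>V W. (V, W) \<in> hhs_orth H) A \<longrightarrow> finite A \<and> card A \<le> M)"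

definition hhs_consistency :: "('a, 'i, 'c) hhs \<Rightarrow> real \<Rightarrow> real \<Rightarrow> bool" where
  "hhs_consistency H \<xi> \<kappa>0 \<longleftrightarrow>
     (\<forall>V W. hhs_transverse H V W \<longrightarrow> hhs_rho_bounded H \<xi> V W \<and> hhs_rho_bounded H \<xi> W V \<and>
        (\<forall>x. min (hhs_dist H W (hhs_proj H W x) (hhs_rho H V W))
                 (hhs_dist H V (hhs_proj H V x) (hhs_rho H W V)) \<le> \<kappa>0)) \<and>
     (\<forall>V W. hhs_below H V W \<longrightarrow>
        (\<forall>x. hhs_dist H W (hhs_proj H W x) (hhs_rho H V W) \<le> \<kappa>0 \<or>
             mdiam_le (hhs_space H V)
               (hhs_proj H V x \<union> (\<Union>c\<in>hhs_proj H W x. hhs_rho_map H W V c)) \<kappa>0)) \<and>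
     (\<forall>U V W. (U, V) \<in> hhs_nest H \<and>
        (hhs_below H V W \<or> hhs_transverse H V W \<and> (W, U) \<notin> hhs_orth H) \<longrightarrow>
        hhs_dist H W (hhs_rho H U W) (hhs_rho H V W) \<le> \<kappa>0)"

definition hhs_finite_complexity :: "('a, 'i, 'c) hhs \<Rightarrow> nat \<Rightarrow> bool" where
  "hhs_finite_complexity H n \<longleftrightarrow>
     (\<forall>A\<subseteq>hhs_index H. pairwise (hhs_comparable H) A \<longrightarrow> finite A \<and> card A \<le> n)"

text \<open>The list \<open>T\<^sub>1, \<dots>\<close> of at most \<open>\<lfloor>P\<rfloor>\<close> elements is rendered as a set; it has to be allowed to
  be empty because \<open>P \<ge> 1\<close> while nothing is properly nested in a minimal \<open>W\<close>.\<close>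

definition hhs_large_links :: "('a, 'i, 'c) hhs \<Rightarrow> real \<Rightarrow> real \<Rightarrow> bool" where
  "hhs_large_links H L E \<longleftrightarrow> (\<forall>W\<in>hhs_index H. \<forall>x x'.
     let P = L * hhs_pdist H W x x' + L in
     \<exists>\<T>. \<T> \<subseteq> {T. hhs_below H T W} \<and> finite \<T> \<and> int (card \<T>) \<le> \<lfloor>P\<rfloor> \<and>
       (\<forall>T. hhs_below H T W \<longrightarrow> (\<exists>T'\<in>\<T>. (T, T') \<in> hhs_nest H) \<or> hhs_pdist H T x x' < E) \<and>
       (\<forall>T\<in>\<T>. hhs_dist H W (hhs_proj H W x) (hhs_rho H T W) \<le> P))"

definition hhs_bounded_geodesic_image :: "('a, 'i, 'c) hhs \<Rightarrow> real \<Rightarrow> bool" where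
  "hhs_bounded_geodesic_image H E \<longleftrightarrow> (\<forall>V W. hhs_below H V W \<longrightarrow>
     (\<forall>I \<gamma>. mgeodesic (hhs_space H W) I \<gamma> \<longrightarrow>
        mdiam_le (hhs_space H V) (\<Union>c\<in>\<gamma> ` I. hhs_rho_map H W V c) E \<or>
        (\<exists>c\<in>\<gamma> ` I. hhs_dist H W {c} (hhs_rho H V W) \<le> E)))"

definition hhs_partial_realization :: "('a, 'i, 'c) hhs \<Rightarrow> real \<Rightarrow> bool" where
  "hhs_partial_realization H \<alpha> \<longleftrightarrow> (\<forall>A\<subseteq>hhs_index H. \<forall>p.
     pairwise (\<lambda>V W. (V, W) \<in> hhs_orth H) A \<and> (\<forall>V\<in>A. p V \<in> (\<Union>x. hhs_proj H V x)) \<longrightarrow>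
     (\<exists>x. \<forall>V\<in>A. hhs_dist H V (hhs_proj H V x) {p V} \<le> \<alpha> \<and>
        (\<forall>W. hhs_below H V W \<or> hhs_transverse H V W \<longrightarrow>
           hhs_dist H W (hhs_proj H W x) (hhs_rho H V W) \<le> \<alpha>)))"

definition hhs_uniqueness :: "('a::metric_space, 'i, 'c) hhs \<Rightarrow> bool" where
  "hhs_uniqueness H \<longleftrightarrow> (\<forall>\<kappa>\<ge>0. \<exists>\<theta>. \<forall>x y. dist x y \<ge> \<theta> \<longrightarrow>
     (\<exists>V\<in>hhs_index H. hhs_pdist H V x y \<ge> \<kappa>))"

definition almost_hhs :: "('a::metric_space, 'i, 'c) hhs \<Rightarrow> bool" where
  "almost_hhs H \<longleftrightarrow> (\<exists>\<delta> \<xi> \<kappa>0 L E \<alpha> K. \<exists>n M :: nat.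
     \<delta> \<ge> 0 \<and> \<xi> \<ge> 0 \<and> \<kappa>0 \<ge> 0 \<and> L \<ge> 1 \<and> E \<ge> max \<xi> \<kappa>0 \<and>
     (\<forall>W\<in>hhs_index H. hyperbolic \<delta> (hhs_space H W)) \<and>
     hhs_projections H \<xi> K \<and>
     hhs_nesting H \<xi> \<and>
     hhs_orthogonality H M \<and>
     hhs_consistency H \<xi> \<kappa>0 \<and>
     hhs_finite_complexity H n \<and>
     hhs_large_links H L E \<and>
     hhs_bounded_geodesic_image H E \<and>
     hhs_partial_realization H \<alpha> \<and>
     hhs_uniqueness H)"

definition bounded_projections ::
  "('a, 'i, 'c) hhs \<Rightarrow> real \<Rightarrow> real set \<Rightarrow> (real \<Rightarrow> 'a) \<Rightarrow> bool" where
  "bounded_projections H B I \<gamma> \<longleftrightarrow> (\<forall>U\<in>hhs_index H - {hhs_top H}.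
     mdiam_le (hhs_space H U) (\<Union>t\<in>I. hhs_proj H U (\<gamma> t)) B)"

definition top_quasi_geodesic ::
  "('a, 'i, 'c) hhs \<Rightarrow> real \<Rightarrow> real set \<Rightarrow> (real \<Rightarrow> 'a) \<Rightarrow> bool" where
  "top_quasi_geodesic H L I \<gamma> \<longleftrightarrow> L \<ge> 1 \<and> (\<forall>s\<in>I. \<forall>t\<in>I.
     (1 / L) * \<bar>s - t\<bar> - L \<le> hhs_pdist H (hhs_top H) (\<gamma> s) (\<gamma> t) \<and>
     hhs_pdist H (hhs_top H) (\<gamma> s) (\<gamma> t) \<le> L * \<bar>s - t\<bar> + L)"

text \<open>The equivalence of the three conditions, together with the fact that the constants determine
  each other, is a cycle of implications in which each constant depends only on the preceding one
  and on the quasi-geodesic constants.\<close>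

definition maximal_almost_hhs :: "('a::metric_space, 'i, 'c) hhs \<Rightarrow> bool" where
  "maximal_almost_hhs H \<longleftrightarrow> almost_hhs H \<and> (\<forall>L\<ge>1. \<forall>e\<ge>0.
     (\<forall>N. morse_gauge N \<longrightarrow> (\<exists>B. \<forall>I \<gamma>. quasi_geodesic L e I \<gamma> \<and> morse N I \<gamma> \<longrightarrow>
        bounded_projections H B I \<gamma>)) \<and>
     (\<forall>B. \<exists>L'. \<forall>I \<gamma>. quasi_geodesic L e I \<gamma> \<and> bounded_projections H B I \<gamma> \<longrightarrow>
        top_quasi_geodesic H L' I \<gamma>) \<and>
     (\<forall>L'. \<exists>N. morse_gauge N \<and> (\<forall>I \<gamma>. quasi_geodesic L e I \<gamma> \<and> top_quasi_geodesic H L' I \<gamma> \<longrightarrow>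
        morse N I \<gamma>)))"

section \<open>The boundary topologies are well defined\<close>

lemma subseq_converges_to_subseq:
  assumes "subseq_converges_to \<beta> b" "strict_mono (s :: nat \<Rightarrow> nat)"
  shows "subseq_converges_to (\<lambda>n. \<beta> (s n)) b"
proof (unfold subseq_converges_to_def, intro allI impI)
  fix r :: "nat \<Rightarrow> nat" assume "strict_mono r"
  then have "strict_mono (\<lambda>n. s (r n))"
    using assms(2) by (simp add: strict_mono_def)
  from assms(1)[unfolded subseq_converges_to_def, THEN spec, THEN mp, OF this]
  show "\<exists>r'::nat \<Rightarrow> nat. strict_mono r' \<and> (\<exists>\<gamma>\<in>b. \<forall>C. compact C \<and> C \<subseteq> {0..} \<longrightarrow>
        uniform_limit C (\<lambda>n. \<beta> (s (r (r' n)))) \<gamma> sequentially)" .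
qed

lemma visual_closed_Un:
  assumes "visual_closed p A" "visual_closed p B"
  shows "visual_closed p (A \<union> B)"
proof (unfold visual_closed_def, intro conjI allI impI)
  show "A \<union> B \<subseteq> visual_boundary p"
    using assms by (auto simp: visual_closed_def)
next
  fix \<beta> b
  assume *: "(\<forall>n. geodesic_ray p (\<beta> n) \<and> asymptotic_rays p `` {\<beta> n} \<in> A \<union> B) \<and>
        b \<in> visual_boundary p \<and> subseq_converges_to \<beta> b"
  have main: "b \<in> C"
    if C: "visual_closed p C" and inf: "infinite {n. asymptotic_rays p `` {\<beta> n} \<in> C}" for C
  proof -
    define s where "s = enumerate {n. asymptotic_rays p `` {\<beta> n} \<in> C}"
    have s: "strict_mono s" and sC: "\<And>n. asymptotic_rays p `` {\<beta> (s n)} \<in> C"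
      using strict_mono_enumerate[OF inf] enumerate_in_set[OF inf] by (auto simp: s_def)
    have "subseq_converges_to (\<lambda>n. \<beta> (s n)) b"
      by (rule subseq_converges_to_subseq[OF _ s]) (use * in simp)
    with * sC show ?thesis
      by (intro C[unfolded visual_closed_def, THEN conjunct2, THEN spec, THEN spec, THEN mp,
            of "\<lambda>n. \<beta> (s n)" b]) simp
  qed
  have "{n. asymptotic_rays p `` {\<beta> n} \<in> A} \<union> {n. asymptotic_rays p `` {\<beta> n} \<in> B} = UNIV"
    using * by auto
  then have "infinite ({n. asymptotic_rays p `` {\<beta> n} \<in> A} \<union> {n. asymptotic_rays p `` {\<beta> n} \<in> B})"
    by (simp only: infinite_UNIV_nat not_False_eq_True)
  then have "infinite {n. asymptotic_rays p `` {\<beta> n} \<in> A} \<or> infinite {n. asymptotic_rays p `` {\<beta> n} \<in> B}"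
    unfolding finite_Un by blast
  then show "b \<in> A \<union> B"
    using main assms by blast
qed

lemma openin_visual_topology:
  "openin (visual_topology p) U \<longleftrightarrow>
     U \<subseteq> visual_boundary p \<and> visual_closed p (visual_boundary p - U)"
proof -
  have "istopology (\<lambda>U. U \<subseteq> visual_boundary p \<and> visual_closed p (visual_boundary p - U))"
    unfolding istopology_def
  proof (intro conjI allI impI)
    fix S T
    assume "S \<subseteq> visual_boundary p \<and> visual_closed p (visual_boundary p - S)"
      "T \<subseteq> visual_boundary p \<and> visual_closed p (visual_boundary p - T)"
    then show "visual_closed p (visual_boundary p - S \<inter> T)"
      using visual_closed_Un[of p "visual_boundary p - S" "visual_boundary p - T"]
      by (simp add: Diff_Int)
  next
    fix \<K>
    assume \<K>: "\<forall>K\<in>\<K>. K \<subseteq> visual_boundary p \<and> visual_closed p (visual_boundary p - K)"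
    show "visual_closed p (visual_boundary p - \<Union>\<K>)"
      unfolding visual_closed_def
    proof (intro conjI allI impI)
      fix \<beta> b
      assume *: "(\<forall>n. geodesic_ray p (\<beta> n) \<and>
           asymptotic_rays p `` {\<beta> n} \<in> visual_boundary p - \<Union>\<K>) \<and>
         b \<in> visual_boundary p \<and> subseq_converges_to \<beta> b"
      have "b \<in> visual_boundary p - K" if "K \<in> \<K>" for K
      proof -
        have K: "visual_closed p (visual_boundary p - K)"
          using \<K> that by simp
        show ?thesis
          by (intro K[unfolded visual_closed_def, THEN conjunct2, THEN spec, THEN spec, THEN mp,
                of \<beta> b]) (use * that in auto)
      qed
      then show "b \<in> visual_boundary p - \<Union>\<K>"
        using * by auto
    qed blast
  qed blast+
  then show ?thesis
    by (simp add: visual_topology_def topology_inverse')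
qed

lemma topspace_visual_topology: "topspace (visual_topology p) = visual_boundary p"
proof (rule subset_antisym)
  show "topspace (visual_topology p) \<subseteq> visual_boundary p"
    using openin_topspace[of "visual_topology p"] by (simp only: openin_visual_topology)
  have "visual_closed p {}"
    by (simp add: visual_closed_def)
  then have "openin (visual_topology p) (visual_boundary p)"
    by (simp only: openin_visual_topology Diff_cancel subset_refl simp_thms)
  then show "visual_boundary p \<subseteq> topspace (visual_topology p)"
    by (rule openin_subset)
qed

lemma openin_morse_topology:
  "openin (morse_topology p) U \<longleftrightarrow> U \<subseteq> morse_boundary p \<and>
     (\<forall>N. morse_gauge N \<longrightarrow>
        openin (subtopology (visual_topology p) (morse_stratum p N)) (U \<inter> morse_stratum p N))"
proof -
  have "istopology (\<lambda>U. U \<subseteq> morse_boundary p \<and>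
     (\<forall>N. morse_gauge N \<longrightarrow>
        openin (subtopology (visual_topology p) (morse_stratum p N)) (U \<inter> morse_stratum p N)))"
    unfolding istopology_def
  proof (intro conjI allI impI)
    fix S T N
    assume "S \<subseteq> morse_boundary p \<and> (\<forall>N. morse_gauge N \<longrightarrow>
        openin (subtopology (visual_topology p) (morse_stratum p N)) (S \<inter> morse_stratum p N))"
      "T \<subseteq> morse_boundary p \<and> (\<forall>N. morse_gauge N \<longrightarrow>
        openin (subtopology (visual_topology p) (morse_stratum p N)) (T \<inter> morse_stratum p N))"
      "morse_gauge N"
    then have "openin (subtopology (visual_topology p) (morse_stratum p N))
       ((S \<inter> morse_stratum p N) \<inter> (T \<inter> morse_stratum p N))"
      by blast
    then show "openin (subtopology (visual_topology p) (morse_stratum p N)) (S \<inter> T \<inter> morse_stratum p N)"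
      by (simp add: Int_ac)
  next
    fix \<K> N
    assume "\<forall>K\<in>\<K>. K \<subseteq> morse_boundary p \<and> (\<forall>N. morse_gauge N \<longrightarrow>
        openin (subtopology (visual_topology p) (morse_stratum p N)) (K \<inter> morse_stratum p N))"
      "morse_gauge N"
    then have "openin (subtopology (visual_topology p) (morse_stratum p N))
       (\<Union>K\<in>\<K>. K \<inter> morse_stratum p N)"
      by (intro openin_Union) auto
    then show "openin (subtopology (visual_topology p) (morse_stratum p N)) (\<Union>\<K> \<inter> morse_stratum p N)"
      by (simp only: Int_Union2)
  qed blast+
  then show ?thesis
    by (simp add: morse_topology_def topology_inverse')
qed

lemma topspace_morse_topology: "topspace (morse_topology p) = morse_boundary p"
proof -
  have "openin (subtopology (visual_topology p) (morse_stratum p N)) (morse_boundary p \<inter> morse_stratum p N)"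
    if "morse_gauge N" for N
  proof -
    have "morse_boundary p \<inter> morse_stratum p N = visual_boundary p \<inter> morse_stratum p N"
      using that by (auto simp: morse_boundary_def morse_stratum_def)
    then show ?thesis
      unfolding openin_subtopology using openin_topspace[of "visual_topology p"]
      by (auto simp: topspace_visual_topology)
  qed
  then have "openin (morse_topology p) (morse_boundary p)"
    by (simp add: openin_morse_topology)
  then have "morse_boundary p \<subseteq> topspace (morse_topology p)"
    by (rule openin_subset)
  moreover have "topspace (morse_topology p) \<subseteq> morse_boundary p"
    using openin_topspace[of "morse_topology p"] by (simp only: openin_morse_topology)
  ultimately show ?thesis
    by (rule subset_antisym[rotated])
qed

end

theory Submission
  imports Defs
begin

text \<open>
  The argument follows Charney, Cordes and Murray. One device gives all the uniform estimates: joining a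
  point to an almost nearest point of a quasi-geodesic by a geodesic yields a quasi-geodesic with
  controlled constants, which Morse geodesics then have to stay close to. In particular, lines between
  boundary points that are seen from one point \<open>x\<close> along uniformly Morse rays are uniformly Morse,
  and triangles of such lines are thin.

  A quasi-isometry maps centers near centers, so it distorts cross-ratios in an affine way. Conversely,
  given \<open>h\<close>, send a center of a triple to a center of the image triple. Two triples with
  nearby centers are connected by a chain of triples that change one point at a time and keep their
  center, so that the cross-ratio bound makes this map coarsely Lipschitz; \<open>h'\<close> gives a
  quasi-inverse. The map takes a line from \<open>b\<close> to \<open>a\<close> close to the line from
  \<open>h b\<close> to \<open>h a\<close>, and comparing two such lines ending in \<open>a\<close> shows that it
  induces \<open>h\<close>.
\<close>


text \<open>The obstacle is uniformity: the boundary is a union of strata without a common gauge,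
  and \<open>h\<close> is controlled only for one fixed gauge at a time. The remedy is to work at a
  point \<open>x\<close> of the space: all boundary points occurring in an estimate are seen from
  \<open>x\<close> with one gauge, so every line between them has a gauge computed from that one,
  and \<open>two_stable\<close> then supplies a single target gauge. The order of the exchanges in a
  chain matters, because intermediate triples must stay nondegenerate and keep \<open>x\<close> as a
  center. Call two boundary points adjacent when they differ and a line between them passes near
  \<open>x\<close>. By thinness every point considered is adjacent to at least two vertices of a
  triple centered at \<open>x\<close>. Hence the nonadjacent pairs between two such triples form a
  partial matching, and a permutation extending it gives an admissible order. Finally, knowing that
  a line is sent near a line does not tell towards which end its points go. A point on the wrong
  half of two lines with a common end is confined by the line joining their other ends.\<close>

section \<open>Closed intervals and almost nearest points\<close>

lemma closed_interval_iff:
  "closed_interval I \<longleftrightarrow> closed I \<and> I \<noteq> {} \<and> (\<forall>a\<in>I. \<forall>b\<in>I. \<forall>x. a \<le> x \<and> x \<le> b \<longrightarrow> x \<in> I)"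
  unfolding closed_interval_def is_interval_1 by blast

lemma closed_interval_simps [simp]:
  "closed_interval {a..}" "closed_interval {..a}" "closed_interval UNIV"
  "closed_interval {a..b} \<longleftrightarrow> a \<le> b"
  by (auto simp: closed_interval_iff)

lemma closed_interval_segment:
  assumes "closed_interval I" "s \<in> I" "t \<in> I"
  shows "{min s t..max s t} \<subseteq> I"
proof
  fix x assume "x \<in> {min s t..max s t}"
  then have "min s t \<le> x \<and> x \<le> max s t" by simp
  moreover have "min s t \<in> I" "max s t \<in> I" using assms by (auto simp: min_def max_def)
  ultimately show "x \<in> I" using assms(1) unfolding closed_interval_iff by blast
qed

text \<open>Images of quasi-geodesics need not be closed, so the infimum may not be attained. The
  slack 1 replaces attainment and is the source of most additive 1's in the later constants.\<close>

lemma infdist_almost_attained: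
  assumes "A \<noteq> {}"
  shows "\<exists>a\<in>A. dist x a < infdist x A + 1"
proof -
  have "(INF a\<in>A. dist x a) < infdist x A + 1" by (simp add: infdist_notempty[OF assms])
  then show ?thesis
    using cINF_less_iff[OF assms bdd_below_image_dist] by blast
qed

lemma ex_almost_nearest:
  assumes "A \<noteq> {}"
  shows "\<exists>a\<in>A. \<forall>b\<in>A. dist x a \<le> dist x b + 1"
  using infdist_almost_attained[OF assms, of x] infdist_le[of _ A x]
  by (meson add_right_mono less_imp_le order_trans)

lemma infdist_le_imp_near:
  assumes "infdist x A \<le> r" "A \<noteq> {}"
  shows "\<exists>a\<in>A. dist x a \<le> r + 1"
  using infdist_almost_attained[OF assms(2), of x] assms(1)
  by (meson add_right_mono less_imp_le order_trans)

lemma near_imp_infdist_le: "a \<in> A \<Longrightarrow> dist x a \<le> r \<Longrightarrow> infdist x A \<le> r"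
  using infdist_le2 by blast

subsection \<open>Quasi-geodesics\<close>

text \<open>Both bounds are symmetric in the two parameters, and the lower one is multiplied out by
  \<open>L\<close>. Later estimates thus avoid division and absolute values.\<close>

lemma quasi_geodesicI:
  assumes "closed_interval I" "L \<ge> 1" "e \<ge> 0"
    and "\<And>s t. s \<in> I \<Longrightarrow> t \<in> I \<Longrightarrow> s \<le> t \<Longrightarrow> t - s \<le> L * (dist (\<sigma> s) (\<sigma> t) + e)"
    and "\<And>s t. s \<in> I \<Longrightarrow> t \<in> I \<Longrightarrow> s \<le> t \<Longrightarrow> dist (\<sigma> s) (\<sigma> t) \<le> L * (t - s) + e"
  shows "quasi_geodesic L e I \<sigma>"
proof -
  have "(1 / L) * dist s t - e \<le> dist (\<sigma> s) (\<sigma> t) \<and> dist (\<sigma> s) (\<sigma> t) \<le> L * dist s t + e"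
    if "s \<in> I" "t \<in> I" for s t
  proof (cases "s \<le> t")
    case True
    then show ?thesis
      using assms(4,5)[OF that True] assms(2) by (simp add: dist_real_def field_simps)
  next
    case False
    then show ?thesis
      using assms(4,5)[of t s] that assms(2) by (simp add: dist_real_def field_simps dist_commute)
  qed
  then show ?thesis
    using assms by (simp add: quasi_geodesic_def qi_embedding_on_def)
qed

lemma quasi_geodesicD:
  assumes "quasi_geodesic L e I \<sigma>"
  shows "closed_interval I" "L \<ge> 1" "e \<ge> 0"
    and "\<And>s t. s \<in> I \<Longrightarrow> t \<in> I \<Longrightarrow> \<bar>t - s\<bar> \<le> L * (dist (\<sigma> s) (\<sigma> t) + e)"
    and "\<And>s t. s \<in> I \<Longrightarrow> t \<in> I \<Longrightarrow> dist (\<sigma> s) (\<sigma> t) \<le> L * \<bar>t - s\<bar> + e"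
proof -
  show 1: "closed_interval I" "L \<ge> 1" "e \<ge> 0"
    using assms by (auto simp: quasi_geodesic_def qi_embedding_on_def)
  fix s t assume *: "s \<in> I" "t \<in> I"
  then have "(1 / L) * \<bar>t - s\<bar> - e \<le> dist (\<sigma> s) (\<sigma> t)" "dist (\<sigma> s) (\<sigma> t) \<le> L * \<bar>t - s\<bar> + e"
    using assms by (auto simp: quasi_geodesic_def qi_embedding_on_def dist_real_def abs_minus_commute)
  then show "\<bar>t - s\<bar> \<le> L * (dist (\<sigma> s) (\<sigma> t) + e)" "dist (\<sigma> s) (\<sigma> t) \<le> L * \<bar>t - s\<bar> + e"
    using 1 by (simp_all add: field_simps)
qed

lemma quasi_geodesic_subset:
  "quasi_geodesic L e I \<sigma> \<Longrightarrow> closed_interval J \<Longrightarrow> J \<subseteq> I \<Longrightarrow> quasi_geodesic L e J \<sigma>"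
  by (auto simp: quasi_geodesic_def qi_embedding_on_def)

text \<open>One statement for shifts (\<open>k = 1\<close>) and reversals (\<open>k = -1\<close>) of
  the parameter.\<close>

lemma quasi_geodesic_affine:
  assumes "quasi_geodesic L e I \<sigma>" "\<bar>k\<bar> = 1" "closed_interval J" "\<And>t. t \<in> J \<Longrightarrow> c + k * t \<in> I"
  shows "quasi_geodesic L e J (\<lambda>t. \<sigma> (c + k * t))"
proof -
  have "dist (c + k * s) (c + k * t) = dist s t" for s t
    using assms(2) by (metis abs_mult add_diff_cancel_left dist_real_def mult_1 right_diff_distrib)
  then show ?thesis
    using assms unfolding quasi_geodesic_def qi_embedding_on_def by metis
qed

lemma geodesic_on_affine:
  assumes "geodesic_on I \<sigma>" "\<bar>k\<bar> = 1" "closed_interval J" "\<And>t. t \<in> J \<Longrightarrow> c + k * t \<in> I"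
  shows "geodesic_on J (\<lambda>t. \<sigma> (c + k * t))"
proof -
  have "\<bar>(c + k * s) - (c + k * t)\<bar> = \<bar>s - t\<bar>" for s t
    using assms(2) by (metis abs_mult add_diff_cancel_left mult_1 right_diff_distrib)
  then show ?thesis
    using assms unfolding geodesic_on_def by metis
qed

lemma geodesic_on_subset:
  "geodesic_on I \<sigma> \<Longrightarrow> closed_interval J \<Longrightarrow> J \<subseteq> I \<Longrightarrow> geodesic_on J \<sigma>"
  by (auto simp: geodesic_on_def)

lemma geodesic_on_dist: "geodesic_on I \<gamma> \<Longrightarrow> s \<in> I \<Longrightarrow> t \<in> I \<Longrightarrow> dist (\<gamma> s) (\<gamma> t) = \<bar>s - t\<bar>"
  by (simp add: geodesic_on_def)

lemma geodesic_on_imp_quasi_geodesic: "geodesic_on I \<gamma> \<Longrightarrow> quasi_geodesic 1 0 I \<gamma>"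
  by (auto simp: geodesic_on_def quasi_geodesic_def qi_embedding_on_def dist_real_def)

lemma quasi_geodesic_perturb:
  assumes "quasi_geodesic L e I \<sigma>" and D: "\<And>t. t \<in> I \<Longrightarrow> dist (\<sigma> t) (\<sigma>' t) \<le> D" and "0 \<le> D"
  shows "quasi_geodesic L (e + 2 * D) I \<sigma>'"
proof -
  note q = quasi_geodesicD[OF assms(1)]
  have "\<bar>dist (\<sigma>' s) (\<sigma>' t) - dist (\<sigma> s) (\<sigma> t)\<bar> \<le> 2 * D" if "s \<in> I" "t \<in> I" for s t
    using D[OF that(1)] D[OF that(2)] by metric
  then have *: "dist (\<sigma> s) (\<sigma> t) \<le> dist (\<sigma>' s) (\<sigma>' t) + 2 * D"
      "dist (\<sigma>' s) (\<sigma>' t) \<le> dist (\<sigma> s) (\<sigma> t) + 2 * D" if "s \<in> I" "t \<in> I" for s t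
    using that by (smt (verit))+
  show ?thesis
  proof (rule quasi_geodesicI)
    fix s t assume st: "s \<in> I" "t \<in> I" "s \<le> t"
    have "t - s \<le> L * (dist (\<sigma> s) (\<sigma> t) + e)" using q(4)[OF st(1,2)] by simp
    also have "\<dots> \<le> L * (dist (\<sigma>' s) (\<sigma>' t) + (e + 2 * D))"
      using *(1)[OF st(1,2)] q(2) by (intro mult_left_mono) auto
    finally show "t - s \<le> L * (dist (\<sigma>' s) (\<sigma>' t) + (e + 2 * D))" .
    show "dist (\<sigma>' s) (\<sigma>' t) \<le> L * (t - s) + (e + 2 * D)"
      using *(2)[OF st(1,2)] q(5)[OF st(1,2)] st by simp
  qed (use q \<open>0 \<le> D\<close> in auto)
qed

lemma quasi_geodesic_compose:
  assumes "quasi_geodesic L e I \<sigma>" "qi_embedding_on L' e' UNIV f"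
  shows "quasi_geodesic (L' * L) (L' * e + e') I (\<lambda>t. f (\<sigma> t))"
proof (rule quasi_geodesicI)
  note q = quasi_geodesicD[OF assms(1)]
  have f: "L' \<ge> 1" "e' \<ge> 0"
    "\<And>x y. dist x y \<le> L' * (dist (f x) (f y) + e')" "\<And>x y. dist (f x) (f y) \<le> L' * dist x y + e'"
    using assms(2) by (auto simp: qi_embedding_on_def field_simps)
  show "closed_interval I" by (fact q)
  show "1 \<le> L' * L" using f(1) q(2) mult_mono[of 1 L' 1 L] by simp
  show "0 \<le> L' * e + e'" using f q by simp
  fix s t assume *: "s \<in> I" "t \<in> I" "s \<le> t"
  have "t - s \<le> L * (dist (\<sigma> s) (\<sigma> t) + e)" using q(4)[OF *(1,2)] by simp
  also have "\<dots> \<le> L * (L' * (dist (f (\<sigma> s)) (f (\<sigma> t)) + e') + e)"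
    using f(3)[of "\<sigma> s" "\<sigma> t"] q(2) by (intro mult_left_mono) auto
  \<comment> \<open>The upper bound forces the additive constant \<open>L' * e + e'\<close>.
    Enlarging \<open>e\<close> to \<open>L' * (L' * e)\<close> makes the lower bound fit the same
    constant.\<close>
  also have "\<dots> \<le> L * (L' * (dist (f (\<sigma> s)) (f (\<sigma> t)) + e') + L' * (L' * e))"
  proof -
    have "1 * e \<le> (L' * L') * e"
      using f(1) q(3) mult_mono[of 1 L' 1 L'] by (intro mult_right_mono) auto
    then show ?thesis using q(2) by (intro mult_left_mono) auto
  qed
  finally show "t - s \<le> L' * L * (dist (f (\<sigma> s)) (f (\<sigma> t)) + (L' * e + e'))"
    by (simp add: algebra_simps)
  have "dist (f (\<sigma> s)) (f (\<sigma> t)) \<le> L' * dist (\<sigma> s) (\<sigma> t) + e'" by (rule f)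
  also have "\<dots> \<le> L' * (L * (t - s) + e) + e'"
    using q(5)[OF *(1,2)] * f(1) by (intro add_right_mono mult_left_mono) auto
  finally show "dist (f (\<sigma> s)) (f (\<sigma> t)) \<le> L' * L * (t - s) + (L' * e + e')"
    by (simp add: algebra_simps)
qed

lemma geodesic_segment_exists:
  fixes x y :: "'a::proper_geodesic_space"
  obtains \<gamma> :: "real \<Rightarrow> 'a" where "geodesic_on {0..dist x y} \<gamma>" "\<gamma> 0 = x" "\<gamma> (dist x y) = y"
  using geodesic_exists by blast

text \<open>A point of the geodesic from \<open>u\<close> to \<open>\<sigma> c\<close> is about as
  far from any \<open>\<sigma> t\<close> as from \<open>\<sigma> c\<close>, because
  \<open>\<sigma> c\<close> is almost nearest to \<open>u\<close>. If \<open>D\<close> is the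
  distance between a point of the geodesic and \<open>\<sigma> t\<close>, then up to additive errors
  the piece before \<open>c\<close> has length at most \<open>D\<close> and the two ends of the
  piece after \<open>c\<close> are at most \<open>2 * D\<close> apart; this is the factor 3.\<close>

lemma concat_left:
  fixes u :: "'a::proper_geodesic_space"
  assumes "quasi_geodesic L e I \<sigma>" and c: "c \<in> I" "\<And>t. t \<in> I \<Longrightarrow> c \<le> t"
    and near: "\<And>t. t \<in> I \<Longrightarrow> dist u (\<sigma> c) \<le> dist u (\<sigma> t) + \<delta>"
  obtains \<tau> where "quasi_geodesic (3 * L) (e + 2 * \<delta>) ({c - dist u (\<sigma> c)..c} \<union> I) \<tau>"
    "\<And>t. t \<in> I \<Longrightarrow> \<tau> t = \<sigma> t" "\<tau> (c - dist u (\<sigma> c)) = u"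
    "\<And>t. t \<in> {c - dist u (\<sigma> c)..c} \<Longrightarrow> dist u (\<tau> t) \<le> dist u (\<sigma> c)"
proof -
  define l where "l = dist u (\<sigma> c)"
  note q = quasi_geodesicD[OF assms(1)]
  have \<delta>: "0 \<le> \<delta>" using near[OF c(1)] by simp
  have l: "0 \<le> l" by (simp add: l_def)
  obtain \<gamma> where \<gamma>: "geodesic_on {0..l} \<gamma>" "\<gamma> 0 = u" "\<gamma> l = \<sigma> c"
    unfolding l_def by (rule geodesic_segment_exists)
  define \<tau> where "\<tau> t = (if c < t then \<sigma> t else \<gamma> (t - c + l))" for t
  have \<tau>I: "\<tau> t = \<sigma> t" if "t \<in> I" for t
    using c(2)[OF that] \<gamma> by (auto simp: \<tau>_def)
  have \<tau>J: "\<tau> t = \<gamma> (t - c + l)" if "t \<le> c" for t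
    using that by (auto simp: \<tau>_def)
  have J: "closed_interval ({c - l..c} \<union> I)"
    unfolding closed_interval_iff
  proof (intro conjI ballI allI impI)
    show "closed ({c - l..c} \<union> I)" using q(1) by (auto simp: closed_interval_iff intro: closed_Un)
    show "{c - l..c} \<union> I \<noteq> {}" using c by auto
    fix a b x assume *: "a \<in> {c - l..c} \<union> I" "b \<in> {c - l..c} \<union> I" "a \<le> x \<and> x \<le> b"
    show "x \<in> {c - l..c} \<union> I"
    proof (cases "x \<le> c")
      case True
      then show ?thesis using * c(2)[of a] l by auto
    next
      case False
      then have "b \<in> I" using * by auto
      then show ?thesis using False * c(1) q(1) unfolding closed_interval_iff by (metis UnI2 less_imp_le not_le)
    qed
  qed
  have "quasi_geodesic (3 * L) (e + 2 * \<delta>) ({c - l..c} \<union> I) \<tau>"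
  proof (rule quasi_geodesicI[OF J])
    show "1 \<le> 3 * L" "0 \<le> e + 2 * \<delta>" using q \<delta> by auto
    fix s t assume st: "s \<in> {c - l..c} \<union> I" "t \<in> {c - l..c} \<union> I" "s \<le> t"
    consider "s \<in> I" "t \<in> I" | "s \<le> c" "s \<ge> c - l" "t \<le> c" | "s \<le> c" "s \<ge> c - l" "t \<in> I"
      using st c(2) by force
    then have "t - s \<le> 3 * L * (dist (\<tau> s) (\<tau> t) + (e + 2 * \<delta>)) \<and>
               dist (\<tau> s) (\<tau> t) \<le> 3 * L * (t - s) + (e + 2 * \<delta>)"
    proof cases
      case 1
      have "t - s \<le> L * (dist (\<sigma> s) (\<sigma> t) + e)" "dist (\<sigma> s) (\<sigma> t) \<le> L * (t - s) + e"
        using q(4,5)[OF 1] st by auto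
      moreover have "L * (dist (\<sigma> s) (\<sigma> t) + e) \<le> (3 * L) * (dist (\<sigma> s) (\<sigma> t) + (e + 2 * \<delta>))"
        using q \<delta> by (intro mult_mono) auto
      moreover have "L * (t - s) \<le> (3 * L) * (t - s)"
        using q st by (intro mult_right_mono) auto
      ultimately show ?thesis using \<tau>I 1 \<delta> by simp
    next
      case 2
      have d: "dist (\<tau> s) (\<tau> t) = t - s"
        using 2 st \<tau>J[of s] \<tau>J[of t] geodesic_on_dist[OF \<gamma>(1), of "s - c + l" "t - c + l"] by auto
      have "1 * (t - s) \<le> (3 * L) * (t - s)"
        using q(2) st by (intro mult_right_mono) auto
      moreover have "1 * (t - s) \<le> (3 * L) * (t - s + (e + 2 * \<delta>))"
        using q st \<delta> by (intro mult_mono) auto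
      ultimately show ?thesis using d q \<delta> by simp
    next
      case 3
      have \<tau>s: "\<tau> s = \<gamma> (s - c + l)" "\<tau> t = \<sigma> t" using 3 \<tau>J \<tau>I by auto
      have ds: "dist (\<tau> s) (\<sigma> c) = c - s" "dist (\<tau> s) u = s - c + l"
        using geodesic_on_dist[OF \<gamma>(1), of "s - c + l" l] geodesic_on_dist[OF \<gamma>(1), of "s - c + l" 0]
          3 \<gamma> l \<tau>s by auto
      define D where "D = dist (\<tau> s) (\<tau> t)"
      have ct: "c \<le> t" using c(2) 3 by auto
      \<comment> \<open>\<open>\<tau> s\<close> lies on a geodesic from \<open>u\<close> to
        \<open>\<sigma> c\<close>. If \<open>\<sigma> t\<close> were closer to it by more than
        \<open>\<delta>\<close>, it would also beat \<open>\<sigma> c\<close> as a point near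
        \<open>u\<close>.\<close>
      have Dlow: "c - s - \<delta> \<le> D"
        using near[OF \<open>t \<in> I\<close>] ds dist_triangle[of u "\<sigma> t" "\<tau> s"] \<tau>s
        unfolding D_def l_def by (simp add: dist_commute)
      have "dist (\<sigma> c) (\<sigma> t) \<le> D + (c - s)"
        using ds dist_triangle[of "\<sigma> c" "\<sigma> t" "\<tau> s"] \<tau>s unfolding D_def by (simp add: dist_commute)
      then have "dist (\<sigma> c) (\<sigma> t) + e \<le> 2 * D + \<delta> + e" using Dlow by simp
      then have "L * (dist (\<sigma> c) (\<sigma> t) + e) \<le> L * (2 * D + \<delta> + e)"
        using q(2) by (intro mult_left_mono) auto
      then have "t - c \<le> L * (2 * D + \<delta> + e)" using q(4)[OF c(1) \<open>t \<in> I\<close>] ct by simp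
      moreover have "c - s \<le> L * (D + \<delta>)"
      proof -
        have "1 * (D + \<delta>) \<le> L * (D + \<delta>)"
          using q(2) \<delta> by (intro mult_right_mono) (auto simp: D_def)
        then show ?thesis using Dlow by simp
      qed
      ultimately have "t - s \<le> L * (3 * D + 2 * \<delta> + e)" by (simp add: algebra_simps)
      also have "\<dots> \<le> L * (3 * (D + (e + 2 * \<delta>)))"
        using q \<delta> by (intro mult_left_mono) auto
      finally have 1: "t - s \<le> 3 * L * (D + (e + 2 * \<delta>))" by (simp add: algebra_simps)
      have "D \<le> (c - s) + dist (\<sigma> c) (\<sigma> t)"
        using ds dist_triangle[of "\<tau> s" "\<sigma> t" "\<sigma> c"] \<tau>s unfolding D_def by simp
      also have "\<dots> \<le> (c - s) + (L * (t - c) + e)" using q(5)[OF c(1) \<open>t \<in> I\<close>] ct by simp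
      also have "\<dots> \<le> L * (c - s) + (L * (t - c) + e)"
        using mult_right_mono[OF q(2), of "c - s"] 3 by simp
      also have "\<dots> = L * (t - s) + e" by (simp add: algebra_simps)
      also have "\<dots> \<le> 3 * L * (t - s) + (e + 2 * \<delta>)"
        using mult_right_mono[of L "3 * L" "t - s"] st q \<delta> by simp
      finally show ?thesis using 1 by (simp add: D_def)
    qed
    then show "t - s \<le> 3 * L * (dist (\<tau> s) (\<tau> t) + (e + 2 * \<delta>))"
      "dist (\<tau> s) (\<tau> t) \<le> 3 * L * (t - s) + (e + 2 * \<delta>)" by auto
  qed
  moreover have "\<tau> (c - l) = u" using \<tau>J[of "c - l"] l \<gamma> by simp
  moreover have "dist u (\<tau> t) \<le> l" if "t \<in> {c - l..c}" for t
    using \<tau>J[of t] that geodesic_on_dist[OF \<gamma>(1), of 0 "t - c + l"] \<gamma> l by auto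
  ultimately show ?thesis using that \<tau>I unfolding l_def by blast
qed

text \<open>Reversal of the parameter turns this into \<open>concat_left\<close>.\<close>

lemma concat_right:
  fixes u :: "'a::proper_geodesic_space"
  assumes "quasi_geodesic L e {a..c} \<sigma>" "a \<le> c"
    and near: "\<And>t. t \<in> {a..c} \<Longrightarrow> dist u (\<sigma> c) \<le> dist u (\<sigma> t) + \<delta>"
  obtains \<tau> b where "c \<le> b" "quasi_geodesic (3 * L) (e + 2 * \<delta>) {a..b} \<tau>"
    "\<And>t. t \<in> {a..c} \<Longrightarrow> \<tau> t = \<sigma> t" "\<tau> b = u"
proof -
  define l where "l = dist u (\<sigma> c)"
  have l: "0 \<le> l" by (simp add: l_def)
  have "quasi_geodesic L e {-c..-a} (\<lambda>t. \<sigma> (0 + (-1) * t))"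
    by (rule quasi_geodesic_affine[OF assms(1)]) (use assms(2) in auto)
  then have q: "quasi_geodesic L e {-c..-a} (\<lambda>t. \<sigma> (-t))" by simp
  obtain \<tau> where \<tau>: "quasi_geodesic (3 * L) (e + 2 * \<delta>) ({-c - dist u (\<sigma> (-(-c)))..-c} \<union> {-c..-a}) \<tau>"
    "\<And>t. t \<in> {-c..-a} \<Longrightarrow> \<tau> t = \<sigma> (-t)" "\<tau> (-c - dist u (\<sigma> (-(-c)))) = u"
    by (rule concat_left[OF q, of "-c" u \<delta>]) (use assms in auto)
  have "{-c - l..-c} \<union> {-c..-a} = {-c - l..-a}"
    using l assms(2) by auto
  then have I: "{-c - dist u (\<sigma> (-(-c)))..-c} \<union> {-c..-a} = {-c - l..-a}"
    by (simp add: l_def)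
  have "quasi_geodesic (3 * L) (e + 2 * \<delta>) {a..c + l} (\<lambda>t. \<tau> (0 + (-1) * t))"
    by (rule quasi_geodesic_affine[OF \<tau>(1)[unfolded I]]) (use assms(2) l in auto)
  then show ?thesis
    using that[of "c + l" "\<lambda>t. \<tau> (-t)"] \<tau>(2,3) l by (auto simp: l_def)
qed

subsection \<open>Morse geodesics\<close>

lemma morse_geodesicD_geodesic: "morse_geodesic N I \<gamma> \<Longrightarrow> geodesic_on I \<gamma>"
  by (simp add: morse_geodesic_def)

lemma morse_geodesic_mono:
  assumes "morse_geodesic N I \<gamma>" "\<And>L e. L \<ge> 1 \<Longrightarrow> e \<ge> 0 \<Longrightarrow> N L e \<le> N' L e"
  shows "morse_geodesic N' I \<gamma>"
  using assms unfolding morse_geodesic_def morse_def by (meson order_trans)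

text \<open>The working form of the Morse property. Moving the two end points onto
  \<open>\<gamma>\<close> costs \<open>2 * D\<close> in the additive constant. Applying the property
  to the subgeodesic between \<open>s\<close> and \<open>t\<close>, as the convention for geodesics
  allows, places \<open>v\<close> between them. The summand \<open>D\<close> pays for the two end
  times, the 1 for an infimum that may not be attained.\<close>

lemma morse_near:
  assumes "morse_geodesic N I \<gamma>" "morse_gauge N" "s \<in> I" "t \<in> I" "quasi_geodesic L e {a..b} \<sigma>"
    and D: "dist (\<sigma> a) (\<gamma> s) \<le> D" "dist (\<sigma> b) (\<gamma> t) \<le> D" and r: "r \<in> {a..b}"
  shows "\<exists>v\<in>{min s t..max s t}. dist (\<sigma> r) (\<gamma> v) \<le> N L (e + 2 * D) + D + 1"
proof -
  note q = quasi_geodesicD[OF assms(5)]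
  have D0: "0 \<le> D" using D(1) zero_le_dist order_trans by blast
  have N0: "0 \<le> N L (e + 2 * D)" using assms(2) q D0 by (simp add: morse_gauge_def)
  consider "r = a" | "r = b" | "a < r" "r < b" using r by force
  then show ?thesis
  proof cases
    case 1
    then show ?thesis using D(1) N0 by (intro bexI[of _ s]) auto
  next
    case 2
    then show ?thesis using D(2) N0 by (intro bexI[of _ t]) auto
  next
    case 3
    define \<sigma>' where "\<sigma>' = \<sigma>(a := \<gamma> s, b := \<gamma> t)"
    let ?J = "{min s t..max s t}"
    have q': "quasi_geodesic L (e + 2 * D) {a..b} \<sigma>'"
      by (rule quasi_geodesic_perturb[OF assms(5) _ D0]) (use D D0 3 in \<open>auto simp: \<sigma>'_def\<close>)
    have "?J \<subseteq> I"
      using assms(1,3,4) closed_interval_segment by (auto simp: morse_geodesic_def geodesic_on_def)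
    then have "morse N ?J \<gamma>" using assms(1) by (auto simp: morse_geodesic_def)
    moreover have "\<sigma>' a \<in> \<gamma> ` ?J" "\<sigma>' b \<in> \<gamma> ` ?J" using 3 by (auto simp: \<sigma>'_def)
    moreover have "0 \<le> e + 2 * D" "a \<le> b" using q(3) D0 3 by auto
    ultimately have "infdist (\<sigma>' r) (\<gamma> ` ?J) \<le> N L (e + 2 * D)"
      unfolding morse_def using q' q(2) r by blast
    moreover have "\<sigma>' r = \<sigma> r" using 3 by (simp add: \<sigma>'_def)
    moreover have "\<gamma> ` ?J \<noteq> {}" by simp
    ultimately have "\<exists>x\<in>\<gamma> ` ?J. dist (\<sigma> r) x \<le> N L (e + 2 * D) + 1"
      by (intro infdist_le_imp_near) simp_all
    then obtain v where v: "v \<in> ?J" "dist (\<sigma> r) (\<gamma> v) \<le> N L (e + 2 * D) + 1"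
      by blast
    show ?thesis by (rule bexI[OF _ v(1)]) (use v(2) D0 in linarith)
  qed
qed

text \<open>Since the nearby point is found between \<open>s\<close> and \<open>t\<close>, it lies
  in every closed subinterval that contains both; one estimate therefore settles all subgeodesics.
  Reversal reduces to \<open>s \<le> t\<close>.\<close>

lemma morse_geodesicI:
  assumes "geodesic_on I \<gamma>"
    and main: "\<And>L e a b \<sigma> s t r. \<lbrakk>quasi_geodesic L e {a..b} \<sigma>; s \<in> I; t \<in> I; s \<le> t; \<sigma> a = \<gamma> s;
      \<sigma> b = \<gamma> t; r \<in> {a..b}\<rbrakk> \<Longrightarrow> \<exists>v\<in>{s..t}. dist (\<sigma> r) (\<gamma> v) \<le> N L e"
  shows "morse_geodesic N I \<gamma>"
  unfolding morse_geodesic_def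
proof (intro conjI allI impI)
  fix J assume J: "J \<subseteq> I" "closed_interval J"
  show "morse N J \<gamma>"
    unfolding morse_def
  proof (intro allI impI ballI)
    fix L e a b :: real and \<sigma> :: "real \<Rightarrow> 'a" and r
    assume *: "a \<le> b \<and> quasi_geodesic L e {a..b} \<sigma> \<and> \<sigma> a \<in> \<gamma> ` J \<and> \<sigma> b \<in> \<gamma> ` J" "r \<in> {a..b}"
    then obtain s t where st: "s \<in> J" "t \<in> J" "\<sigma> a = \<gamma> s" "\<sigma> b = \<gamma> t" by auto
    have "\<exists>v\<in>{min s t..max s t}. dist (\<sigma> r) (\<gamma> v) \<le> N L e"
    proof (cases "s \<le> t")
      case True
      then show ?thesis using main[of L e a b \<sigma> s t r] st * J by (simp add: subset_iff min_absorb1 max_absorb2)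
    next
      case False
      have "quasi_geodesic L e {-b..-a} (\<lambda>t. \<sigma> (0 + (-1) * t))"
        by (rule quasi_geodesic_affine) (use * in auto)
      then show ?thesis
        using False main[of L e "-b" "-a" "\<lambda>t. \<sigma> (-t)" t s "-r"] st * J
        by (simp add: subset_iff min_absorb2 max_absorb1)
    qed
    then obtain v where v: "v \<in> {min s t..max s t}" "dist (\<sigma> r) (\<gamma> v) \<le> N L e" by blast
    have "v \<in> J"
      using closed_interval_segment[OF J(2) st(1,2)] v(1) by (rule subsetD)
    then show "infdist (\<sigma> r) (\<gamma> ` J) \<le> N L e"
      using v(2) by (intro near_imp_infdist_le[of "\<gamma> v"]) auto
  qed
qed (fact assms)

lemma morse_geodesic_affine:
  assumes "morse_geodesic N I \<gamma>" "\<bar>k\<bar> = 1" "closed_interval J" "\<And>t. t \<in> J \<Longrightarrow> c + k * t \<in> I"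
  shows "morse_geodesic N J (\<lambda>t. \<gamma> (c + k * t))"
  unfolding morse_geodesic_def
proof (intro conjI allI impI)
  show "geodesic_on J (\<lambda>t. \<gamma> (c + k * t))"
    using geodesic_on_affine assms morse_geodesicD_geodesic by blast
  fix J' assume J': "J' \<subseteq> J" "closed_interval J'"
  have k: "k \<noteq> 0" "k * k = 1" using assms(2) by (auto simp: abs_if split: if_splits)
  have "closed_interval ((\<lambda>t. c + k * t) ` J')"
    unfolding closed_interval_iff
  proof (intro conjI ballI allI impI)
    have "(\<lambda>t. c + k * t) ` J' = (+) c ` ((*\<^sub>R) k ` J')" by (auto simp: image_image)
    then show "closed ((\<lambda>t. c + k * t) ` J')"
      using J'(2) closed_translation closed_scaling unfolding closed_interval_iff by metis
    show "(\<lambda>t. c + k * t) ` J' \<noteq> {}" using J'(2) by (simp add: closed_interval_iff)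
    fix a b x assume *: "a \<in> (\<lambda>t. c + k * t) ` J'" "b \<in> (\<lambda>t. c + k * t) ` J'" "a \<le> x \<and> x \<le> b"
    have "x = c + k * (k * (x - c))" using k by (simp add: mult.assoc[symmetric])
    moreover have "k * (x - c) \<in> J'"
    proof -
      obtain a' b' where "a' \<in> J'" "b' \<in> J'" "a = c + k * a'" "b = c + k * b'" using * by auto
      moreover have "k = 1 \<or> k = -1" using assms(2) by linarith
      ultimately have "k * (x - c) \<in> {min a' b'..max a' b'}" using *(3) by auto
      then show ?thesis
        using closed_interval_segment[OF J'(2) \<open>a' \<in> J'\<close> \<open>b' \<in> J'\<close>] by blast
    qed
    ultimately show "x \<in> (\<lambda>t. c + k * t) ` J'" by blast
  qed
  moreover have "(\<lambda>t. c + k * t) ` J' \<subseteq> I" using assms J' by auto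
  ultimately have "morse N ((\<lambda>t. c + k * t) ` J') \<gamma>"
    using assms(1) by (auto simp: morse_geodesic_def)
  then show "morse N J' (\<lambda>t. \<gamma> (c + k * t))"
    by (simp add: morse_def image_image)
qed

subsection \<open>Finite Hausdorff distance\<close>

lemma finite_hausdorff_sym: "finite_hausdorff A B \<Longrightarrow> finite_hausdorff B A"
  unfolding finite_hausdorff_def by blast

lemma finite_hausdorff_trans:
  assumes "finite_hausdorff A B" "finite_hausdorff B C"
  shows "finite_hausdorff A C"
proof -
  obtain D where D: "\<And>a. a \<in> A \<Longrightarrow> \<exists>b\<in>B. dist a b \<le> D" "\<And>b. b \<in> B \<Longrightarrow> \<exists>a\<in>A. dist b a \<le> D"
    using assms(1) unfolding finite_hausdorff_def by blast
  obtain E where E: "\<And>a. a \<in> B \<Longrightarrow> \<exists>b\<in>C. dist a b \<le> E" "\<And>b. b \<in> C \<Longrightarrow> \<exists>a\<in>B. dist b a \<le> E"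
    using assms(2) unfolding finite_hausdorff_def by blast
  show ?thesis
    unfolding finite_hausdorff_def
  proof (intro exI[of _ "D + E"] conjI ballI)
    fix a assume "a \<in> A"
    then obtain b c where "b \<in> B" "dist a b \<le> D" "c \<in> C" "dist b c \<le> E" using D(1) E(1) by meson
    then show "\<exists>c\<in>C. dist a c \<le> D + E" using dist_triangle[of a c b] by force
  next
    fix c assume "c \<in> C"
    then obtain b a where "b \<in> B" "dist c b \<le> E" "a \<in> A" "dist b a \<le> D" using D(2) E(2) by meson
    then show "\<exists>a\<in>A. dist c a \<le> D + E" using dist_triangle[of c a b] by force
  qed
qed

lemma finite_hausdorff_refl: "finite_hausdorff A A"
  unfolding finite_hausdorff_def by (intro exI[of _ 0]) auto

lemma finite_hausdorff_bounded_diff: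
  assumes "A \<noteq> {}" "A \<subseteq> A'" "bounded (A' - A)"
  shows "finite_hausdorff A' A"
proof -
  obtain a0 where a0: "a0 \<in> A" using assms by blast
  obtain d where d: "\<And>x. x \<in> A' - A \<Longrightarrow> dist a0 x \<le> d"
    using assms(3) unfolding bounded_any_center[of _ a0] by blast
  show ?thesis
    unfolding finite_hausdorff_def
  proof (intro exI[of _ "max d 0"] conjI ballI)
    fix x assume "x \<in> A'"
    then show "\<exists>b\<in>A. dist x b \<le> max d 0"
      using d[of x] a0 by (cases "x \<in> A") (force simp: dist_commute)+
  next
    fix x assume "x \<in> A"
    then show "\<exists>b\<in>A'. dist x b \<le> max d 0" using assms(2) by force
  qed
qed

lemma quasi_geodesic_bounded_image:
  assumes "quasi_geodesic L e I \<sigma>" "J \<subseteq> I" "bounded J"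
  shows "bounded (\<sigma> ` J)"
proof (cases "J = {}")
  case False
  then obtain s where s: "s \<in> J" by blast
  obtain d where d: "\<And>t. t \<in> J \<Longrightarrow> dist s t \<le> d"
    using assms(3) unfolding bounded_any_center[of _ s] by blast
  note q = quasi_geodesicD[OF assms(1)]
  show ?thesis
    unfolding bounded_any_center[of _ "\<sigma> s"]
  proof (intro exI[of _ "L * d + e"] ballI)
    fix y assume "y \<in> \<sigma> ` J"
    then obtain t where t: "t \<in> J" "y = \<sigma> t" by blast
    then have "dist (\<sigma> s) (\<sigma> t) \<le> L * \<bar>t - s\<bar> + e" using q(5)[of s t] s assms(2) by blast
    also have "\<dots> \<le> L * d + e"
      using d[OF t(1)] q(2) by (intro add_right_mono mult_left_mono) (auto simp: dist_real_def)
    finally show "dist (\<sigma> s) y \<le> L * d + e" using t by simp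
  qed
qed simp

lemma quasi_geodesic_tail_right:
  assumes "quasi_geodesic L e I \<sigma>" "{s..} \<subseteq> I" "{t..} \<subseteq> I"
  shows "finite_hausdorff (\<sigma> ` {s..}) (\<sigma> ` {t..})"
proof -
  have "finite_hausdorff (\<sigma> ` {s..}) (\<sigma> ` {t..})" if "{s..} \<subseteq> I" "s \<le> t" for s t :: real
  proof (rule finite_hausdorff_bounded_diff)
    have "bounded (\<sigma> ` {s..t})"
      by (rule quasi_geodesic_bounded_image[OF assms(1)]) (use that in auto)
    moreover have "\<sigma> ` {s..} - \<sigma> ` {t..} \<subseteq> \<sigma> ` {s..t}" by force
    ultimately show "bounded (\<sigma> ` {s..} - \<sigma> ` {t..})" by (rule bounded_subset)
  qed (use that in auto)
  from this[of s t] this[of t s] show ?thesis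
    using assms finite_hausdorff_sym by (cases "s \<le> t") auto
qed

lemma quasi_geodesic_tail_left:
  assumes "quasi_geodesic L e UNIV \<sigma>"
  shows "finite_hausdorff (\<sigma> ` {..s}) (\<sigma> ` {..t})"
proof -
  have "quasi_geodesic L e UNIV (\<lambda>t. \<sigma> (0 + (-1) * t))"
    by (rule quasi_geodesic_affine[OF assms]) auto
  then have "finite_hausdorff ((\<lambda>t. \<sigma> (-t)) ` {-s..}) ((\<lambda>t. \<sigma> (-t)) ` {-t..})"
    by (intro quasi_geodesic_tail_right) auto
  moreover have "(\<lambda>t. \<sigma> (-t)) ` {-s..} = \<sigma> ` {..s}" for s
    using image_comp[of \<sigma> uminus "{-s..}"] by (simp add: comp_def)
  ultimately show ?thesis by simp
qed

subsection \<open>Quasi-geodesics asymptotic to Morse rays\<close>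

text \<open>The bound does not depend on the Hausdorff distance of the two images: the quasi-geodesic is left
  for a point \<open>\<rho> S\<close> only so far out that the whole jump happens after time \<open>t\<close>.\<close>

lemma morse_ray_near_quasi_geodesic:
  fixes \<rho> :: "real \<Rightarrow> 'a::proper_geodesic_space"
  assumes \<rho>: "morse_geodesic N {0..} \<rho>" "morse_gauge N" and \<zeta>: "quasi_geodesic L e {s0..} \<zeta>"
    and fh: "finite_hausdorff (\<zeta> ` {s0..}) (\<rho> ` {0..})"
    and K: "dist (\<zeta> s0) (\<rho> 0) \<le> K" and t: "s0 \<le> t"
  shows "\<exists>v\<ge>0. dist (\<zeta> t) (\<rho> v) \<le> N (3 * L) (e + 2 + 2 * K) + K + 1"
proof -
  note q = quasi_geodesicD[OF \<zeta>]
  note g = geodesic_on_dist[OF morse_geodesicD_geodesic[OF \<rho>(1)]]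
  have K0: "0 \<le> K" using K zero_le_dist order_trans by blast
  obtain D where D: "\<And>v. v \<ge> 0 \<Longrightarrow> \<exists>s\<ge>s0. dist (\<rho> v) (\<zeta> s) \<le> D"
    using fh unfolding finite_hausdorff_def by (auto simp: Bex_def Ball_def image_iff) metis
  have D0: "0 \<le> D" using D[of 0] zero_le_dist order_trans by (metis order_refl)
  \<comment> \<open>\<open>B\<close> bounds the distance from \<open>\<rho> 0\<close> to every
    \<open>\<zeta> T\<close> with \<open>s0 \<le> T \<le> t\<close>. As \<open>\<rho> S\<close> is
    within \<open>D + 1\<close> of the chosen \<open>\<zeta> T\<close>, taking
    \<open>S > B + D + 1\<close> forces \<open>t < T\<close>.\<close>
  define B where "B = K + L * (t - s0) + e"
  have B0: "0 \<le> B" using K0 q t by (simp add: B_def)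
  define S where "S = B + D + 2"
  have S0: "0 \<le> S" using B0 D0 by (simp add: S_def)
  have "\<exists>a\<in>\<zeta> ` {s0..}. \<forall>b\<in>\<zeta> ` {s0..}. dist (\<rho> S) a \<le> dist (\<rho> S) b + 1"
    by (rule ex_almost_nearest) auto
  then obtain T where T: "s0 \<le> T" "\<And>s. s0 \<le> s \<Longrightarrow> dist (\<rho> S) (\<zeta> T) \<le> dist (\<rho> S) (\<zeta> s) + 1"
    by auto
  have TD: "dist (\<rho> S) (\<zeta> T) \<le> D + 1" using D[OF S0] T(2) by (meson add_right_mono order_trans)
  have "t < T"
  proof (rule ccontr)
    assume "\<not> t < T"
    then have "L * \<bar>T - s0\<bar> \<le> L * (t - s0)" using T(1) q(2) by (intro mult_left_mono) auto
    then have "dist (\<zeta> s0) (\<zeta> T) \<le> L * (t - s0) + e" using q(5)[of s0 T] T(1) by simp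
    moreover have "dist (\<rho> 0) (\<rho> S) = S" using g[of 0 S] S0 by simp
    ultimately show False
      using TD K dist_triangle[of "\<rho> 0" "\<rho> S" "\<zeta> T"] dist_triangle[of "\<rho> 0" "\<zeta> T" "\<zeta> s0"]
      by (simp add: S_def B_def dist_commute)
  qed
  have "quasi_geodesic L e {s0..T} \<zeta>"
    by (rule quasi_geodesic_subset[OF \<zeta>]) (use T in auto)
  then obtain \<tau> b where \<tau>: "T \<le> b" "quasi_geodesic (3 * L) (e + 2 * 1) {s0..b} \<tau>"
    "\<And>t. t \<in> {s0..T} \<Longrightarrow> \<tau> t = \<zeta> t" "\<tau> b = \<rho> S"
    by (rule concat_right[of _ _ _ _ _ "\<rho> S" 1]) (use T in auto)
  have "\<exists>v\<in>{min 0 S..max 0 S}. dist (\<tau> t) (\<rho> v) \<le> N (3 * L) ((e + 2 * 1) + 2 * K) + K + 1"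
    by (rule morse_near[OF \<rho> _ _ \<tau>(2)]) (use S0 \<tau> T K K0 t \<open>t < T\<close> in auto)
  then show ?thesis using S0 \<tau>(3)[of t] t \<open>t < T\<close> by force
qed

text \<open>Both rays have unit speed and start within \<open>K\<close> of each other, so the
  parameter \<open>v\<close> of a point near \<open>\<zeta> t\<close> differs from \<open>t\<close>
  by at most \<open>K\<close> plus that distance. Hence the bound is twice that of
  \<open>morse_ray_near_quasi_geodesic\<close> plus \<open>K\<close>.\<close>

lemma morse_ray_fellow_travel:
  fixes \<rho> :: "real \<Rightarrow> 'a::proper_geodesic_space"
  assumes \<rho>: "morse_geodesic N {0..} \<rho>" "morse_gauge N" and \<zeta>: "geodesic_on {0..} \<zeta>"
    and fh: "finite_hausdorff (\<zeta> ` {0..}) (\<rho> ` {0..})"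
    and K: "dist (\<zeta> 0) (\<rho> 0) \<le> K" and t: "0 \<le> t"
  shows "dist (\<zeta> t) (\<rho> t) \<le> 2 * N 3 (2 + 2 * K) + 3 * K + 2"
proof -
  obtain v where v: "v \<ge> 0" "dist (\<zeta> t) (\<rho> v) \<le> N (3 * 1) (0 + 2 + 2 * K) + K + 1"
    using morse_ray_near_quasi_geodesic[OF \<rho> geodesic_on_imp_quasi_geodesic[OF \<zeta>] fh K t] by blast
  have "dist (\<rho> 0) (\<rho> v) = v" "dist (\<rho> t) (\<rho> v) = \<bar>t - v\<bar>" "dist (\<zeta> 0) (\<zeta> t) = t"
    using geodesic_on_dist[OF morse_geodesicD_geodesic[OF \<rho>(1)]] geodesic_on_dist[OF \<zeta>] v t by auto
  moreover have "\<bar>dist (\<rho> 0) (\<rho> v) - dist (\<zeta> 0) (\<zeta> t)\<bar> \<le> K + dist (\<zeta> t) (\<rho> v)"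
    using K by metric
  moreover have "dist (\<zeta> t) (\<rho> t) \<le> dist (\<zeta> t) (\<rho> v) + dist (\<rho> t) (\<rho> v)" by metric
  ultimately show ?thesis using v(2) by (simp add: abs_if split: if_splits)
qed

text \<open>Here \<open>\<zeta>\<close> may start far from the ray. Prepending a geodesic from
  \<open>x\<close> to the almost nearest point \<open>\<zeta> s\<close> reduces to the case of
  nearby origins. With the jump made there, two concatenations occur: 9 is 3 times 3, and each adds
  2 to \<open>e\<close>.\<close>

lemma morse_ray_near_tail:
  fixes \<rho> :: "real \<Rightarrow> 'a::proper_geodesic_space"
  assumes \<rho>: "morse_geodesic N {0..} \<rho>" "morse_gauge N" and \<zeta>: "quasi_geodesic L e {s..} \<zeta>"
    and fh: "finite_hausdorff (\<zeta> ` {s..}) (\<rho> ` {0..})"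
    and K: "dist x (\<rho> 0) \<le> K"
    and near: "\<And>t. s \<le> t \<Longrightarrow> dist x (\<zeta> s) \<le> dist x (\<zeta> t) + 1" and t: "s \<le> t"
  shows "\<exists>v\<ge>0. dist (\<zeta> t) (\<rho> v) \<le> N (9 * L) (e + 4 + 2 * K) + K + 1"
proof -
  define l where "l = dist x (\<zeta> s)"
  have l: "0 \<le> l" by (simp add: l_def)
  obtain \<tau> where \<tau>: "quasi_geodesic (3 * L) (e + 2 * 1) ({s - l..s} \<union> {s..}) \<tau>"
    "\<And>t. t \<in> {s..} \<Longrightarrow> \<tau> t = \<zeta> t" "\<tau> (s - l) = x" "\<And>t. t \<in> {s - l..s} \<Longrightarrow> dist x (\<tau> t) \<le> l"
    unfolding l_def by (rule concat_left[OF \<zeta>, of s x 1]) (use near in auto)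
  have I: "{s - l..s} \<union> {s..} = {s - l..}" using l by auto
  have "finite_hausdorff (\<tau> ` {s - l..}) (\<tau> ` {s..})"
    by (rule quasi_geodesic_tail_right[OF \<tau>(1)]) (auto simp: I l)
  moreover have "\<tau> ` {s..} = \<zeta> ` {s..}" using \<tau>(2) by force
  ultimately have "finite_hausdorff (\<tau> ` {s - l..}) (\<rho> ` {0..})"
    using fh finite_hausdorff_trans by metis
  then have "\<exists>v\<ge>0. dist (\<tau> t) (\<rho> v) \<le> N (3 * (3 * L)) ((e + 2 * 1) + 2 + 2 * K) + K + 1"
    by (intro morse_ray_near_quasi_geodesic[OF \<rho> \<tau>(1)[unfolded I]]) (use \<tau> K t l in auto)
  then show ?thesis using \<tau>(2) t by (simp add: add.commute[of 4 e])
qed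

text \<open>The line is cut at a point almost nearest to \<open>x\<close>, which is then an almost
  nearest point for each half, so that \<open>morse_ray_near_tail\<close> applies to both.\<close>

lemma quasi_line_near_morse_rays:
  fixes \<rho>1 \<rho>2 :: "real \<Rightarrow> 'a::proper_geodesic_space"
  assumes N: "morse_gauge N" and \<rho>: "morse_geodesic N {0..} \<rho>1" "morse_geodesic N {0..} \<rho>2"
    and \<zeta>: "quasi_geodesic L e UNIV \<zeta>"
    and fh: "finite_hausdorff (\<zeta> ` {..0}) (\<rho>1 ` {0..})" "finite_hausdorff (\<zeta> ` {0..}) (\<rho>2 ` {0..})"
    and K: "dist x (\<rho>1 0) \<le> K" "dist x (\<rho>2 0) \<le> K"
  shows "\<exists>s. (\<forall>t\<le>s. \<exists>v\<ge>0. dist (\<zeta> t) (\<rho>1 v) \<le> N (9 * L) (e + 4 + 2 * K) + K + 1) \<and>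
             (\<forall>t\<ge>s. \<exists>v\<ge>0. dist (\<zeta> t) (\<rho>2 v) \<le> N (9 * L) (e + 4 + 2 * K) + K + 1)"
proof -
  have "\<exists>a\<in>range \<zeta>. \<forall>b\<in>range \<zeta>. dist x a \<le> dist x b + 1" by (rule ex_almost_nearest) auto
  then obtain s where s: "\<And>t. dist x (\<zeta> s) \<le> dist x (\<zeta> t) + 1" by auto
  have 1: "\<exists>v\<ge>0. dist (\<zeta> t) (\<rho>2 v) \<le> N (9 * L) (e + 4 + 2 * K) + K + 1" if "t \<ge> s" for t
  proof (rule morse_ray_near_tail[OF \<rho>(2) N _ _ K(2) _ that])
    show "quasi_geodesic L e {s..} \<zeta>" by (rule quasi_geodesic_subset[OF \<zeta>]) auto
    show "finite_hausdorff (\<zeta> ` {s..}) (\<rho>2 ` {0..})"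
      by (rule finite_hausdorff_trans[OF quasi_geodesic_tail_right[OF \<zeta>] fh(2)]) auto
  qed (use s in auto)
  have 2: "\<exists>v\<ge>0. dist (\<zeta> t) (\<rho>1 v) \<le> N (9 * L) (e + 4 + 2 * K) + K + 1" if "t \<le> s" for t
  proof -
    have "quasi_geodesic L e {-s..} (\<lambda>t. \<zeta> (0 + (-1) * t))"
      by (rule quasi_geodesic_affine[OF \<zeta>]) auto
    moreover have "finite_hausdorff ((\<lambda>t. \<zeta> (-t)) ` {-s..}) (\<rho>1 ` {0..})"
      using finite_hausdorff_trans[OF quasi_geodesic_tail_left[OF \<zeta>] fh(1), of s]
        image_comp[of \<zeta> uminus "{-s..}"] by (simp add: comp_def)
    ultimately show ?thesis
      using morse_ray_near_tail[OF \<rho>(1) N _ _ K(1), of L e "-s" "\<lambda>t. \<zeta> (-t)" "-t"] s that by simp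
  qed
  show ?thesis using 1 2 by blast
qed

subsection \<open>Recognising Morse geodesics\<close>

text \<open>The value of \<open>C2 + 3 * C + 2 * C3\<close> in the proof of
  \<open>morse_geodesic_near\<close>.\<close>

definition near_gauge :: "gauge \<Rightarrow> real \<Rightarrow> gauge" where
  "near_gauge N C = (\<lambda>L e. N L (e + 2 * C) + 2 * N 1 (2 * C) + 6 * C + 3)"

text \<open>\<open>N L e\<close> serves quasi-geodesics with both ends on one side of the junction,
  \<open>N (3 * L) (e + 2)\<close> those that pass it and are cut and rerouted there.\<close>

definition join_gauge :: "gauge \<Rightarrow> gauge" where
  "join_gauge N = (\<lambda>L e. N L e + N (3 * L) (e + 2) + 1)"

lemma morse_gauge_near: "morse_gauge N \<Longrightarrow> 0 \<le> C \<Longrightarrow> morse_gauge (near_gauge N C)"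
  by (simp add: morse_gauge_def near_gauge_def)

lemma morse_gauge_join: "morse_gauge N \<Longrightarrow> morse_gauge (join_gauge N)"
  by (simp add: morse_gauge_def join_gauge_def)

text \<open>A quasi-geodesic with ends on \<open>\<eta>\<close> has ends near
  \<open>\<alpha>\<close> and so stays near \<open>\<alpha>\<close>. What remains is to return from
  a point \<open>\<alpha> v\<close> to a point of \<open>\<eta>\<close> between the two ends;
  comparing lengths along the two geodesics does this without a continuity argument.\<close>

lemma morse_geodesic_near:
  assumes \<alpha>: "morse_geodesic N I \<alpha>" and N: "morse_gauge N" and \<eta>: "geodesic_on J \<eta>"
    and near: "\<And>s. s \<in> J \<Longrightarrow> \<exists>v\<in>I. dist (\<eta> s) (\<alpha> v) \<le> C"
  shows "morse_geodesic (near_gauge N C) J \<eta>"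
proof (rule morse_geodesicI[OF \<eta>])
  fix L e a b \<sigma> s t r
  assume \<sigma>: "quasi_geodesic L e {a..b} \<sigma>" and st: "s \<in> J" "t \<in> J" "s \<le> t"
    and ab: "\<sigma> a = \<eta> s" "\<sigma> b = \<eta> t" and r: "r \<in> {a..b}"
  note g = geodesic_on_dist[OF morse_geodesicD_geodesic[OF \<alpha>]] and h = geodesic_on_dist[OF \<eta>]
  obtain v1 where v1: "v1 \<in> I" "dist (\<eta> s) (\<alpha> v1) \<le> C" using near st by blast
  obtain v2 where v2: "v2 \<in> I" "dist (\<eta> t) (\<alpha> v2) \<le> C" using near st by blast
  have C0: "0 \<le> C" using v1(2) zero_le_dist order_trans by blast
  define C2 where "C2 = N L (e + 2 * C) + C + 1"
  define C3 where "C3 = N 1 (2 * C) + C + 1"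
  have "\<exists>v\<in>{min v1 v2..max v1 v2}. dist (\<sigma> r) (\<alpha> v) \<le> C2"
    unfolding C2_def by (rule morse_near[OF \<alpha> N v1(1) v2(1) \<sigma>]) (use v1 v2 ab r in auto)
  then obtain v where v: "v \<in> {min v1 v2..max v1 v2}" "dist (\<sigma> r) (\<alpha> v) \<le> C2" by blast
  have J: "{s..t} \<subseteq> J"
    using closed_interval_segment[of J s t] st \<eta> by (auto simp: geodesic_on_def)
  have I: "{min v1 v2..max v1 v2} \<subseteq> I"
    using closed_interval_segment[of I v1 v2] v1 v2 \<alpha> by (auto simp: morse_geodesic_def geodesic_on_def)
  \<comment> \<open>As \<open>\<eta>\<close> and \<open>\<alpha>\<close> have unit speed, the
    counterpart of \<open>\<alpha> v\<close> is expected at distance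
    \<open>\<bar>v - v1\<bar>\<close> after \<open>s\<close>. The minimum keeps it inside the
    segment and changes it by at most \<open>2 * C\<close>.\<close>
  define w where "w = min \<bar>v - v1\<bar> (t - s)"
  have w: "0 \<le> w" "s + w \<in> {s..t}" using st by (auto simp: w_def)
  have "geodesic_on {s..t} \<eta>" by (rule geodesic_on_subset[OF \<eta> _ J]) (use st in auto)
  note seg = geodesic_on_imp_quasi_geodesic[OF this]
  obtain v' where v': "v' \<in> {min v1 v2..max v1 v2}" "dist (\<eta> (s + w)) (\<alpha> v') \<le> C3"
    using morse_near[OF \<alpha> N v1(1) v2(1) seg v1(2) v2(2) w(2)] unfolding C3_def add_0 by blast
  have vI: "v \<in> I" "v' \<in> I" using v v' I by auto
  have d: "dist (\<alpha> v) (\<alpha> v') = \<bar>v - v'\<bar>" "dist (\<alpha> v1) (\<alpha> v') = \<bar>v1 - v'\<bar>"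
    "dist (\<alpha> v1) (\<alpha> v2) = \<bar>v1 - v2\<bar>" using g v1 v2 vI by auto
  have hd: "dist (\<eta> s) (\<eta> t) = t - s" "dist (\<eta> s) (\<eta> (s + w)) = w"
    using h[of s t] h[OF st(1) subsetD[OF J w(2)]] st w by auto
  have "\<bar>dist (\<alpha> v1) (\<alpha> v') - dist (\<eta> s) (\<eta> (s + w))\<bar> \<le> C + C3" using v1(2) v'(2) by metric
  then have 1: "\<bar>\<bar>v1 - v'\<bar> - w\<bar> \<le> C + C3" using d hd by simp
  have "dist (\<alpha> v1) (\<alpha> v2) \<le> dist (\<eta> s) (\<eta> t) + 2 * C" using v1(2) v2(2) by metric
  then have 2: "\<bar>v1 - v2\<bar> \<le> t - s + 2 * C" using d hd by simp
  have "\<bar>v - v1\<bar> \<le> \<bar>v1 - v2\<bar>" using v(1) by auto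
  then have 3: "\<bar>\<bar>v - v1\<bar> - w\<bar> \<le> 2 * C" using 2 st C0 by (auto simp: w_def min_def)
  \<comment> \<open>Both parameters lie on the same side of \<open>v1\<close>, so they can be
    compared through their distances to it.\<close>
  have "\<bar>v - v'\<bar> = \<bar>\<bar>v - v1\<bar> - \<bar>v1 - v'\<bar>\<bar>"
    using v(1) v'(1) by (cases "v1 \<le> v2") auto
  then have "\<bar>v - v'\<bar> \<le> 3 * C + C3" using 1 3 by linarith
  moreover have "dist (\<sigma> r) (\<eta> (s + w)) \<le> dist (\<sigma> r) (\<alpha> v) + dist (\<alpha> v) (\<alpha> v') + dist (\<eta> (s + w)) (\<alpha> v')"
    by metric
  ultimately have "dist (\<sigma> r) (\<eta> (s + w)) \<le> C2 + 3 * C + 2 * C3" using v(2) v'(2) d by linarith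
  then have "dist (\<sigma> r) (\<eta> (s + w)) \<le> near_gauge N C L e"
    by (simp add: near_gauge_def C2_def C3_def)
  then show "\<exists>v\<in>{s..t}. dist (\<sigma> r) (\<eta> v) \<le> near_gauge N C L e" using w(2) by blast
qed

text \<open>A quasi-geodesic with ends on different sides of \<open>c\<close> is cut at a point
  almost nearest to \<open>\<eta> c\<close>. Each piece, continued to \<open>\<eta> c\<close>, is a
  quasi-geodesic whose ends lie on one half of \<open>\<eta>\<close>.\<close>

lemma morse_geodesic_join:
  fixes \<eta> :: "real \<Rightarrow> 'a::proper_geodesic_space"
  assumes \<eta>: "geodesic_on J \<eta>" and c: "c \<in> J" and N: "morse_gauge N"
    and l: "morse_geodesic N (J \<inter> {..c}) \<eta>" and u: "morse_geodesic N (J \<inter> {c..}) \<eta>"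
  shows "morse_geodesic (join_gauge N) J \<eta>"
proof (rule morse_geodesicI[OF \<eta>])
  fix L e a b \<sigma> s t r
  assume \<sigma>: "quasi_geodesic L e {a..b} \<sigma>" and st: "s \<in> J" "t \<in> J" "s \<le> t"
    and ab: "\<sigma> a = \<eta> s" "\<sigma> b = \<eta> t" and r: "r \<in> {a..b}"
  note q = quasi_geodesicD[OF \<sigma>]
  have N0: "0 \<le> N L e" "0 \<le> N (3 * L) (e + 2)" using N q by (auto simp: morse_gauge_def)
  consider "t \<le> c" | "c \<le> s" | "s < c" "c < t" by linarith
  then show "\<exists>v\<in>{s..t}. dist (\<sigma> r) (\<eta> v) \<le> join_gauge N L e"
  proof cases
    case 1
    then have "\<exists>v\<in>{min s t..max s t}. dist (\<sigma> r) (\<eta> v) \<le> N L (e + 2 * 0) + 0 + 1"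
      by (intro morse_near[OF l N _ _ \<sigma>]) (use st ab r in auto)
    then show ?thesis using st N0 by (force simp: join_gauge_def)
  next
    case 2
    then have "\<exists>v\<in>{min s t..max s t}. dist (\<sigma> r) (\<eta> v) \<le> N L (e + 2 * 0) + 0 + 1"
      by (intro morse_near[OF u N _ _ \<sigma>]) (use st ab r in auto)
    then show ?thesis using st N0 by (force simp: join_gauge_def)
  next
    case 3
    have "\<exists>x\<in>\<sigma> ` {a..b}. \<forall>y\<in>\<sigma> ` {a..b}. dist (\<eta> c) x \<le> dist (\<eta> c) y + 1"
      by (rule ex_almost_nearest) (use r in auto)
    then obtain k where k: "k \<in> {a..b}"
      "\<And>t. t \<in> {a..b} \<Longrightarrow> dist (\<eta> c) (\<sigma> k) \<le> dist (\<eta> c) (\<sigma> t) + 1" by auto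
    show ?thesis
    proof (cases "r \<le> k")
      case True
      have "quasi_geodesic L e {a..k} \<sigma>" by (rule quasi_geodesic_subset[OF \<sigma>]) (use k in auto)
      then obtain \<tau> b' where \<tau>: "k \<le> b'" "quasi_geodesic (3 * L) (e + 2 * 1) {a..b'} \<tau>"
        "\<And>t. t \<in> {a..k} \<Longrightarrow> \<tau> t = \<sigma> t" "\<tau> b' = \<eta> c"
        by (rule concat_right[of _ _ _ _ _ "\<eta> c" 1]) (use k in auto)
      have "\<exists>v\<in>{min s c..max s c}. dist (\<tau> r) (\<eta> v) \<le> N (3 * L) ((e + 2 * 1) + 2 * 0) + 0 + 1"
        by (rule morse_near[OF l N _ _ \<tau>(2)]) (use st ab r k c True 3 \<tau> in auto)
      then obtain v where "v \<in> {s..c}" "dist (\<sigma> r) (\<eta> v) \<le> N (3 * L) (e + 2) + 1"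
        using \<tau>(3)[of r] r True 3 by auto
      then show ?thesis using 3 N0 by (intro bexI[of _ v]) (auto simp: join_gauge_def)
    next
      case False
      define m where "m = dist (\<eta> c) (\<sigma> k)"
      have m: "0 \<le> m" by (simp add: m_def)
      have "quasi_geodesic L e {k..b} \<sigma>" by (rule quasi_geodesic_subset[OF \<sigma>]) (use k in auto)
      then obtain \<tau> where \<tau>: "quasi_geodesic (3 * L) (e + 2 * 1) ({k - m..k} \<union> {k..b}) \<tau>"
        "\<And>t. t \<in> {k..b} \<Longrightarrow> \<tau> t = \<sigma> t" "\<tau> (k - m) = \<eta> c"
        unfolding m_def by (rule concat_left[of _ _ _ _ k "\<eta> c" 1]) (use k in auto)
      have I: "{k - m..k} \<union> {k..b} = {k - m..b}" using m k by auto
      have "\<exists>v\<in>{min c t..max c t}. dist (\<tau> r) (\<eta> v) \<le> N (3 * L) ((e + 2 * 1) + 2 * 0) + 0 + 1"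
        by (rule morse_near[OF u N _ _ \<tau>(1)[unfolded I]]) (use st ab r k c False 3 \<tau> m in auto)
      then obtain v where "v \<in> {c..t}" "dist (\<sigma> r) (\<eta> v) \<le> N (3 * L) (e + 2) + 1"
        using \<tau>(2)[of r] r False 3 by auto
      then show ?thesis using 3 N0 by (intro bexI[of _ v]) (auto simp: join_gauge_def)
    qed
  qed
qed

subsection \<open>Boundary points and lines\<close>

definition max_gauge :: "gauge \<Rightarrow> gauge \<Rightarrow> gauge" where
  "max_gauge N N' = (\<lambda>L e. max (N L e) (N' L e))"

lemma morse_gauge_max: "morse_gauge N \<Longrightarrow> morse_gauge N' \<Longrightarrow> morse_gauge (max_gauge N N')"
  by (force simp: morse_gauge_def max_gauge_def)

lemma morse_geodesic_max1: "morse_geodesic N I \<gamma> \<Longrightarrow> morse_geodesic (max_gauge N N') I \<gamma>"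
  by (rule morse_geodesic_mono) (auto simp: max_gauge_def)

lemma morse_geodesic_max2: "morse_geodesic N' I \<gamma> \<Longrightarrow> morse_geodesic (max_gauge N N') I \<gamma>"
  by (rule morse_geodesic_mono) (auto simp: max_gauge_def)

definition geo_line :: "'a::metric_space ideal \<Rightarrow> 'a ideal \<Rightarrow> (real \<Rightarrow> 'a) \<Rightarrow> bool" where
  "geo_line a b \<eta> \<longleftrightarrow> geodesic_on UNIV \<eta> \<and> tends_to (\<eta> ` {..0}) a \<and> tends_to (\<eta> ` {0..}) b"

text \<open>The strata measure gauges from the basepoint. Measuring them from an arbitrary
  \<open>x\<close> is what stays uniform as \<open>x\<close> moves through the space. The ray may
  start at distance \<open>K\<close> from \<open>x\<close>, since typical rays are halves of lines
  passing near \<open>x\<close>.\<close>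

definition sees :: "gauge \<Rightarrow> real \<Rightarrow> 'a::metric_space \<Rightarrow> 'a ideal \<Rightarrow> bool" where
  "sees N K x a \<longleftrightarrow>
     (\<exists>\<rho>. morse_geodesic N {0..} \<rho> \<and> dist x (\<rho> 0) \<le> K \<and> tends_to (\<rho> ` {0..}) a)"

lemma geodesic_from_to_boundary:
  "geodesic_from_to (Inr a) (Inr b) I \<eta> \<longleftrightarrow> I = UNIV \<and> geo_line a b \<eta>"
  by (auto simp: geo_line_def)

lemma sees_max1: "sees N K x a \<Longrightarrow> sees (max_gauge N N') K x a"
  unfolding sees_def using morse_geodesic_max1 by blast

lemma sees_max2: "sees N' K x a \<Longrightarrow> sees (max_gauge N N') K x a"
  unfolding sees_def using morse_geodesic_max2 by blast

lemma sees_near: "sees N K x a \<Longrightarrow> dist x' x + K \<le> K' \<Longrightarrow> sees N K' x' a"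
  unfolding sees_def by (meson add_left_mono dist_triangle order_trans)

lemma equiv_asymptotic_rays: "equiv {\<gamma>. geodesic_ray p \<gamma>} (asymptotic_rays p)"
proof (rule equivI)
  show "refl_on {\<gamma>. geodesic_ray p \<gamma>} (asymptotic_rays p)"
    by (auto simp: refl_on_def asymptotic_rays_def finite_hausdorff_refl)
  show "sym (asymptotic_rays p)"
    by (auto simp: sym_def asymptotic_rays_def intro: finite_hausdorff_sym)
  show "trans (asymptotic_rays p)"
    by (auto simp: trans_def asymptotic_rays_def intro: finite_hausdorff_trans)
qed (auto simp: asymptotic_rays_def)

lemma morse_boundary_subset: "morse_boundary p \<subseteq> visual_boundary p"
  by (auto simp: morse_boundary_def morse_stratum_def)

lemma boundary_ray: "a \<in> morse_boundary p \<Longrightarrow> \<rho> \<in> a \<Longrightarrow> geodesic_ray p \<rho>"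
  using morse_boundary_subset equiv_class_subset
  by (fastforce simp: visual_boundary_def quotient_def asymptotic_rays_def)

lemma boundary_asymptotic:
  "a \<in> morse_boundary p \<Longrightarrow> \<rho> \<in> a \<Longrightarrow> \<rho>' \<in> a \<Longrightarrow> finite_hausdorff (\<rho> ` {0..}) (\<rho>' ` {0..})"
  using morse_boundary_subset[of p] quotient_eq_iff[OF equiv_asymptotic_rays[of p], of a a \<rho> \<rho>']
  by (auto simp: visual_boundary_def asymptotic_rays_def)

lemma boundary_memI:
  assumes "a \<in> morse_boundary p" "\<rho> \<in> a" "geodesic_ray p \<rho>'" "finite_hausdorff (\<rho> ` {0..}) (\<rho>' ` {0..})"
  shows "\<rho>' \<in> a"
proof -
  have "(\<rho>, \<rho>') \<in> asymptotic_rays p"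
    using assms boundary_ray by (auto simp: asymptotic_rays_def)
  then show ?thesis
    using in_quotient_imp_closed[OF equiv_asymptotic_rays[of p]] assms morse_boundary_subset[of p]
    by (auto simp: visual_boundary_def)
qed

lemma boundary_eqI:
  assumes "a \<in> morse_boundary p" "b \<in> morse_boundary p" "\<rho> \<in> a" "\<rho>' \<in> b"
    "finite_hausdorff (\<rho> ` {0..}) (\<rho>' ` {0..})"
  shows "a = b"
proof -
  have "\<rho>' \<in> a" using boundary_memI assms boundary_ray by blast
  then show ?thesis
    using quotient_disj[OF equiv_asymptotic_rays[of p], of a b] assms morse_boundary_subset[of p]
    by (auto simp: visual_boundary_def)
qed

lemma tends_to_cong: "tends_to A a \<Longrightarrow> finite_hausdorff B A \<Longrightarrow> tends_to B a"
  unfolding tends_to_def using finite_hausdorff_trans by blast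

lemma tends_to_finite_hausdorff:
  "a \<in> morse_boundary p \<Longrightarrow> tends_to A a \<Longrightarrow> tends_to B a \<Longrightarrow> finite_hausdorff A B"
  unfolding tends_to_def using boundary_asymptotic finite_hausdorff_trans finite_hausdorff_sym by meson

lemma tends_to_ray: "\<rho> \<in> a \<Longrightarrow> tends_to (\<rho> ` {0..}) a"
  unfolding tends_to_def using finite_hausdorff_refl by blast

lemma morse_boundary_ray:
  assumes "a \<in> morse_boundary p"
  obtains N \<rho> where "morse_gauge N" "\<rho> \<in> a" "morse_geodesic N {0..} \<rho>"
  using assms by (auto simp: morse_boundary_def morse_stratum_def)

lemma boundary_sees:
  assumes "a \<in> morse_boundary p"
  obtains N where "morse_gauge N" "sees N 0 p a"
proof -
  obtain N \<rho> where *: "morse_gauge N" "\<rho> \<in> a" "morse_geodesic N {0..} \<rho>"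
    using morse_boundary_ray[OF assms] .
  have "\<rho> 0 = p" using boundary_ray[OF assms *(2)] by (simp add: geodesic_ray_def)
  then have "sees N 0 p a"
    unfolding sees_def by (intro exI[of _ \<rho>]) (simp add: * tends_to_ray)
  then show ?thesis using * that by blast
qed

lemma image_right: "(\<lambda>t. \<eta> (s + t :: real)) ` {0..} = \<eta> ` {s..}"
proof -
  have "(+) s ` {0..} = {s..}" by simp
  then show ?thesis using image_image[of \<eta> "(+) s" "{0..}"] by simp
qed

lemma image_left: "(\<lambda>t. \<eta> (s - t :: real)) ` {0..} = \<eta> ` {..s}"
proof -
  have "(-) s ` {0..} = {..s}" by simp
  then show ?thesis using image_image[of \<eta> "(-) s" "{0..}"] by simp
qed

lemma geo_line_geodesic: "geo_line a b \<eta> \<Longrightarrow> geodesic_on UNIV \<eta>"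
  by (simp add: geo_line_def)

lemma geo_line_dist: "geo_line a b \<eta> \<Longrightarrow> dist (\<eta> s) (\<eta> t) = \<bar>s - t\<bar>"
  by (simp add: geo_line_def geodesic_on_def)

lemma geo_line_right: "geo_line a b \<eta> \<Longrightarrow> tends_to (\<eta> ` {s..}) b"
  unfolding geo_line_def
  using quasi_geodesic_tail_right[OF geodesic_on_imp_quasi_geodesic, of UNIV] tends_to_cong
  by (metis subset_UNIV)

lemma geo_line_left: "geo_line a b \<eta> \<Longrightarrow> tends_to (\<eta> ` {..s}) a"
  unfolding geo_line_def
  using quasi_geodesic_tail_left[OF geodesic_on_imp_quasi_geodesic] tends_to_cong
  by blast

lemma geo_line_right_ray:
  assumes "geo_line a b \<eta>"
  shows "geodesic_on {0..} (\<lambda>t. \<eta> (s + t))" "tends_to ((\<lambda>t. \<eta> (s + t)) ` {0..}) b"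
    "morse_geodesic N UNIV \<eta> \<Longrightarrow> morse_geodesic N {0..} (\<lambda>t. \<eta> (s + t))"
  using geodesic_on_affine[of UNIV \<eta> 1 "{0..}" s] morse_geodesic_affine[where N = N and I = UNIV and \<gamma> = \<eta> and k = 1 and J = "{0..}" and c = s]
    geo_line_right[OF assms] geo_line_geodesic[OF assms] by (simp_all add: image_right)

lemma geo_line_left_ray:
  assumes "geo_line a b \<eta>"
  shows "geodesic_on {0..} (\<lambda>t. \<eta> (s - t))" "tends_to ((\<lambda>t. \<eta> (s - t)) ` {0..}) a"
    "morse_geodesic N UNIV \<eta> \<Longrightarrow> morse_geodesic N {0..} (\<lambda>t. \<eta> (s - t))"
  using geodesic_on_affine[of UNIV \<eta> "-1" "{0..}" s] morse_geodesic_affine[where N = N and I = UNIV and \<gamma> = \<eta> and k = "-1" and J = "{0..}" and c = s]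
    geo_line_left[OF assms] geo_line_geodesic[OF assms] by (simp_all add: image_left)

lemma geo_line_reverse: "geo_line a b \<eta> \<Longrightarrow> geo_line b a (\<lambda>t. \<eta> (-t))"
  using geodesic_on_affine[of UNIV \<eta> "-1" UNIV 0] image_left[of \<eta> 0]
    image_image[of \<eta> uminus "{..0}"]
  by (simp add: geo_line_def)

lemma geo_line_sees:
  assumes "geo_line a b \<eta>" "morse_geodesic N UNIV \<eta>" "dist x (\<eta> s) \<le> K"
  shows "sees N K x a" "sees N K x b"
proof -
  show "sees N K x a"
    unfolding sees_def using geo_line_left_ray(2,3)[OF assms(1)] assms(2,3)
    by (intro exI[of _ "\<lambda>t. \<eta> (s - t)"]) simp
  show "sees N K x b"
    unfolding sees_def using geo_line_right_ray(2,3)[OF assms(1)] assms(2,3)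
    by (intro exI[of _ "\<lambda>t. \<eta> (s + t)"]) simp
qed

text \<open>The inner constant is the bound of \<open>quasi_line_near_morse_rays\<close> for
  \<open>L = 1\<close> and \<open>e = 0\<close>. The halves of the line are near the two rays
  (\<open>near_gauge\<close>) and are then joined (\<open>join_gauge\<close>).\<close>

definition line_gauge :: "gauge \<Rightarrow> real \<Rightarrow> gauge" where
  "line_gauge N K = join_gauge (near_gauge N (N 9 (4 + 2 * K) + K + 1))"

lemma morse_gauge_line: "morse_gauge N \<Longrightarrow> 0 \<le> K \<Longrightarrow> morse_gauge (line_gauge N K)"
  unfolding line_gauge_def
  by (intro morse_gauge_join morse_gauge_near) (simp_all add: morse_gauge_def)

text \<open>Cut near \<open>x\<close>, the line has halves that stay close to the two rays. The
  resulting gauge depends on \<open>N\<close> and \<open>K\<close> only, not on \<open>a\<close> and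
  \<open>b\<close>; every uniform choice of gauge later rests on this.\<close>

lemma sees_imp_line_morse:
  fixes x :: "'a::proper_geodesic_space"
  assumes "a \<in> morse_boundary p" "b \<in> morse_boundary p" "morse_gauge N"
    and "sees N K x a" "sees N K x b" and \<eta>: "geo_line a b \<eta>"
  shows "morse_geodesic (line_gauge N K) UNIV \<eta>"
proof -
  obtain \<rho>1 where \<rho>1: "morse_geodesic N {0..} \<rho>1" "dist x (\<rho>1 0) \<le> K" "tends_to (\<rho>1 ` {0..}) a"
    using assms by (auto simp: sees_def)
  obtain \<rho>2 where \<rho>2: "morse_geodesic N {0..} \<rho>2" "dist x (\<rho>2 0) \<le> K" "tends_to (\<rho>2 ` {0..}) b"
    using assms by (auto simp: sees_def)
  have K0: "0 \<le> K" using \<rho>1(2) zero_le_dist order_trans by blast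
  define C where "C = N 9 (4 + 2 * K) + K + 1"
  have C0: "0 \<le> C" using assms(3) K0 by (simp add: C_def morse_gauge_def)
  have "\<exists>s. (\<forall>t\<le>s. \<exists>v\<ge>0. dist (\<eta> t) (\<rho>1 v) \<le> N (9 * 1) (0 + 4 + 2 * K) + K + 1) \<and>
            (\<forall>t\<ge>s. \<exists>v\<ge>0. dist (\<eta> t) (\<rho>2 v) \<le> N (9 * 1) (0 + 4 + 2 * K) + K + 1)"
  proof (rule quasi_line_near_morse_rays[OF assms(3) \<rho>1(1) \<rho>2(1) _ _ _ \<rho>1(2) \<rho>2(2)])
    show "quasi_geodesic 1 0 UNIV \<eta>"
      using geo_line_geodesic[OF \<eta>] geodesic_on_imp_quasi_geodesic by blast
    show "finite_hausdorff (\<eta> ` {..0}) (\<rho>1 ` {0..})"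
      using tends_to_finite_hausdorff[OF assms(1) geo_line_left[OF \<eta>] \<rho>1(3)] .
    show "finite_hausdorff (\<eta> ` {0..}) (\<rho>2 ` {0..})"
      using tends_to_finite_hausdorff[OF assms(2) geo_line_right[OF \<eta>] \<rho>2(3)] .
  qed
  then obtain s where s: "\<And>t. t \<le> s \<Longrightarrow> \<exists>v\<ge>0. dist (\<eta> t) (\<rho>1 v) \<le> C"
    "\<And>t. t \<ge> s \<Longrightarrow> \<exists>v\<ge>0. dist (\<eta> t) (\<rho>2 v) \<le> C" by (auto simp: C_def)
  have g: "geodesic_on J \<eta>" if "closed_interval J" for J
    using geodesic_on_subset[OF geo_line_geodesic[OF \<eta>] that] by simp
  have "morse_geodesic (near_gauge N C) {..s} \<eta>"
    by (rule morse_geodesic_near[OF \<rho>1(1) assms(3) g]) (use s in auto)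
  moreover have "morse_geodesic (near_gauge N C) {s..} \<eta>"
    by (rule morse_geodesic_near[OF \<rho>2(1) assms(3) g]) (use s in auto)
  ultimately show ?thesis
    unfolding line_gauge_def C_def[symmetric]
    by (intro morse_geodesic_join[where c = s])
       (use geo_line_geodesic[OF \<eta>] morse_gauge_near[OF assms(3) C0] in auto)
qed

text \<open>The two halves of \<open>\<eta>\<close> issuing from \<open>\<eta> t\<close> play the
  role of the Morse rays, with \<open>x = \<eta> t\<close>. Besides nearness the statement keeps the
  order: parameters on either side of \<open>s\<close> correspond to points on the same side of
  \<open>t\<close>.\<close>

lemma morse_line_near_quasi_line:
  fixes \<eta> :: "real \<Rightarrow> 'a::proper_geodesic_space"
  assumes N: "morse_gauge N" and \<eta>: "morse_geodesic N UNIV \<eta>"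
    and \<zeta>: "quasi_geodesic L e UNIV \<zeta>"
    and fh: "finite_hausdorff (\<zeta> ` {..0}) (\<eta> ` {..0})" "finite_hausdorff (\<zeta> ` {0..}) (\<eta> ` {0..})"
    and C: "C = N (9 * L) (e + 4) + 1"
  shows "\<exists>s. dist (\<eta> t) (\<zeta> s) \<le> 3 * C \<and>
    (\<forall>r\<le>s. \<exists>v\<le>t. dist (\<zeta> r) (\<eta> v) \<le> C) \<and> (\<forall>r\<ge>s. \<exists>v\<ge>t. dist (\<zeta> r) (\<eta> v) \<le> C)"
proof -
  have q: "quasi_geodesic 1 0 UNIV \<eta>"
    using \<eta> geodesic_on_imp_quasi_geodesic morse_geodesicD_geodesic by blast
  have "\<exists>s. (\<forall>r\<le>s. \<exists>v\<ge>0. dist (\<zeta> r) (\<eta> (t - v)) \<le> N (9 * L) (e + 4 + 2 * 0) + 0 + 1) \<and>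
            (\<forall>r\<ge>s. \<exists>v\<ge>0. dist (\<zeta> r) (\<eta> (t + v)) \<le> N (9 * L) (e + 4 + 2 * 0) + 0 + 1)"
  proof (rule quasi_line_near_morse_rays[OF N _ _ \<zeta>, of _ _ "\<eta> t"])
    show "morse_geodesic N {0..} (\<lambda>v. \<eta> (t - v))" "morse_geodesic N {0..} (\<lambda>v. \<eta> (t + v))"
      using morse_geodesic_affine[OF \<eta>, where k = "-1" and J = "{0..}" and c = t] morse_geodesic_affine[OF \<eta>, where k = 1 and J = "{0..}" and c = t]
      by simp_all
    show "finite_hausdorff (\<zeta> ` {..0}) ((\<lambda>v. \<eta> (t - v)) ` {0..})"
      unfolding image_left by (rule finite_hausdorff_trans[OF fh(1) quasi_geodesic_tail_left[OF q]])
    show "finite_hausdorff (\<zeta> ` {0..}) ((\<lambda>v. \<eta> (t + v)) ` {0..})"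
      unfolding image_right by (rule finite_hausdorff_trans[OF fh(2) quasi_geodesic_tail_right[OF q]]) auto
  qed auto
  then obtain s where s: "\<And>r. r \<le> s \<Longrightarrow> \<exists>v\<ge>0. dist (\<zeta> r) (\<eta> (t - v)) \<le> C"
    "\<And>r. r \<ge> s \<Longrightarrow> \<exists>v\<ge>0. dist (\<zeta> r) (\<eta> (t + v)) \<le> C" using C by auto
  obtain v where v: "v \<ge> 0" "dist (\<zeta> s) (\<eta> (t - v)) \<le> C" using s(1) by blast
  obtain w where w: "w \<ge> 0" "dist (\<zeta> s) (\<eta> (t + w)) \<le> C" using s(2) by blast
  have d: "dist (\<eta> (t - v)) (\<eta> (t + w)) = v + w" "dist (\<eta> t) (\<eta> (t - v)) = v"
    using geodesic_on_dist[OF morse_geodesicD_geodesic[OF \<eta>]] v w by auto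
  \<comment> \<open>The cut point is close to both halves of \<open>\<eta>\<close>, so the two
    nearby points of \<open>\<eta>\<close> are close to each other and hence to
    \<open>\<eta> t\<close>, which lies between them.\<close>
  have "dist (\<eta> (t - v)) (\<eta> (t + w)) \<le> 2 * C" using v w by metric
  then have "v \<le> 2 * C" using d w by simp
  moreover have "dist (\<eta> t) (\<zeta> s) \<le> dist (\<eta> t) (\<eta> (t - v)) + dist (\<zeta> s) (\<eta> (t - v))" by metric
  ultimately have "dist (\<eta> t) (\<zeta> s) \<le> 3 * C" using d v by simp
  moreover have "\<exists>v\<le>t. dist (\<zeta> r) (\<eta> v) \<le> C" if "r \<le> s" for r
    using s(1)[OF that] by (metis diff_le_eq le_add_same_cancel1)
  moreover have "\<exists>v\<ge>t. dist (\<zeta> r) (\<eta> v) \<le> C" if "r \<ge> s" for r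
    using s(2)[OF that] by (metis le_add_same_cancel1)
  ultimately show ?thesis by blast
qed

subsection \<open>Existence of lines\<close>

text \<open>One-sided closeness suffices: both rays have unit speed, so \<open>v\<close> differs
  from \<open>r\<close> by a bounded amount and points with equal parameters are close.\<close>

lemma geodesic_ray_finite_hausdorff:
  assumes "geodesic_on {0..} \<gamma>" "geodesic_on {0..} \<rho>" and E: "\<And>r. r \<ge> 0 \<Longrightarrow> \<exists>v\<ge>0. dist (\<gamma> r) (\<rho> v) \<le> E"
  shows "finite_hausdorff (\<gamma> ` {0..}) (\<rho> ` {0..})"
proof -
  define D where "D = dist (\<gamma> 0) (\<rho> 0)"
  have near: "dist (\<rho> r) (\<gamma> r) \<le> 2 * E + D" if r: "r \<ge> 0" for r
  proof -
    obtain v where v: "v \<ge> 0" "dist (\<gamma> r) (\<rho> v) \<le> E" using E[OF r] by blast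
    have d: "dist (\<gamma> 0) (\<gamma> r) = r" "dist (\<rho> 0) (\<rho> v) = v" "dist (\<rho> r) (\<rho> v) = \<bar>r - v\<bar>"
      using geodesic_on_dist[OF assms(1)] geodesic_on_dist[OF assms(2)] r v by auto
    have "\<bar>dist (\<gamma> 0) (\<gamma> r) - dist (\<rho> 0) (\<rho> v)\<bar> \<le> E + D" using v(2) unfolding D_def by metric
    moreover have "dist (\<rho> r) (\<gamma> r) \<le> dist (\<rho> r) (\<rho> v) + dist (\<gamma> r) (\<rho> v)" by metric
    ultimately show ?thesis using v(2) d by simp
  qed
  show ?thesis
    unfolding finite_hausdorff_def
    by (rule exI[of _ "2 * E + D"]) (use near in \<open>force simp: dist_commute\<close>)
qed

text \<open>Far out the segment of \<open>\<rho>'\<close> from its origin to a meeting time has both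
  ends within \<open>D\<close> of \<open>\<rho>\<close>, with \<open>D\<close> independent of that
  time, so the Morse bound is uniform. It is applied in contrapositive form: rays to distinct
  boundary points are close only in a bounded region.\<close>

lemma morse_ray_asymptotic:
  assumes \<rho>: "morse_geodesic N {0..} \<rho>" "morse_gauge N" and \<rho>': "geodesic_on {0..} \<rho>'"
    and close: "\<And>M. \<exists>s>M. \<exists>t\<ge>0. dist (\<rho> s) (\<rho>' t) \<le> C"
  shows "finite_hausdorff (\<rho>' ` {0..}) (\<rho> ` {0..})"
proof (rule geodesic_ray_finite_hausdorff[OF \<rho>' morse_geodesicD_geodesic[OF \<rho>(1)]])
  define D where "D = max C (dist (\<rho>' 0) (\<rho> 0))"
  fix r :: real assume r: "0 \<le> r"
  have D0: "0 \<le> D" by (simp add: D_def le_max_iff_disj)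
  \<comment> \<open>The margin \<open>2 * D\<close> makes the meeting time \<open>t\<close> on
    \<open>\<rho>'\<close> at least \<open>r\<close>.\<close>
  obtain s t where st: "s > r + 2 * D" "t \<ge> 0" "dist (\<rho> s) (\<rho>' t) \<le> C" using close by blast
  have s0: "s \<ge> 0" using st r D0 by linarith
  have d: "dist (\<rho> 0) (\<rho> s) = s" "dist (\<rho>' 0) (\<rho>' t) = t"
    using geodesic_on_dist[OF \<rho>'] geodesic_on_dist[OF morse_geodesicD_geodesic[OF \<rho>(1)]] s0 st by auto
  have near: "dist (\<rho>' 0) (\<rho> 0) \<le> D" "dist (\<rho>' t) (\<rho> s) \<le> D"
    using st(3) by (auto simp: D_def dist_commute)
  have "dist (\<rho> 0) (\<rho> s) \<le> dist (\<rho>' 0) (\<rho>' t) + 2 * D" using near by metric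
  then have "r \<le> t" using d st by simp
  have "geodesic_on {0..t} \<rho>'" by (rule geodesic_on_subset[OF \<rho>']) (use st in auto)
  then have "quasi_geodesic 1 0 {0..t} \<rho>'" by (rule geodesic_on_imp_quasi_geodesic)
  then have "\<exists>v\<in>{min 0 s..max 0 s}. dist (\<rho>' r) (\<rho> v) \<le> N 1 (0 + 2 * D) + D + 1"
    by (rule morse_near[OF \<rho>, rotated 2]) (use s0 near r \<open>r \<le> t\<close> in auto)
  then show "\<exists>v\<ge>0. dist (\<rho>' r) (\<rho> v) \<le> N 1 (0 + 2 * D) + D + 1" using s0 by auto
qed

text \<open>Compactness of a product of balls replaces Arzela-Ascoli and a diagonal sequence.
  Simultaneous approximation at two times is enough to pass distances to the limit.\<close>

lemma pointwise_cluster: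
  fixes g :: "nat \<Rightarrow> real \<Rightarrow> 'a::proper_geodesic_space"
  assumes g: "\<And>n t. g n t \<in> cball x (B t)"
  obtains \<gamma> where "\<And>s t \<epsilon> n0. \<epsilon> > 0 \<Longrightarrow> \<exists>n\<ge>n0. dist (g n s) (\<gamma> s) < \<epsilon> \<and> dist (g n t) (\<gamma> t) < \<epsilon>"
proof -
  define Q where "Q = PiE UNIV (\<lambda>t. cball x (B t))"
  have "compactin (product_topology (\<lambda>_. euclidean) UNIV) Q"
    unfolding Q_def compactin_PiE by (simp add: compact_cball_proper)
  then have "compact Q" by (simp add: euclidean_product_topology)
  define F where "F = filtermap g sequentially"
  have "F \<noteq> bot" by (simp add: F_def filtermap_bot_iff)
  moreover have "eventually (\<lambda>x. x \<in> Q) F"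
    using g by (simp add: F_def eventually_filtermap Q_def PiE_iff)
  \<comment> \<open>This says that \<open>\<gamma>\<close> is a cluster point of the sequence
    \<open>g\<close> in the product topology.\<close>
  ultimately obtain \<gamma> where \<gamma>: "inf (nhds \<gamma>) F \<noteq> bot"
    using \<open>compact Q\<close> unfolding compact_filter by blast
  show ?thesis
  proof (rule that)
    fix s t \<epsilon> :: real and n0 assume \<epsilon>: "\<epsilon> > 0"
    define V where "V = (\<lambda>f::real \<Rightarrow> 'a. f s) -` ball (\<gamma> s) \<epsilon> \<inter> (\<lambda>f. f t) -` ball (\<gamma> t) \<epsilon>"
    have "open V"
      unfolding V_def by (intro open_Int open_vimage open_ball continuous_on_product_coordinates)
    then have "eventually (\<lambda>f. f \<in> V) (nhds \<gamma>)" using \<epsilon> by (intro eventually_nhds_in_open) (auto simp: V_def)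
    moreover have "eventually (\<lambda>f. f \<in> g ` {n0..}) F"
      unfolding F_def eventually_filtermap using eventually_ge_at_top[of n0] by eventually_elim auto
    ultimately have "eventually (\<lambda>f. f \<in> V \<and> f \<in> g ` {n0..}) (inf (nhds \<gamma>) F)"
      unfolding eventually_inf by blast
    then obtain f where "f \<in> V" "f \<in> g ` {n0..}"
      using eventually_happens'[OF \<gamma>] by blast
    then show "\<exists>n\<ge>n0. dist (g n s) (\<gamma> s) < \<epsilon> \<and> dist (g n t) (\<gamma> t) < \<epsilon>"
      by (auto simp: V_def dist_commute)
  qed
qed

text \<open>The third side is cut at a point almost nearest to \<open>p\<close>. Each piece,
  continued to \<open>p\<close>, is a quasi-geodesic with constants 3 and 2 and both ends on one of
  the rays.\<close>

lemma triangle_split: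
  fixes p :: "'a::proper_geodesic_space"
  assumes N: "morse_gauge N" and \<rho>: "morse_geodesic N {0..} \<rho>1" "morse_geodesic N {0..} \<rho>2"
    and p: "\<rho>1 0 = p" "\<rho>2 0 = p" and n: "0 \<le> n"
  shows "\<exists>\<gamma> c d. 0 \<le> c \<and> c \<le> d \<and> geodesic_on {0..d} \<gamma> \<and> \<gamma> 0 = \<rho>1 n \<and> \<gamma> d = \<rho>2 n \<and>
    (\<forall>t\<in>{0..c}. \<exists>v\<ge>0. dist (\<gamma> t) (\<rho>1 v) \<le> N 3 2 + 1) \<and>
    (\<forall>t\<in>{c..d}. \<exists>v\<ge>0. dist (\<gamma> t) (\<rho>2 v) \<le> N 3 2 + 1)"
proof -
  define d where "d = dist (\<rho>1 n) (\<rho>2 n)"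
  have d: "0 \<le> d" by (simp add: d_def)
  obtain \<gamma> where \<gamma>: "geodesic_on {0..d} \<gamma>" "\<gamma> 0 = \<rho>1 n" "\<gamma> d = \<rho>2 n"
    unfolding d_def by (rule geodesic_segment_exists)
  have "\<exists>x\<in>\<gamma> ` {0..d}. \<forall>y\<in>\<gamma> ` {0..d}. dist p x \<le> dist p y + 1"
    by (rule ex_almost_nearest) (use d in auto)
  then obtain c where c: "c \<in> {0..d}" "\<And>t. t \<in> {0..d} \<Longrightarrow> dist p (\<gamma> c) \<le> dist p (\<gamma> t) + 1" by auto
  have q: "quasi_geodesic 1 0 J \<gamma>" if "closed_interval J" "J \<subseteq> {0..d}" for J
    using \<gamma>(1) that geodesic_on_subset geodesic_on_imp_quasi_geodesic by blast
  have "\<exists>v\<ge>0. dist (\<gamma> t) (\<rho>1 v) \<le> N 3 2 + 1" if t: "t \<in> {0..c}" for t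
  proof -
    obtain \<tau> b where \<tau>: "c \<le> b" "quasi_geodesic (3 * 1) (0 + 2 * 1) {0..b} \<tau>"
        "\<And>t. t \<in> {0..c} \<Longrightarrow> \<tau> t = \<gamma> t" "\<tau> b = p"
      by (rule concat_right[OF q, of 0 c p 1]) (use c in auto)
    have "\<exists>v\<in>{min n 0..max n 0}. dist (\<tau> t) (\<rho>1 v) \<le> N (3 * 1) ((0 + 2 * 1) + 2 * 0) + 0 + 1"
      by (rule morse_near[OF \<rho>(1) N _ _ \<tau>(2)]) (use \<tau> \<gamma> t n p in auto)
    then show ?thesis using \<tau>(3)[OF t] n by auto
  qed
  moreover have "\<exists>v\<ge>0. dist (\<gamma> t) (\<rho>2 v) \<le> N 3 2 + 1" if t: "t \<in> {c..d}" for t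
  proof -
    define l where "l = dist p (\<gamma> c)"
    have l: "0 \<le> l" by (simp add: l_def)
    obtain \<tau> where \<tau>: "quasi_geodesic (3 * 1) (0 + 2 * 1) ({c - l..c} \<union> {c..d}) \<tau>"
        "\<And>t. t \<in> {c..d} \<Longrightarrow> \<tau> t = \<gamma> t" "\<tau> (c - l) = p"
      unfolding l_def by (rule concat_left[OF q, of "{c..d}" c p 1]) (use c in auto)
    have I: "{c - l..c} \<union> {c..d} = {c - l..d}" using l c by auto
    have "\<exists>v\<in>{min 0 n..max 0 n}. dist (\<tau> t) (\<rho>2 v) \<le> N (3 * 1) ((0 + 2 * 1) + 2 * 0) + 0 + 1"
      by (rule morse_near[OF \<rho>(2) N _ _ \<tau>(1)[unfolded I]]) (use \<tau> \<gamma> t n p l c in auto)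
    then show ?thesis using \<tau>(2)[OF t] n by auto
  qed
  ultimately show ?thesis using c(1) \<gamma> by (intro exI[of _ \<gamma>] exI[of _ c] exI[of _ d]) auto
qed

text \<open>The line is a limit of segments from \<open>\<rho>1 n\<close> to
  \<open>\<rho>2 n\<close>. They all pass through a fixed ball around \<open>p\<close>, since
  otherwise the two rays would be close to each other arbitrarily far out and hence
  asymptotic.\<close>

lemma geo_line_exists:
  fixes p :: "'a::proper_geodesic_space"
  assumes ab: "a \<in> morse_boundary p" "b \<in> morse_boundary p" "a \<noteq> b"
  obtains \<eta> where "geo_line a b \<eta>"
proof -
  obtain N1 \<rho>1 where 1: "morse_gauge N1" "\<rho>1 \<in> a" "morse_geodesic N1 {0..} \<rho>1"
    using morse_boundary_ray[OF ab(1)] .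
  obtain N2 \<rho>2 where 2: "morse_gauge N2" "\<rho>2 \<in> b" "morse_geodesic N2 {0..} \<rho>2"
    using morse_boundary_ray[OF ab(2)] .
  define N where "N = max_gauge N1 N2"
  have N: "morse_gauge N" "morse_geodesic N {0..} \<rho>1" "morse_geodesic N {0..} \<rho>2"
    using 1 2 by (simp_all add: N_def morse_gauge_max morse_geodesic_max1 morse_geodesic_max2)
  note g1 = geodesic_on_dist[OF morse_geodesicD_geodesic[OF N(2)]]
    and g2 = geodesic_on_dist[OF morse_geodesicD_geodesic[OF N(3)]]
  have p: "\<rho>1 0 = p" "\<rho>2 0 = p"
    using boundary_ray ab 1 2 by (auto simp: geodesic_ray_def)
  define C where "C = N 3 2 + 1"
  have C0: "0 \<le> C" using N(1) by (simp add: C_def morse_gauge_def)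
  have "\<not> finite_hausdorff (\<rho>2 ` {0..}) (\<rho>1 ` {0..})"
    using boundary_eqI[OF ab(2,1)] ab(3) 1 2 by blast
  then have "\<not> (\<forall>M. \<exists>s>M. \<exists>t\<ge>0. dist (\<rho>1 s) (\<rho>2 t) \<le> 2 * C)"
    using morse_ray_asymptotic[OF N(2,1) morse_geodesicD_geodesic[OF N(3)]] by blast
  then obtain M where M: "\<And>s t. t \<ge> 0 \<Longrightarrow> dist (\<rho>1 s) (\<rho>2 t) \<le> 2 * C \<Longrightarrow> s \<le> M" by (meson not_le)
  \<comment> \<open>The cut point of the \<open>n\<close>-th segment is within \<open>C\<close> of
    both rays, so the nearby point of \<open>\<rho>1\<close> has parameter at most
    \<open>M\<close>.\<close>
  define B where "B = C + M"
  have "\<forall>n::nat. \<exists>\<gamma> c d. 0 \<le> c \<and> c \<le> d \<and> geodesic_on {0..d} \<gamma> \<and> \<gamma> 0 = \<rho>1 n \<and> \<gamma> d = \<rho>2 n \<and>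
    (\<forall>t\<in>{0..c}. \<exists>v\<ge>0. dist (\<gamma> t) (\<rho>1 v) \<le> C) \<and> (\<forall>t\<in>{c..d}. \<exists>v\<ge>0. dist (\<gamma> t) (\<rho>2 v) \<le> C)"
    unfolding C_def using triangle_split[OF N p] by simp
  then obtain \<gamma> :: "nat \<Rightarrow> real \<Rightarrow> 'a" and c d :: "nat \<Rightarrow> real" where \<gamma>: "\<And>n::nat. 0 \<le> c n \<and> c n \<le> d n \<and> geodesic_on {0..d n} (\<gamma> n) \<and>
      \<gamma> n 0 = \<rho>1 n \<and> \<gamma> n (d n) = \<rho>2 n \<and>
      (\<forall>t\<in>{0..c n}. \<exists>v\<ge>0. dist (\<gamma> n t) (\<rho>1 v) \<le> C) \<and>
      (\<forall>t\<in>{c n..d n}. \<exists>v\<ge>0. dist (\<gamma> n t) (\<rho>2 v) \<le> C)"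
    by metis
  have gn: "dist (\<gamma> n s) (\<gamma> n t) = \<bar>s - t\<bar>" if "s \<in> {0..d n}" "t \<in> {0..d n}" for n s t
    using geodesic_on_dist that \<gamma> by blast
  have cB: "dist p (\<gamma> n (c n)) \<le> B" for n
  proof -
    obtain v where v: "v \<ge> 0" "dist (\<gamma> n (c n)) (\<rho>1 v) \<le> C" using \<gamma>[of n] by force
    obtain w where w: "w \<ge> 0" "dist (\<gamma> n (c n)) (\<rho>2 w) \<le> C" using \<gamma>[of n] by force
    have "dist (\<rho>1 v) (\<rho>2 w) \<le> 2 * C" using v w by metric
    then have "v \<le> M" using M w by blast
    moreover have "dist p (\<rho>1 v) = v" using g1[of 0 v] p v by simp
    moreover have "dist p (\<gamma> n (c n)) \<le> dist p (\<rho>1 v) + dist (\<gamma> n (c n)) (\<rho>1 v)" by metric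
    ultimately show ?thesis using v by (simp add: B_def)
  qed
  have cn: "real n - B \<le> c n" "real n - B \<le> d n - c n" for n
  proof -
    have "dist p (\<rho>1 n) = n" "dist p (\<rho>2 n) = n" using g1[of 0 n] g2[of 0 n] p by auto
    moreover have "dist (\<rho>1 n) (\<gamma> n (c n)) = c n" "dist (\<gamma> n (c n)) (\<rho>2 n) = d n - c n"
      using gn[of 0 n "c n"] gn[of "c n" n "d n"] \<gamma>[of n] by auto
    moreover have "dist p (\<rho>1 n) \<le> dist p (\<gamma> n (c n)) + dist (\<rho>1 n) (\<gamma> n (c n))"
      "dist p (\<rho>2 n) \<le> dist p (\<gamma> n (c n)) + dist (\<gamma> n (c n)) (\<rho>2 n)" by metric+
    ultimately show "real n - B \<le> c n" "real n - B \<le> d n - c n" using cB[of n] by auto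
  qed
  have B0: "0 \<le> B" using cB[of 0] zero_le_dist order_trans by blast
  \<comment> \<open>The shift puts the cut points at time 0. The value \<open>p\<close> outside the
    domain only keeps every function inside the required balls; for a fixed \<open>t\<close> it does
    not occur once \<open>n\<close> is large.\<close>
  define h where "h n t = (if c n + t \<in> {0..d n} then \<gamma> n (c n + t) else p)" for n t
  have "h n t \<in> cball p (B + \<bar>t\<bar>)" for n t
  proof (cases "c n + t \<in> {0..d n}")
    case True
    have "dist p (\<gamma> n (c n + t)) \<le> dist p (\<gamma> n (c n)) + dist (\<gamma> n (c n)) (\<gamma> n (c n + t))" by metric
    also have "dist (\<gamma> n (c n)) (\<gamma> n (c n + t)) = \<bar>t\<bar>" using gn[of "c n" n "c n + t"] True \<gamma>[of n] by auto
    finally show ?thesis using cB[of n] True by (simp add: h_def)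
  qed (use B0 in \<open>auto simp: h_def\<close>)
  then obtain \<eta> where \<eta>: "\<And>s t \<epsilon> n0. \<epsilon> > 0 \<Longrightarrow> \<exists>n\<ge>n0. dist (h n s) (\<eta> s) < \<epsilon> \<and> dist (h n t) (\<eta> t) < \<epsilon>"
    using pointwise_cluster[of h p "\<lambda>t. B + \<bar>t\<bar>"] by blast
  have hn: "h n t = \<gamma> n (c n + t)" "c n + t \<in> {0..d n}" if "real n \<ge> B + \<bar>t\<bar>" for n t
    using cn[of n] that by (auto simp: h_def)
  have geo: "geodesic_on UNIV \<eta>"
    unfolding geodesic_on_def
  proof (intro conjI ballI)
    fix s t :: real
    have "\<bar>dist (\<eta> s) (\<eta> t) - \<bar>s - t\<bar>\<bar> \<le> 0"
    proof (rule field_le_epsilon)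
      fix \<epsilon> :: real assume "\<epsilon> > 0"
      obtain n0 :: nat where n0: "real n0 \<ge> B + \<bar>s\<bar> + \<bar>t\<bar>" using real_arch_simple by blast
      obtain n where n: "n \<ge> n0" "dist (h n s) (\<eta> s) < \<epsilon> / 2" "dist (h n t) (\<eta> t) < \<epsilon> / 2"
        using \<eta>[of "\<epsilon> / 2" n0 s t] \<open>\<epsilon> > 0\<close> by auto
      have "real n \<ge> B + \<bar>s\<bar> + \<bar>t\<bar>" using n n0 by linarith
      then have "dist (h n s) (h n t) = \<bar>s - t\<bar>"
        using hn[where n = n and t = s] hn[where n = n and t = t] gn[of "c n + s" n "c n + t"] by auto
      moreover have "\<bar>dist (\<eta> s) (\<eta> t) - dist (h n s) (h n t)\<bar> \<le> dist (h n s) (\<eta> s) + dist (h n t) (\<eta> t)"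
        by metric
      ultimately show "\<bar>dist (\<eta> s) (\<eta> t) - \<bar>s - t\<bar>\<bar> \<le> 0 + \<epsilon>" using n by linarith
    qed
    then show "dist (\<eta> s) (\<eta> t) = \<bar>s - t\<bar>" by simp
  qed simp
  have approx: "\<exists>n. c n + t \<in> {0..d n} \<and> dist (\<eta> t) (\<gamma> n (c n + t)) < 1" for t
  proof -
    obtain n0 :: nat where n0: "real n0 \<ge> B + \<bar>t\<bar>" using real_arch_simple by blast
    obtain n where n: "n \<ge> n0" "dist (h n t) (\<eta> t) < 1" using \<eta>[of 1 n0 t t] by auto
    have "real n \<ge> B + \<bar>t\<bar>" using n n0 by linarith
    then show ?thesis using hn[of t n] n by (auto simp: dist_commute)
  qed
  have near1: "\<exists>v\<ge>0. dist (\<eta> t) (\<rho>1 v) \<le> C + 1" if "t \<le> 0" for t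
  proof -
    obtain n where n: "c n + t \<in> {0..d n}" "dist (\<eta> t) (\<gamma> n (c n + t)) < 1" using approx by blast
    moreover have "c n + t \<in> {0..c n}" using n(1) that by auto
    ultimately obtain v where "v \<ge> 0" "dist (\<gamma> n (c n + t)) (\<rho>1 v) \<le> C" using \<gamma>[of n] by blast
    then show ?thesis using n(2) dist_triangle[of "\<eta> t" "\<rho>1 v" "\<gamma> n (c n + t)"] by (intro exI[of _ v]) auto
  qed
  have near2: "\<exists>v\<ge>0. dist (\<eta> t) (\<rho>2 v) \<le> C + 1" if "t \<ge> 0" for t
  proof -
    obtain n where n: "c n + t \<in> {0..d n}" "dist (\<eta> t) (\<gamma> n (c n + t)) < 1" using approx by blast
    moreover have "c n + t \<in> {c n..d n}" using n(1) that by auto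
    ultimately obtain v where "v \<ge> 0" "dist (\<gamma> n (c n + t)) (\<rho>2 v) \<le> C" using \<gamma>[of n] by blast
    then show ?thesis using n(2) dist_triangle[of "\<eta> t" "\<rho>2 v" "\<gamma> n (c n + t)"] by (intro exI[of _ v]) auto
  qed
  have "finite_hausdorff ((\<lambda>t. \<eta> (0 - t)) ` {0..}) (\<rho>1 ` {0..})"
  proof (rule geodesic_ray_finite_hausdorff[where E = "C + 1"])
    show "geodesic_on {0..} (\<lambda>t. \<eta> (0 - t))" using geodesic_on_affine[OF geo, of "-1" "{0..}" 0] by simp
  qed (use near1 morse_geodesicD_geodesic[OF N(2)] in auto)
  then have "finite_hausdorff (\<eta> ` {..0}) (\<rho>1 ` {0..})" by (simp only: image_left)
  moreover have "finite_hausdorff (\<eta> ` {0..}) (\<rho>2 ` {0..})"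
    by (rule geodesic_ray_finite_hausdorff[where E = "C + 1"])
       (use near2 morse_geodesicD_geodesic[OF N(3)] geodesic_on_subset[OF geo] in auto)
  ultimately have "geo_line a b \<eta>"
    using geo 1 2 by (auto simp: geo_line_def tends_to_def)
  then show ?thesis using that by blast
qed

subsection \<open>Centers\<close>

definition near_line :: "real \<Rightarrow> 'a::metric_space \<Rightarrow> 'a ideal \<Rightarrow> 'a ideal \<Rightarrow> bool" where
  "near_line K x a b \<longleftrightarrow> (\<exists>\<eta>. geo_line a b \<eta> \<and> infdist x (range \<eta>) \<le> K)"

definition morse_pair :: "gauge \<Rightarrow> 'a::metric_space ideal \<Rightarrow> 'a ideal \<Rightarrow> bool" where
  "morse_pair N a b \<longleftrightarrow> (\<forall>\<eta>. geo_line a b \<eta> \<longrightarrow> morse_geodesic N UNIV \<eta>)"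

text \<open>The bound of \<open>morse_ray_fellow_travel\<close>.\<close>

definition travel :: "gauge \<Rightarrow> real \<Rightarrow> real" where
  "travel N K = 2 * N 3 (2 + 2 * K) + 3 * K + 2"

text \<open>The bound of \<open>near_two_rays_bounded\<close>, with \<open>K'\<close> the radius
  that \<open>near_line_any_line\<close> gives.\<close>

definition center_diam :: "gauge \<Rightarrow> real \<Rightarrow> real" where
  "center_diam N K = (let K' = K + 4 + 3 * N 9 4 in 4 * K' + 3 * travel N (2 * K'))"

lemma near_lineD: "near_line K x a b \<Longrightarrow> \<exists>\<eta> s. geo_line a b \<eta> \<and> dist x (\<eta> s) \<le> K + 1"
  using infdist_le_imp_near[of x "range _" K] unfolding near_line_def by blast

lemma near_lineI: "geo_line a b \<eta> \<Longrightarrow> dist x (\<eta> s) \<le> K \<Longrightarrow> near_line K x a b"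
  unfolding near_line_def by (meson near_imp_infdist_le rangeI)

lemma near_line_mono: "near_line K x a b \<Longrightarrow> K \<le> K' \<Longrightarrow> near_line K' x a b"
  unfolding near_line_def by (meson order_trans)

lemma near_line_commute: "near_line K x a b \<longleftrightarrow> near_line K x b a"
proof -
  have "near_line K x b a" if hyp: "near_line K x a b" for a b
  proof -
    obtain \<eta> where \<eta>: "geo_line a b \<eta>" "infdist x (range \<eta>) \<le> K" using hyp by (auto simp: near_line_def)
    have "range (\<lambda>t. \<eta> (-t)) = range \<eta>" using image_image[of \<eta> uminus UNIV] by simp
    then show ?thesis using geo_line_reverse[OF \<eta>(1)] \<eta>(2) unfolding near_line_def by metis
  qed
  then show ?thesis by blast
qed

lemma centers_iff:
  "x \<in> centers K a b c \<longleftrightarrow> near_line K x a b \<and> near_line K x b c \<and> near_line K x c a"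
  unfolding centers_def near_line_def geodesic_from_to_boundary by blast

lemma centers_mono: "x \<in> centers K a b c \<Longrightarrow> K \<le> K' \<Longrightarrow> x \<in> centers K' a b c"
  unfolding centers_iff using near_line_mono by blast

lemma boundary_tuples_iff:
  "as \<in> boundary_tuples p n N \<longleftrightarrow> length as = n \<and> distinct as \<and> set as \<subseteq> morse_boundary p \<and>
     (\<forall>a\<in>set as. \<forall>b\<in>set as. a \<noteq> b \<longrightarrow> morse_pair N a b)"
  unfolding boundary_tuples_def morse_pair_def geodesic_from_to_boundary by blast

lemma boundary_tuples_subset:
  assumes "as \<in> boundary_tuples p n N" "set bs \<subseteq> set as" "distinct bs" "length bs = m"
  shows "bs \<in> boundary_tuples p m N"
  using assms unfolding boundary_tuples_iff by (meson subset_iff)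

lemma travel_ge: "morse_gauge N \<Longrightarrow> 0 \<le> K \<Longrightarrow> K \<le> travel N K"
  by (simp add: travel_def morse_gauge_def)

lemma near_line_sees:
  assumes "near_line K x a b" "morse_pair N a b"
  shows "sees N (K + 1) x a" "sees N (K + 1) x b"
  using near_lineD[OF assms(1)] assms(2) geo_line_sees unfolding morse_pair_def by metis+

text \<open>Triangles may use any lines between their vertices, so two centers may refer to
  different sides. Changing to a prescribed side costs \<open>3 * (N 9 4 + 1)\<close> by
  \<open>morse_line_near_quasi_line\<close>, and 1 goes into attaining the infimum.\<close>

lemma near_line_any_line:
  fixes y :: "'a::proper_geodesic_space"
  assumes ab: "a \<in> morse_boundary p" "b \<in> morse_boundary p" and N: "morse_gauge N" "morse_pair N a b"
    and y: "near_line K y a b" and \<eta>: "geo_line a b \<eta>"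
  shows "\<exists>r. dist y (\<eta> r) \<le> K + 4 + 3 * N 9 4"
proof -
  obtain \<gamma> t where \<gamma>: "geo_line a b \<gamma>" "dist y (\<gamma> t) \<le> K + 1" using near_lineD[OF y] by blast
  have "\<exists>s. dist (\<gamma> t) (\<eta> s) \<le> 3 * (N (9 * 1) (0 + 4) + 1) \<and>
    (\<forall>r\<le>s. \<exists>v\<le>t. dist (\<eta> r) (\<gamma> v) \<le> N (9 * 1) (0 + 4) + 1) \<and>
    (\<forall>r\<ge>s. \<exists>v\<ge>t. dist (\<eta> r) (\<gamma> v) \<le> N (9 * 1) (0 + 4) + 1)"
  proof (rule morse_line_near_quasi_line[OF N(1) _ _ _ _ refl])
    show "morse_geodesic N UNIV \<gamma>" using N \<gamma> by (simp add: morse_pair_def)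
    show "quasi_geodesic 1 0 UNIV \<eta>" using geo_line_geodesic[OF \<eta>] geodesic_on_imp_quasi_geodesic by blast
    show "finite_hausdorff (\<eta> ` {..0}) (\<gamma> ` {..0})"
      using tends_to_finite_hausdorff[OF ab(1) geo_line_left[OF \<eta>] geo_line_left[OF \<gamma>(1)]] .
    show "finite_hausdorff (\<eta> ` {0..}) (\<gamma> ` {0..})"
      using tends_to_finite_hausdorff[OF ab(2) geo_line_right[OF \<eta>] geo_line_right[OF \<gamma>(1)]] .
  qed
  then obtain s where s: "dist (\<gamma> t) (\<eta> s) \<le> 3 * (N 9 4 + 1)" by auto
  have "dist y (\<eta> s) \<le> dist y (\<gamma> t) + dist (\<gamma> t) (\<eta> s)" by metric
  then show ?thesis using s \<gamma>(2) by (intro exI[of _ s]) simp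
qed

lemma ray_to_boundary_travel:
  fixes \<rho> :: "real \<Rightarrow> 'a::proper_geodesic_space"
  assumes "a \<in> morse_boundary p" "morse_gauge N" "morse_geodesic N {0..} \<rho>" "geodesic_on {0..} \<zeta>"
    "tends_to (\<rho> ` {0..}) a" "tends_to (\<zeta> ` {0..}) a" "dist (\<zeta> 0) (\<rho> 0) \<le> K" "0 \<le> t"
  shows "dist (\<zeta> t) (\<rho> t) \<le> travel N K"
  unfolding travel_def
  by (rule morse_ray_fellow_travel) (use assms tends_to_finite_hausdorff in auto)

text \<open>The line \<open>\<eta>\<close> follows \<open>\<rho>1\<close> backwards and
  \<open>\<rho>2\<close> forwards. A point \<open>y\<close> near both rays is thus near both
  \<open>\<eta> (s - u)\<close> and \<open>\<eta> (s + v)\<close>, which are \<open>u + v\<close>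
  apart; so \<open>u\<close> and \<open>v\<close> are bounded.\<close>

lemma near_two_rays_bounded:
  fixes x :: "'a::proper_geodesic_space"
  assumes ab: "a \<in> morse_boundary p" "b \<in> morse_boundary p" and N: "morse_gauge N"
    and \<eta>: "geo_line a b \<eta>" "dist x (\<eta> s) \<le> K"
    and \<rho>1: "morse_geodesic N {0..} \<rho>1" "dist x (\<rho>1 0) \<le> K" "tends_to (\<rho>1 ` {0..}) a"
    and \<rho>2: "morse_geodesic N {0..} \<rho>2" "dist x (\<rho>2 0) \<le> K" "tends_to (\<rho>2 ` {0..}) b"
    and y: "0 \<le> u" "dist y (\<rho>1 u) \<le> K" "0 \<le> v" "dist y (\<rho>2 v) \<le> K"
  shows "dist x y \<le> 4 * K + 3 * travel N (2 * K)"
proof -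
  have "dist (\<eta> s) (\<rho>1 0) \<le> 2 * K" "dist (\<eta> s) (\<rho>2 0) \<le> 2 * K" using \<eta>(2) \<rho>1(2) \<rho>2(2) by metric+
  then have "dist (\<eta> (s - u)) (\<rho>1 u) \<le> travel N (2 * K)" "dist (\<eta> (s + v)) (\<rho>2 v) \<le> travel N (2 * K)"
    using ray_to_boundary_travel[OF ab(1) N \<rho>1(1) geo_line_left_ray(1)[OF \<eta>(1)] \<rho>1(3) geo_line_left_ray(2)[OF \<eta>(1)], of s "2 * K" u]
      ray_to_boundary_travel[OF ab(2) N \<rho>2(1) geo_line_right_ray(1)[OF \<eta>(1)] \<rho>2(3) geo_line_right_ray(2)[OF \<eta>(1)], of s "2 * K" v] y
    by auto
  moreover have "dist (\<eta> (s - u)) (\<eta> (s + v)) \<le>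
      dist (\<eta> (s - u)) (\<rho>1 u) + dist y (\<rho>1 u) + dist y (\<rho>2 v) + dist (\<eta> (s + v)) (\<rho>2 v)" by metric
  moreover have "dist x y \<le> dist x (\<eta> s) + dist (\<eta> s) (\<eta> (s + v)) + dist (\<eta> (s + v)) (\<rho>2 v) + dist y (\<rho>2 v)"
    by metric
  ultimately show ?thesis using y \<eta>(2) geo_line_dist[OF \<eta>(1)] by simp
qed

text \<open>On a side passing near both points, \<open>y\<close> lies from \<open>x\<close> in the
  direction of one of its two ends. The three sides select at least two different vertices in this
  way. The side joining these two passes near \<open>x\<close>, so
  \<open>near_two_rays_bounded\<close> applies.\<close>

lemma centers_dist_le:
  fixes x :: "'a::proper_geodesic_space"
  assumes abc: "[a, b, c] \<in> boundary_tuples p 3 N" and N: "morse_gauge N"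
    and x: "x \<in> centers K a b c" and y: "y \<in> centers K a b c"
  shows "dist x y \<le> center_diam N K"
proof -
  define K' where "K' = K + 4 + 3 * N 9 4"
  have K': "K + 1 \<le> K'" using N by (simp add: K'_def morse_gauge_def)
  have bd: "a \<in> morse_boundary p" "b \<in> morse_boundary p" "c \<in> morse_boundary p"
    and mp: "morse_pair N a b" "morse_pair N b c" "morse_pair N c a"
    using abc by (auto simp: boundary_tuples_iff)
  \<comment> \<open>\<open>P e\<close> expresses that \<open>y\<close> lies in the direction of
    \<open>e\<close> as seen from \<open>x\<close>.\<close>
  define P where "P e \<longleftrightarrow> (\<exists>\<rho> u. morse_geodesic N {0..} \<rho> \<and> dist x (\<rho> 0) \<le> K' \<and>
      tends_to (\<rho> ` {0..}) e \<and> 0 \<le> u \<and> dist y (\<rho> u) \<le> K')" for e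
  have pick: "P e \<or> P f" if hyp: "e \<in> morse_boundary p" "f \<in> morse_boundary p" "morse_pair N e f"
    "near_line K x e f" "near_line K y e f" for e f
  proof -
    obtain \<eta> s where \<eta>: "geo_line e f \<eta>" "dist x (\<eta> s) \<le> K + 1" using near_lineD[OF hyp(4)] by blast
    obtain r where r: "dist y (\<eta> r) \<le> K'"
      using near_line_any_line[OF hyp(1,2) N hyp(3,5) \<eta>(1)] unfolding K'_def by blast
    have m: "morse_geodesic N UNIV \<eta>" using hyp(3) \<eta> by (simp add: morse_pair_def)
    show ?thesis
    proof (cases "r \<le> s")
      case True
      have "P e" unfolding P_def
        by (intro exI[of _ "\<lambda>t. \<eta> (s - t)"] exI[of _ "s - r"])
           (use geo_line_left_ray(2,3)[OF \<eta>(1)] m \<eta>(2) r True K' in auto)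
      then show ?thesis ..
    next
      case False
      have "P f" unfolding P_def
        by (intro exI[of _ "\<lambda>t. \<eta> (s + t)"] exI[of _ "r - s"])
           (use geo_line_right_ray(2,3)[OF \<eta>(1)] m \<eta>(2) r False K' in auto)
      then show ?thesis ..
    qed
  qed
  have fin: "dist x y \<le> center_diam N K" if hyp: "e \<in> morse_boundary p" "f \<in> morse_boundary p"
    "near_line K x e f" "P e" "P f" for e f
  proof -
    obtain \<eta> s where \<eta>: "geo_line e f \<eta>" "dist x (\<eta> s) \<le> K + 1" using near_lineD[OF hyp(3)] by blast
    have s: "dist x (\<eta> s) \<le> K'" using \<eta>(2) K' by simp
    obtain \<rho>1 u where 1: "morse_geodesic N {0..} \<rho>1" "dist x (\<rho>1 0) \<le> K'" "tends_to (\<rho>1 ` {0..}) e"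
      "0 \<le> u" "dist y (\<rho>1 u) \<le> K'" using hyp(4) unfolding P_def by blast
    obtain \<rho>2 v where 2: "morse_geodesic N {0..} \<rho>2" "dist x (\<rho>2 0) \<le> K'" "tends_to (\<rho>2 ` {0..}) f"
      "0 \<le> v" "dist y (\<rho>2 v) \<le> K'" using hyp(5) unfolding P_def by blast
    show ?thesis
      using near_two_rays_bounded[OF hyp(1,2) N \<eta>(1) s 1(1-3) 2(1-3) 1(4,5) 2(4,5)]
      by (simp add: center_diam_def K'_def Let_def)
  qed
  have nx: "near_line K x a b" "near_line K x b c" "near_line K x c a"
    and ny: "near_line K y a b" "near_line K y b c" "near_line K y c a"
    using x y by (auto simp: centers_iff)
  have "P a \<or> P b" "P b \<or> P c" "P c \<or> P a"
    using pick bd mp nx ny by blast+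
  then consider "P a" "P b" | "P b" "P c" | "P c" "P a" by blast
  then show ?thesis using fin bd nx by cases blast+
qed

lemma centers_nonempty:
  fixes p :: "'a::proper_geodesic_space"
  assumes kc: "center_constants p kc" and abc: "[a, b, c] \<in> boundary_tuples p 3 N" and N: "morse_gauge N"
  obtains x where "x \<in> centers (kc N) a b c"
proof -
  have bd: "a \<in> morse_boundary p" "b \<in> morse_boundary p" "c \<in> morse_boundary p"
    and d: "a \<noteq> b" "b \<noteq> c" "c \<noteq> a"
    and mp: "morse_pair N a b" "morse_pair N b c" "morse_pair N c a"
    using abc by (auto simp: boundary_tuples_iff)
  obtain \<gamma>1 \<gamma>2 \<gamma>3 where \<gamma>: "geo_line a b \<gamma>1" "geo_line b c \<gamma>2" "geo_line c a \<gamma>3"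
    using geo_line_exists bd d by metis
  have "\<exists>q1\<in>range \<gamma>1. \<exists>q2\<in>range \<gamma>2. \<exists>q3\<in>range \<gamma>3. dist q1 q2 \<le> kc N \<and> dist q2 q3 \<le> kc N \<and> dist q3 q1 \<le> kc N"
    using kc[unfolded center_constants_def, rule_format, OF N, THEN conjunct2, rule_format,
        of "Inr a" "Inr b" "Inr c" UNIV \<gamma>1 UNIV \<gamma>2 UNIV \<gamma>3] \<gamma> mp bd
    unfolding geodesic_from_to_boundary morse_pair_def by auto
  then obtain s1 s2 s3 where s: "dist (\<gamma>1 s1) (\<gamma>2 s2) \<le> kc N" "dist (\<gamma>3 s3) (\<gamma>1 s1) \<le> kc N"
    by blast
  have kc0: "kc N > 0" using kc N by (simp add: center_constants_def)
  have "\<gamma>1 s1 \<in> centers (kc N) a b c"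
    unfolding centers_iff
    using near_lineI[OF \<gamma>(1), of "\<gamma>1 s1" s1 "kc N"] near_lineI[OF \<gamma>(2), of "\<gamma>1 s1" s2 "kc N"]
      near_lineI[OF \<gamma>(3), of "\<gamma>1 s1" s3 "kc N"] s kc0 by (simp add: dist_commute)
  then show ?thesis using that by blast
qed

section \<open>Thin triangles and adjacency at a center\<close>

text \<open>The three mutually close points given by \<open>center_constants\<close> divide each
  side into two rays. The two rays running to a common vertex start close together and therefore
  fellow travel.\<close>

lemma near_line_thin:
  fixes p :: "'a::proper_geodesic_space"
  assumes kc: "center_constants p kc" and abc: "[a, b, c] \<in> boundary_tuples p 3 N" and N: "morse_gauge N"
    and x: "near_line R x a b"
  shows "near_line (R + 1 + travel N (kc N)) x a c \<or> near_line (R + 1 + travel N (kc N)) x b c"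
proof -
  have bd: "a \<in> morse_boundary p" "b \<in> morse_boundary p" "c \<in> morse_boundary p"
    and d: "a \<noteq> b" "b \<noteq> c" "c \<noteq> a"
    and mp: "morse_pair N a b" "morse_pair N b c" "morse_pair N c a"
    using abc by (auto simp: boundary_tuples_iff)
  obtain \<gamma>1 s where 1: "geo_line a b \<gamma>1" "dist x (\<gamma>1 s) \<le> R + 1" using near_lineD[OF x] by blast
  obtain \<gamma>2 \<gamma>3 where \<gamma>: "geo_line b c \<gamma>2" "geo_line c a \<gamma>3"
    using geo_line_exists bd d by metis
  have m: "morse_geodesic N UNIV \<gamma>2" "morse_geodesic N UNIV \<gamma>3" using \<gamma> mp by (auto simp: morse_pair_def)
  have "\<exists>q1\<in>range \<gamma>1. \<exists>q2\<in>range \<gamma>2. \<exists>q3\<in>range \<gamma>3. dist q1 q2 \<le> kc N \<and> dist q2 q3 \<le> kc N \<and> dist q3 q1 \<le> kc N"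
    using kc[unfolded center_constants_def, rule_format, OF N, THEN conjunct2, rule_format,
        of "Inr a" "Inr b" "Inr c" UNIV \<gamma>1 UNIV \<gamma>2 UNIV \<gamma>3] \<gamma> 1(1) mp bd
    unfolding geodesic_from_to_boundary morse_pair_def by auto
  then obtain s1 s2 s3 where q: "dist (\<gamma>1 s1) (\<gamma>2 s2) \<le> kc N" "dist (\<gamma>3 s3) (\<gamma>1 s1) \<le> kc N"
    by blast
  show ?thesis
  proof (cases "s \<le> s1")
    case True
    have "dist (\<gamma>1 (s1 - (s1 - s))) (\<gamma>3 (s3 + (s1 - s))) \<le> travel N (kc N)"
      using ray_to_boundary_travel[OF bd(1) N geo_line_right_ray(3)[OF \<gamma>(2) m(2)] geo_line_left_ray(1)[OF 1(1)]
        geo_line_right_ray(2)[OF \<gamma>(2)] geo_line_left_ray(2)[OF 1(1)], of s1 s3 "kc N" "s1 - s"] q True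
      by (simp add: dist_commute)
    then have "dist x (\<gamma>3 (s3 + (s1 - s))) \<le> R + 1 + travel N (kc N)"
      using 1(2) dist_triangle[of x "\<gamma>3 (s3 + (s1 - s))" "\<gamma>1 s"] by simp
    then show ?thesis using near_lineI[OF \<gamma>(2)] near_line_commute by blast
  next
    case False
    have "dist (\<gamma>1 (s1 + (s - s1))) (\<gamma>2 (s2 - (s - s1))) \<le> travel N (kc N)"
      using ray_to_boundary_travel[OF bd(2) N geo_line_left_ray(3)[OF \<gamma>(1) m(1)] geo_line_right_ray(1)[OF 1(1)]
        geo_line_left_ray(2)[OF \<gamma>(1)] geo_line_right_ray(2)[OF 1(1)], of s1 s2 "kc N" "s - s1"] q False
      by (simp add: dist_commute)
    then have "dist x (\<gamma>2 (s2 - (s - s1))) \<le> R + 1 + travel N (kc N)"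
      using 1(2) dist_triangle[of x "\<gamma>2 (s2 - (s - s1))" "\<gamma>1 s"] by simp
    then show ?thesis using near_lineI[OF \<gamma>(1)] near_line_commute by blast
  qed
qed

text \<open>Each of the three sides passes near \<open>x\<close>, and thinness of its triangle with
  \<open>e\<close> selects one end of that side. No vertex lies on all three sides, so at least two
  vertices are selected. If \<open>e\<close> is itself a vertex, its two sides connect it to the
  other two.\<close>

lemma near_line_two_of_three:
  fixes p :: "'a::proper_geodesic_space"
  assumes kc: "center_constants p kc" and N: "morse_gauge N" and abc: "distinct [a, b, c]"
    and S: "{a, b, c, e} \<subseteq> morse_boundary p"
      "\<And>u v. u \<in> {a, b, c, e} \<Longrightarrow> v \<in> {a, b, c, e} \<Longrightarrow> u \<noteq> v \<Longrightarrow> morse_pair N u v"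
    and x: "x \<in> centers R a b c" and R': "R' = R + 1 + travel N (kc N)"
    and adj: "\<And>u v. adj u v \<longleftrightarrow> u \<noteq> v \<and> near_line R' x u v"
  shows "adj e a \<and> adj e b \<or> adj e b \<and> adj e c \<or> adj e c \<and> adj e a"
proof -
  have "0 < kc N" using kc N by (simp add: center_constants_def)
  then have RR: "R \<le> R'" using travel_ge[OF N, of "kc N"] R' by simp
  have nx: "near_line R x a b" "near_line R x b c" "near_line R x c a" using x by (auto simp: centers_iff)
  have step: "adj e u \<or> adj e v" if "u \<in> {a, b, c}" "v \<in> {a, b, c}" "u \<noteq> v" "near_line R x u v" for u v
  proof (cases "e = u \<or> e = v")
    case True
    then show ?thesis using near_line_mono[OF that(4) RR] that adj near_line_commute by metis
  next
    case False
    have "[u, v, e] \<in> boundary_tuples p 3 N"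
      using that False S by (auto simp: boundary_tuples_iff)
    from near_line_thin[OF kc this N that(4)] show ?thesis
      using False adj near_line_commute R' by metis
  qed
  show ?thesis
    using step[of a b] step[of b c] step[of c a] nx abc by auto
qed

lemma sees_imp_morse_pair:
  fixes x :: "'a::proper_geodesic_space"
  assumes "a \<in> morse_boundary p" "b \<in> morse_boundary p" "morse_gauge N" "sees N K x a" "sees N K x b"
  shows "morse_pair (line_gauge N K) a b"
  unfolding morse_pair_def using sees_imp_line_morse[OF assms] by blast

lemma centers_sees:
  assumes "[a, b, c] \<in> boundary_tuples p 3 N" "x \<in> centers K a b c" "u \<in> {a, b, c}"
  shows "sees N (K + 1) x u"
proof -
  have mp: "morse_pair N a b" "morse_pair N b c" "morse_pair N c a"
    using assms(1) by (auto simp: boundary_tuples_iff)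
  show ?thesis
    using assms(2,3) near_line_sees[OF _ mp(1)] near_line_sees[OF _ mp(2)] by (auto simp: centers_iff)
qed

subsection \<open>Quasi-moebius maps move centers a bounded amount\<close>

text \<open>The conditions on a tuple concern pairs of its entries, so control of pairs gives
  control of tuples.\<close>

lemma map_boundary_tuples:
  assumes st: "map h ` boundary_tuples p 2 N \<subseteq> boundary_tuples q 2 N'" and as: "as \<in> boundary_tuples p n N"
    and n: "2 \<le> n"
  shows "map h as \<in> boundary_tuples q n N'"
proof -
  have pr: "h a \<noteq> h b \<and> h a \<in> morse_boundary q \<and> morse_pair N' (h a) (h b)"
    if "a \<in> set as" "b \<in> set as" "a \<noteq> b" for a b
  proof -
    have "[a, b] \<in> boundary_tuples p 2 N"
      using as that by (auto simp: boundary_tuples_iff)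
    then have "map h [a, b] \<in> boundary_tuples q 2 N'" using st by blast
    then show ?thesis by (auto simp: boundary_tuples_iff)
  qed
  have "h a \<in> morse_boundary q" if "a \<in> set as" for a
  proof -
    \<comment> \<open>A second entry is needed so that \<open>a\<close> occurs in some pair.\<close>
    have "2 \<le> card (set as)" using as n by (auto simp: boundary_tuples_iff distinct_card)
    then have "\<not> set as \<subseteq> {a}" using card_mono[of "{a}" "set as"] by auto
    then show ?thesis using pr that by blast
  qed
  then have img: "set (map h as) \<subseteq> morse_boundary q" by auto
  have "inj_on h (set as)" using pr by (meson inj_onI)
  then have "distinct (map h as)" using as by (simp add: boundary_tuples_iff distinct_map)
  moreover have "morse_pair N' u v" if "u \<in> set (map h as)" "v \<in> set (map h as)" "u \<noteq> v" for u v
  proof -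
    from that obtain a b where "a \<in> set as" "u = h a" "b \<in> set as" "v = h b" by auto
    then show ?thesis using pr \<open>u \<noteq> v\<close> by blast
  qed
  ultimately show ?thesis
    using as img unfolding boundary_tuples_iff by (metis length_map)
qed

lemma diameter_le_dist:
  assumes "0 \<le> d" "\<And>x y. x \<in> S \<Longrightarrow> y \<in> S \<Longrightarrow> dist x y \<le> d"
  shows "diameter S \<le> d"
  using assms by (auto simp: diameter_def intro!: cSUP_least)

text \<open>All centers of both triples lie near the common center \<open>x\<close>, so the
  cross-ratio of the four points is at most \<open>2 * D\<close>. The function \<open>\<psi>\<close>
  turns this into a bound on the image cross-ratio, which compares centers of the two image
  triples.\<close>

lemma quasi_mobius_step:
  fixes p :: "'a::proper_geodesic_space" and q :: "'b::proper_geodesic_space"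
  assumes kc: "center_constants p kc" "center_constants q kc" and N: "morse_gauge N" "morse_gauge N'"
    and st: "map h ` boundary_tuples p 2 N \<subseteq> boundary_tuples q 2 N'"
    and qm: "quasi_mobius kc p q h"
  shows "\<exists>C. \<forall>u v w u' x y y'. [u, v, w] \<in> boundary_tuples p 3 N \<and> [u', v, w] \<in> boundary_tuples p 3 N \<and>
    (u \<noteq> u' \<longrightarrow> morse_pair N u u' \<and> morse_pair N u' u) \<and>
    x \<in> centers R u v w \<and> x \<in> centers R u' v w \<and>
    y \<in> centers K (h u) (h v) (h w) \<and> y' \<in> centers K (h u') (h v) (h w) \<longrightarrow> dist y y' \<le> C"
proof -
  obtain \<psi> where \<psi>: "mono_on {0..} \<psi>" "\<psi> ` {0..} \<subseteq> {0..}"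
    "\<And>a b c d. [a, b, c, d] \<in> boundary_tuples p 4 N \<Longrightarrow>
        cross_ratio kc N' (h a) (h b) (h c) (h d) \<le> \<psi> (cross_ratio kc N a b c d)"
    using qm N st unfolding quasi_mobius_def by meson
  \<comment> \<open>The maximum is taken because \<open>x\<close> is a center of radius
    \<open>R\<close>, while the cross-ratio is formed with centers of radius
    \<open>kc N\<close>.\<close>
  define D where "D = center_diam N (max R (kc N))"
  define E where "E = center_diam N' (max K (kc N'))"
  \<comment> \<open>The absolute value keeps the argument of \<open>\<psi>\<close> in its domain
    before any triple is available to show \<open>0 \<le> D\<close>.\<close>
  define C where "C = 2 * E + \<psi> (2 * \<bar>D\<bar>)"
  have \<psi>D: "\<psi> (2 * \<bar>D\<bar>) \<ge> 0" using \<psi>(2) by (simp add: image_subset_iff)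
  show ?thesis
  proof (intro exI[of _ C] allI impI)
    fix u v w u' x y y'
    assume *: "[u, v, w] \<in> boundary_tuples p 3 N \<and> [u', v, w] \<in> boundary_tuples p 3 N \<and>
      (u \<noteq> u' \<longrightarrow> morse_pair N u u' \<and> morse_pair N u' u) \<and>
      x \<in> centers R u v w \<and> x \<in> centers R u' v w \<and>
      y \<in> centers K (h u) (h v) (h w) \<and> y' \<in> centers K (h u') (h v) (h w)"
    have hu: "[h u, h v, h w] \<in> boundary_tuples q 3 N'" "[h u', h v, h w] \<in> boundary_tuples q 3 N'"
      using map_boundary_tuples[OF st, of "[u, v, w]" 3] map_boundary_tuples[OF st, of "[u', v, w]" 3] * by auto
    have E: "dist z z' \<le> E" if "z \<in> centers (max K (kc N')) (h t) (h v) (h w)"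
      "z' \<in> centers (max K (kc N')) (h t) (h v) (h w)" "t \<in> {u, u'}" for t z z'
      using centers_dist_le[of "h t" "h v" "h w" q N'] that hu N(2) unfolding E_def by auto
    have yy: "y \<in> centers (max K (kc N')) (h u) (h v) (h w)" "y' \<in> centers (max K (kc N')) (h u') (h v) (h w)"
      using * centers_mono by (meson max.cobounded1)+
    show "dist y y' \<le> C"
    proof (cases "u = u'")
      case True
      then have "dist y y' \<le> E" using E yy by blast
      moreover have "0 \<le> E" using calculation zero_le_dist order_trans by blast
      ultimately show ?thesis using \<psi>D by (simp add: C_def)
    next
      case False
      have D: "dist x z \<le> D" if "z \<in> centers (kc N) t v w" "t \<in> {u, u'}" for t z
        unfolding D_def
        by (rule centers_dist_le[of t v w p N]) (use * that N centers_mono in \<open>auto intro: centers_mono\<close>)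
      \<comment> \<open>\<open>cross_ratio\<close> exchanges the middle vertex of a triple, the step
        exchanges the first one; centers do not depend on the order.\<close>
      have perm: "centers k s t r = centers k t s r" for k and r s t :: "'c::metric_space ideal"
        unfolding set_eq_iff centers_iff using near_line_commute by blast
      have crX: "cross_ratio kc N v u w u' = diameter (centers (kc N) u v w \<union> centers (kc N) u' v w)"
        unfolding cross_ratio_def perm[of _ v] ..
      have crY: "cross_ratio kc N' (h v) (h u) (h w) (h u') =
          diameter (centers (kc N') (h u) (h v) (h w) \<union> centers (kc N') (h u') (h v) (h w))"
        unfolding cross_ratio_def perm[of _ "h v"] ..
      obtain z where "z \<in> centers (kc N) u v w" using centers_nonempty[OF kc(1) _ N(1)] * by blast
      then have D0: "0 \<le> D" using D[of z u] zero_le_dist order_trans by blast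
      have "[u, v, w] \<in> boundary_tuples p 3 N" "[u', v, w] \<in> boundary_tuples p 3 N"
        "morse_pair N u u'" "morse_pair N u' u" using * False by blast+
      then have bt: "[v, u, w, u'] \<in> boundary_tuples p 4 N"
        using False by (simp add: boundary_tuples_iff) blast
      have "cross_ratio kc N v u w u' \<le> 2 * D"
        unfolding crX
      proof (rule diameter_le_dist)
        fix z z' assume "z \<in> centers (kc N) u v w \<union> centers (kc N) u' v w"
          "z' \<in> centers (kc N) u v w \<union> centers (kc N) u' v w"
        then have "dist x z \<le> D" "dist x z' \<le> D" using D by blast+
        then show "dist z z' \<le> 2 * D" by metric
      qed (use D0 in simp)
      moreover have "0 \<le> cross_ratio kc N v u w u'"
        unfolding crX
      proof (rule diameter_ge_0)
        show "bounded (centers (kc N) u v w \<union> centers (kc N) u' v w)"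
          unfolding bounded_def using D by (intro exI[of _ x] exI[of _ D]) blast
      qed
      ultimately have "\<psi> (cross_ratio kc N v u w u') \<le> \<psi> (2 * \<bar>D\<bar>)"
        using D0 by (intro mono_onD[OF \<psi>(1)]) auto
      then have cr: "cross_ratio kc N' (h v) (h u) (h w) (h u') \<le> \<psi> (2 * \<bar>D\<bar>)" using \<psi>(3)[OF bt] by simp
      obtain z where z: "z \<in> centers (kc N') (h u) (h v) (h w)" using centers_nonempty[OF kc(2) hu(1) N(2)] .
      obtain z' where z': "z' \<in> centers (kc N') (h u') (h v) (h w)" using centers_nonempty[OF kc(2) hu(2) N(2)] .
      have zz: "t \<in> centers (max K (kc N')) a b c" if "t \<in> centers (kc N') a b c" for t :: 'b and a b c
        using that centers_mono by (meson max.cobounded2)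
      have bdd: "bounded (centers (kc N') (h u) (h v) (h w) \<union> centers (kc N') (h u') (h v) (h w))"
        unfolding bounded_Un
        using E[of z "u"] E[of z' "u'"] zz z z' unfolding bounded_def by blast
      have "dist z z' \<le> cross_ratio kc N' (h v) (h u) (h w) (h u')"
        unfolding crY by (rule diameter_bounded_bound[OF bdd]) (use z z' in auto)
      moreover have "dist y z \<le> E" "dist y' z' \<le> E" using E[OF yy(1) zz[OF z]] E[OF yy(2) zz[OF z']] by auto
      moreover have "dist y y' \<le> dist y z + dist z z' + dist y' z'" by metric
      ultimately show ?thesis using cr by (simp add: C_def)
    qed
  qed
qed

text \<open>All six boundary points are seen from \<open>x\<close>, so a single gauge
  \<open>N2\<close>, computed from \<open>N\<close>, \<open>K\<close> and \<open>R\<close>, serves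
  every pair of them. The chain replaces one vertex at a time, and each of its three exchanges is a
  \<open>quasi_mobius_step\<close>.\<close>

lemma quasi_mobius_transfer:
  fixes p :: "'a::proper_geodesic_space" and q :: "'b::proper_geodesic_space"
  assumes kc: "center_constants p kc" "center_constants q kc" and N: "morse_gauge N"
    and st: "two_stable p q h" and qm: "quasi_mobius kc p q h"
  shows "\<exists>C. \<forall>x x' y y' a b c a' b' c'. [a, b, c] \<in> boundary_tuples p 3 N \<longrightarrow>
    [a', b', c'] \<in> boundary_tuples p 3 N \<longrightarrow> x \<in> centers K a b c \<longrightarrow> x' \<in> centers K a' b' c' \<longrightarrow>
    dist x x' \<le> R \<longrightarrow> y \<in> centers K' (h a) (h b) (h c) \<longrightarrow> y' \<in> centers K' (h a') (h b') (h c') \<longrightarrow>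
    dist y y' \<le> C"
proof -
  \<comment> \<open>\<open>R\<close> pays for moving from \<open>x'\<close> to \<open>x\<close>, and
    1 for passing from an infimum to a point on a line.\<close>
  define K2 where "K2 = \<bar>K\<bar> + \<bar>R\<bar> + 1"
  define N2 where "N2 = line_gauge N K2"
  have N2: "morse_gauge N2" unfolding N2_def by (rule morse_gauge_line[OF N]) (simp add: K2_def)
  obtain N' where N': "morse_gauge N'" "map h ` boundary_tuples p 2 N2 \<subseteq> boundary_tuples q 2 N'"
    using st N2 unfolding two_stable_def by blast
  define R1 where "R1 = K2 + 1 + travel N2 (kc N2)"
  obtain C where C: "\<And>u v w u' x y y'. [u, v, w] \<in> boundary_tuples p 3 N2 \<Longrightarrow> [u', v, w] \<in> boundary_tuples p 3 N2 \<Longrightarrow>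
    (u \<noteq> u' \<Longrightarrow> morse_pair N2 u u' \<and> morse_pair N2 u' u) \<Longrightarrow>
    x \<in> centers R1 u v w \<Longrightarrow> x \<in> centers R1 u' v w \<Longrightarrow>
    y \<in> centers (max K' (kc N')) (h u) (h v) (h w) \<Longrightarrow> y' \<in> centers (max K' (kc N')) (h u') (h v) (h w) \<Longrightarrow>
    dist y y' \<le> C"
    using quasi_mobius_step[OF kc N2 N' qm, of R1 "max K' (kc N')"] by blast
  show ?thesis
  proof (intro exI[of _ "3 * C"] allI impI)
    fix x x' y y' a b c a' b' c'
    assume *: "[a, b, c] \<in> boundary_tuples p 3 N" "[a', b', c'] \<in> boundary_tuples p 3 N"
      "x \<in> centers K a b c" "x' \<in> centers K a' b' c'" "dist x x' \<le> R"
      "y \<in> centers K' (h a) (h b) (h c)" "y' \<in> centers K' (h a') (h b') (h c')"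
    define S where "S = {a, b, c, a', b', c'}"
    have S: "S \<subseteq> morse_boundary p" using * by (auto simp: S_def boundary_tuples_iff)
    have sees: "sees N K2 x u" if "u \<in> S" for u
    proof (cases "u \<in> {a, b, c}")
      case True
      then have "sees N (K + 1) x u" using centers_sees * by metis
      then show ?thesis by (rule sees_near) (simp add: K2_def)
    next
      case False
      then have "sees N (K + 1) x' u" using centers_sees * that unfolding S_def by blast
      then show ?thesis by (rule sees_near) (use * in \<open>auto simp: K2_def\<close>)
    qed
    have mp: "morse_pair N2 u v" if "u \<in> S" "v \<in> S" for u v
      unfolding N2_def using sees_imp_morse_pair[OF _ _ N sees[OF that(1)] sees[OF that(2)]] S that by blast
    \<comment> \<open>With \<open>u \<noteq> v\<close> built in, a vertex shared by both triples is
      nonadjacent to itself; it is then matched with itself and stays in place.\<close>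
    define adj where "adj u v \<longleftrightarrow> u \<noteq> v \<and> near_line R1 x u v" for u v
    have adj_sym: "adj u v \<longleftrightarrow> adj v u" for u v unfolding adj_def using near_line_commute by metis
    have x1: "x \<in> centers K2 a b c" using * by (auto simp: K2_def intro: centers_mono)
    have near': "near_line K2 x u v" if hyp: "near_line K x' u v" for u v
    proof -
      obtain \<eta> where \<eta>: "geo_line u v \<eta>" "infdist x' (range \<eta>) \<le> K" using hyp by (auto simp: near_line_def)
      have "infdist x (range \<eta>) \<le> infdist x' (range \<eta>) + dist x x'" by (rule infdist_triangle)
      also have "\<dots> \<le> K + R" using \<eta>(2) * by (intro add_mono) auto
      also have "\<dots> \<le> K2" by (simp add: K2_def)
      finally show ?thesis using \<eta> by (auto simp: near_line_def)
    qed
    have x2: "x \<in> centers K2 a' b' c'" using * near' by (auto simp: centers_iff)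
    have three: "adj e u \<and> adj e v \<or> adj e v \<and> adj e w \<or> adj e w \<and> adj e u"
      if "x \<in> centers K2 u v w" "distinct [u, v, w]" "{e, u, v, w} \<subseteq> S" for e u v w
    proof (rule near_line_two_of_three[OF kc(1) N2 that(2) _ _ that(1) R1_def])
      show "{u, v, w, e} \<subseteq> morse_boundary p" using that(3) S by blast
      show "morse_pair N2 s t" if "s \<in> {u, v, w, e}" "t \<in> {u, v, w, e}" for s t
        using mp that \<open>{e, u, v, w} \<subseteq> S\<close> by blast
    qed (rule adj_def)
    \<comment> \<open>Taking \<open>e\<close> to be a vertex in \<open>three\<close> gives its
      adjacency to the two others.\<close>
    have ab: "x \<in> centers K2 u v w \<Longrightarrow> distinct [u, v, w] \<Longrightarrow> {u, v, w} \<subseteq> S \<Longrightarrow> adj u v \<and> adj v w \<and> adj w u" for u v w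
      using three[of u v w u] three[of u v w v] three[of u v w w] adj_def by auto
    have dis: "distinct [a, b, c]" "distinct [a', b', c']" using * by (auto simp: boundary_tuples_iff)
    have A: "adj a b" "adj b c" "adj c a" using ab[OF x1 dis(1)] by (auto simp: S_def)
    have B: "adj a' b'" "adj b' c'" "adj c' a'" using ab[OF x2 dis(2)] by (auto simp: S_def)
    have tup: "[u, v, w] \<in> boundary_tuples p 3 N2 \<and> x \<in> centers R1 u v w"
      if "u \<in> S" "v \<in> S" "w \<in> S" "adj u v" "adj v w" "adj w u" for u v w
      using that S mp by (auto simp: boundary_tuples_iff centers_iff adj_def)
    have perm: "centers k u v w = centers k v u w" "centers k u v w = centers k v w u" for k and u v w :: "'c::metric_space ideal"
      unfolding set_eq_iff centers_iff using near_line_commute by blast+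
    define KK where "KK = max K' (kc N')"
    have yy: "y \<in> centers KK (h a) (h b) (h c)" "y' \<in> centers KK (h a') (h b') (h c')"
      using * by (auto simp: KK_def intro: centers_mono)
    have step: "dist z z' \<le> C" if "u \<in> S" "v \<in> S" "w \<in> S" "u' \<in> S" "adj u v" "adj v w" "adj w u"
      "adj u' v" "adj u' w" "z \<in> centers KK (h u) (h v) (h w)" "z' \<in> centers KK (h u') (h v) (h w)"
      for u v w u' z z'
      using C[of u v w u' x z z'] tup[of u v w] tup[of u' v w] that adj_sym mp unfolding KK_def by blast
    have ex: "\<exists>z. z \<in> centers KK (h u) (h v) (h w)"
      if hyp: "u \<in> S" "v \<in> S" "w \<in> S" "adj u v" "adj v w" "adj w u" for u v w
    proof -
      have "[h u, h v, h w] \<in> boundary_tuples q 3 N'"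
        using map_boundary_tuples[OF N'(2), of "[u, v, w]" 3] tup[OF hyp] by auto
      then obtain z where "z \<in> centers (kc N') (h u) (h v) (h w)" using centers_nonempty[OF kc(2) _ N'(1)] by blast
      then show ?thesis unfolding KK_def using centers_mono[OF _ max.cobounded2] by blast
    qed
    \<comment> \<open>The exchanges are \<open>u\<close> for \<open>a\<close>, then \<open>v\<close>
      for \<open>b\<close>, then \<open>w\<close> for \<open>c\<close>. The triples in between are
      again pairwise adjacent, so they keep \<open>x\<close> as a center of radius
      \<open>R1\<close>.\<close>
    have chain: "dist y y' \<le> 3 * C" if hyp: "{u, v, w} \<subseteq> S" "adj u v" "adj v w" "adj w u"
      "adj u b" "adj u c" "adj v a" "adj v c" "adj w a" "adj w b" "y' \<in> centers KK (h u) (h v) (h w)" for u v w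
    proof -
      have abc: "a \<in> S" "b \<in> S" "c \<in> S" and uvw: "u \<in> S" "v \<in> S" "w \<in> S" using hyp by (auto simp: S_def)
      obtain z1 where z1: "z1 \<in> centers KK (h u) (h b) (h c)" using ex[of u b c] abc uvw A hyp adj_sym by blast
      obtain z2 where z2: "z2 \<in> centers KK (h u) (h v) (h c)" using ex[of u v c] abc uvw A hyp adj_sym by blast
      have 1: "dist y z1 \<le> C" using step[of a b c u y z1] abc uvw A hyp yy(1) z1 by blast
      have 2: "dist z1 z2 \<le> C"
      proof (rule step[of b u c v z1 z2])
        show "z1 \<in> centers KK (h b) (h u) (h c)" "z2 \<in> centers KK (h v) (h u) (h c)"
          using z1 z2 perm(1) by blast+
      qed (use abc uvw A hyp adj_sym in blast)+
      have 3: "dist z2 y' \<le> C"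
      proof (rule step[of c u v w z2 y'])
        show "z2 \<in> centers KK (h c) (h u) (h v)" "y' \<in> centers KK (h w) (h u) (h v)"
          using z2 hyp(11) perm(2) by blast+
      qed (use abc uvw A hyp adj_sym in blast)+
      have "dist y y' \<le> dist y z1 + dist z1 z2 + dist z2 y'" by metric
      then show ?thesis using 1 2 3 by simp
    qed
    \<comment> \<open>In the three by three table of adjacencies, every row has at most one gap; the
      facts \<open>cl\<close> say the same of the columns.\<close>
    have r: "adj a' a \<and> adj a' b \<or> adj a' b \<and> adj a' c \<or> adj a' c \<and> adj a' a"
      "adj b' a \<and> adj b' b \<or> adj b' b \<and> adj b' c \<or> adj b' c \<and> adj b' a"
      "adj c' a \<and> adj c' b \<or> adj c' b \<and> adj c' c \<or> adj c' c \<and> adj c' a"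
      using three[OF x1 dis(1)] by (auto simp: S_def)
    have cl: "adj a a' \<and> adj a b' \<or> adj a b' \<and> adj a c' \<or> adj a c' \<and> adj a a'"
      "adj b a' \<and> adj b b' \<or> adj b b' \<and> adj b c' \<or> adj b c' \<and> adj b a'"
      "adj c a' \<and> adj c b' \<or> adj c b' \<and> adj c c' \<or> adj c c' \<and> adj c a'"
      using three[OF x2 dis(2)] by (auto simp: S_def)
    \<comment> \<open>The triple stands for the matching of \<open>u\<close> with \<open>a\<close>,
      \<open>v\<close> with \<open>b\<close> and \<open>w\<close> with \<open>c\<close>. It is good
      when every gap of the table is one of the matched pairs.\<close>
    define good where "good u v w \<longleftrightarrow> adj u b \<and> adj u c \<and> adj v a \<and> adj v c \<and> adj w a \<and> adj w b" for u v w
    have B': "adj s t" if "s \<in> {a', b', c'}" "t \<in> {a', b', c'}" "s \<noteq> t" for s t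
      using that B B[THEN adj_sym[THEN iffD1]] by (elim insertE emptyE) simp_all
    have good: "dist y y' \<le> 3 * C" if uvw: "good u v w" "{u, v, w} \<subseteq> {a', b', c'}"
      "u \<noteq> v" "v \<noteq> w" "w \<noteq> u" "y' \<in> centers KK (h u) (h v) (h w)" for u v w
    proof (rule chain)
      have mem: "u \<in> {a', b', c'}" "v \<in> {a', b', c'}" "w \<in> {a', b', c'}" using uvw(2) by simp_all
      show "adj u v" "adj v w" "adj w u"
        using B'[OF mem(1,2) uvw(3)] B'[OF mem(2,3) uvw(4)] B'[OF mem(3,1) uvw(5)] by simp_all
      show "{u, v, w} \<subseteq> S" using uvw(2) unfolding S_def by (rule order_trans) simp
    qed (use uvw(1,6) in \<open>simp_all add: good_def\<close>)
    have y': "y' \<in> centers KK (h a') (h b') (h c')" "y' \<in> centers KK (h a') (h c') (h b')"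
      "y' \<in> centers KK (h b') (h a') (h c')" "y' \<in> centers KK (h b') (h c') (h a')"
      "y' \<in> centers KK (h c') (h a') (h b')" "y' \<in> centers KK (h c') (h b') (h a')"
      using yy(2) near_line_commute[of KK y'] unfolding centers_iff by blast+
    have ne: "a' \<noteq> b'" "b' \<noteq> c'" "c' \<noteq> a'" using dis(2) by auto
    \<comment> \<open>The pairs that are not adjacent form a partial matching of the two triples; any permutation
      extending it tells in which order to exchange the points.\<close>
    have "good a' b' c' \<or> good a' c' b' \<or> good b' a' c' \<or> good b' c' a' \<or> good c' a' b' \<or> good c' b' a'"
      unfolding good_def using r cl[unfolded adj_sym[of a] adj_sym[of b] adj_sym[of c]] by argo
    then show "dist y y' \<le> 3 * C"
      using good[OF _ _ _ _ _ y'(1)] good[OF _ _ _ _ _ y'(2)] good[OF _ _ _ _ _ y'(3)]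
        good[OF _ _ _ _ _ y'(4)] good[OF _ _ _ _ _ y'(5)] good[OF _ _ _ _ _ y'(6)] ne
      by blast
  qed
qed

subsection \<open>The map on centers\<close>

definition center_map ::
  "'a::metric_space \<Rightarrow> 'b::metric_space \<Rightarrow> ('a ideal \<Rightarrow> 'b ideal) \<Rightarrow> gauge \<Rightarrow> real \<Rightarrow> gauge \<Rightarrow> real \<Rightarrow> ('a \<Rightarrow> 'b) \<Rightarrow> bool" where
  "center_map p q h N K N' K' f \<longleftrightarrow> morse_gauge N \<and> morse_gauge N' \<and>
     (\<forall>x. \<exists>a b c. [a, b, c] \<in> boundary_tuples p 3 N \<and> x \<in> centers K a b c \<and>
        [h a, h b, h c] \<in> boundary_tuples q 3 N' \<and> f x \<in> centers K' (h a) (h b) (h c))"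

lemma morse_pair_max1: "morse_pair N a b \<Longrightarrow> morse_pair (max_gauge N M) a b"
  unfolding morse_pair_def by (meson morse_geodesic_max1)

lemma morse_pair_max2: "morse_pair M a b \<Longrightarrow> morse_pair (max_gauge N M) a b"
  unfolding morse_pair_def by (meson morse_geodesic_max2)

lemma boundary_tuples_max1: "as \<in> boundary_tuples p n N \<Longrightarrow> as \<in> boundary_tuples p n (max_gauge N N')"
  unfolding boundary_tuples_iff by (meson morse_pair_max1)

lemma boundary_tuples_max2: "as \<in> boundary_tuples p n N' \<Longrightarrow> as \<in> boundary_tuples p n (max_gauge N N')"
  unfolding boundary_tuples_iff by (meson morse_pair_max2)

lemma center_map_exists:
  fixes p :: "'a::proper_geodesic_space" and q :: "'b::proper_geodesic_space"
  assumes "morse_center_space p" "center_constants q kc" "two_stable p q h"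
  obtains N K N' K' f where "center_map p q h N K N' K' f"
proof -
  obtain N K where N: "morse_gauge N" and K: "(UNIV :: 'a set) = \<Union>{centers K a b c | a b c. [a, b, c] \<in> boundary_tuples p 3 N}"
    using assms(1) unfolding morse_center_space_def by blast
  obtain N' where N': "morse_gauge N'" "map h ` boundary_tuples p 2 N \<subseteq> boundary_tuples q 2 N'"
    using assms(3) N unfolding two_stable_def by blast
  have "\<exists>y a b c. [a, b, c] \<in> boundary_tuples p 3 N \<and> x \<in> centers K a b c \<and>
        [h a, h b, h c] \<in> boundary_tuples q 3 N' \<and> y \<in> centers (kc N') (h a) (h b) (h c)" for x
  proof -
    have "x \<in> \<Union>{centers K a b c | a b c. [a, b, c] \<in> boundary_tuples p 3 N}" using K by blast
    then obtain a b c where 1: "[a, b, c] \<in> boundary_tuples p 3 N" "x \<in> centers K a b c" by blast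
    have 2: "[h a, h b, h c] \<in> boundary_tuples q 3 N'" using map_boundary_tuples[OF N'(2) 1(1)] by simp
    obtain y where "y \<in> centers (kc N') (h a) (h b) (h c)" using centers_nonempty[OF assms(2) 2 N'(1)] .
    then show ?thesis using 1 2 by blast
  qed
  then obtain f where "\<And>x. \<exists>a b c. [a, b, c] \<in> boundary_tuples p 3 N \<and> x \<in> centers K a b c \<and>
        [h a, h b, h c] \<in> boundary_tuples q 3 N' \<and> f x \<in> centers (kc N') (h a) (h b) (h c)" by metis
  then show ?thesis using that N N'(1) unfolding center_map_def by blast
qed

text \<open>The triple used to define \<open>f x\<close> and a given triple of another gauge are
  compared after passing to the maximum of the gauges and of the radii. This makes \<open>f\<close>
  available on triples other than those chosen for it.\<close>

lemma center_map_near_center: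
  fixes p :: "'a::proper_geodesic_space" and q :: "'b::proper_geodesic_space"
  assumes kc: "center_constants p kc" "center_constants q kc"
    and h: "two_stable p q h" "quasi_mobius kc p q h" and f: "center_map p q h N K N' K' f"
    and M: "morse_gauge M"
  shows "\<exists>C. \<forall>x x' y a b c. [a, b, c] \<in> boundary_tuples p 3 M \<longrightarrow> x' \<in> centers A a b c \<longrightarrow>
    dist x x' \<le> R \<longrightarrow> y \<in> centers A' (h a) (h b) (h c) \<longrightarrow> dist (f x) y \<le> C"
proof -
  have N: "morse_gauge N" using f by (simp add: center_map_def)
  obtain C where "\<forall>x x' y y' a b c a' b' c'. [a, b, c] \<in> boundary_tuples p 3 (max_gauge N M) \<longrightarrow>
    [a', b', c'] \<in> boundary_tuples p 3 (max_gauge N M) \<longrightarrow> x \<in> centers (max K A) a b c \<longrightarrow>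
    x' \<in> centers (max K A) a' b' c' \<longrightarrow> dist x x' \<le> R \<longrightarrow> y \<in> centers (max K' A') (h a) (h b) (h c) \<longrightarrow>
    y' \<in> centers (max K' A') (h a') (h b') (h c') \<longrightarrow> dist y y' \<le> C"
    using quasi_mobius_transfer[OF kc morse_gauge_max[OF N M] h] ..
  note C = this[rule_format]
  show ?thesis
  proof (intro exI allI impI)
    fix x x' y a b c
    assume *: "[a, b, c] \<in> boundary_tuples p 3 M" "x' \<in> centers A a b c" "dist x x' \<le> R"
      "y \<in> centers A' (h a) (h b) (h c)"
    obtain a1 b1 c1 where 1: "[a1, b1, c1] \<in> boundary_tuples p 3 N" "x \<in> centers K a1 b1 c1"
      "f x \<in> centers K' (h a1) (h b1) (h c1)" using f unfolding center_map_def by blast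
    show "dist (f x) y \<le> C"
      by (rule C[OF boundary_tuples_max1[OF 1(1)] boundary_tuples_max2[OF *(1)]
            centers_mono[OF 1(2) max.cobounded1] centers_mono[OF *(2) max.cobounded2] *(3)
            centers_mono[OF 1(3) max.cobounded1] centers_mono[OF *(4) max.cobounded2]])
  qed
qed

section \<open>Coarse Lipschitz bounds and the quasi-inverse\<close>

text \<open>A geodesic is walked in steps of length at most 1; rounding the number of steps up adds
  the constant \<open>C\<close>.\<close>

lemma coarse_lipschitzI:
  fixes f :: "'a::proper_geodesic_space \<Rightarrow> 'b::metric_space"
  assumes "\<And>x y. dist x y \<le> 1 \<Longrightarrow> dist (f x) (f y) \<le> C"
  shows "dist (f x) (f y) \<le> C * dist x y + C"
proof -
  have C: "0 \<le> C" using assms[of x x] by simp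
  have n: "dist (f x) (f y) \<le> C * real n" if "dist x y \<le> real n" for n x y
    using that
  proof (induction n arbitrary: x)
    case (Suc n)
    obtain \<gamma> where \<gamma>: "geodesic_on {0..dist x y} \<gamma>" "\<gamma> 0 = x" "\<gamma> (dist x y) = y"
      by (rule geodesic_segment_exists)
    define z where "z = \<gamma> (min 1 (dist x y))"
    have "dist x z \<le> 1" "dist z y \<le> real n"
      using geodesic_on_dist[OF \<gamma>(1), of 0 "min 1 (dist x y)"] \<gamma>(2,3) Suc.prems
        geodesic_on_dist[OF \<gamma>(1), of "min 1 (dist x y)" "dist x y"] by (auto simp: z_def)
    then have "dist (f x) (f z) \<le> C" "dist (f z) (f y) \<le> C * real n" using assms Suc.IH by auto
    then show ?case using dist_triangle[of "f x" "f y" "f z"] by (simp add: algebra_simps)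
  qed simp
  have "dist (f x) (f y) \<le> C * real (nat \<lceil>dist x y\<rceil>)" by (rule n) (simp add: real_nat_ceiling_ge)
  also have "\<dots> \<le> C * (dist x y + 1)"
    using of_int_ceiling_le_add_one[of "dist x y"] by (intro mult_left_mono C) simp
  finally show ?thesis by (simp add: algebra_simps)
qed

lemma center_map_coarse_lipschitz:
  fixes p :: "'a::proper_geodesic_space" and q :: "'b::proper_geodesic_space"
  assumes kc: "center_constants p kc" "center_constants q kc"
    and h: "two_stable p q h" "quasi_mobius kc p q h" and f: "center_map p q h N K N' K' f"
  obtains C where "\<And>x y. dist (f x) (f y) \<le> C * dist x y + C"
proof -
  have N: "morse_gauge N" using f by (simp add: center_map_def)
  obtain C where "\<forall>x x' y a b c. [a, b, c] \<in> boundary_tuples p 3 N \<longrightarrow> x' \<in> centers K a b c \<longrightarrow>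
    dist x x' \<le> 1 \<longrightarrow> y \<in> centers K' (h a) (h b) (h c) \<longrightarrow> dist (f x) y \<le> C"
    using center_map_near_center[OF kc h f N] ..
  note C = this[rule_format]
  have "dist (f x) (f x') \<le> C" if "dist x x' \<le> 1" for x x'
  proof -
    obtain a b c where "[a, b, c] \<in> boundary_tuples p 3 N" "x' \<in> centers K a b c"
      "f x' \<in> centers K' (h a) (h b) (h c)" using f unfolding center_map_def by blast
    then show ?thesis using C \<open>dist x x' \<le> 1\<close> by blast
  qed
  then show ?thesis using that coarse_lipschitzI by blast
qed

text \<open>The triple with center \<open>f x\<close> is carried by \<open>h'\<close> back to the
  triple with center \<open>x\<close>, so \<open>x\<close> itself is an admissible value for
  \<open>g (f x)\<close>.\<close>

lemma center_map_inverse: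
  fixes p :: "'a::proper_geodesic_space" and q :: "'b::proper_geodesic_space"
  assumes kc: "center_constants p kc" "center_constants q kc"
    and h': "two_stable q p h'" "quasi_mobius kc q p h'" and f: "center_map p q h N K N' K' f"
    and g: "center_map q p h' M A M' A' g" and inv: "\<And>a. a \<in> morse_boundary p \<Longrightarrow> h' (h a) = a"
  obtains C where "\<And>x. dist (g (f x)) x \<le> C"
proof -
  have N': "morse_gauge N'" using f by (simp add: center_map_def)
  obtain C where "\<forall>x x' y a b c. [a, b, c] \<in> boundary_tuples q 3 N' \<longrightarrow> x' \<in> centers K' a b c \<longrightarrow>
    dist x x' \<le> 0 \<longrightarrow> y \<in> centers K (h' a) (h' b) (h' c) \<longrightarrow> dist (g x) y \<le> C"
    using center_map_near_center[OF kc(2,1) h' g N'] ..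
  note C = this[rule_format]
  show ?thesis
  proof (rule that)
    fix x
    obtain a b c where 1: "[a, b, c] \<in> boundary_tuples p 3 N" "x \<in> centers K a b c"
      "[h a, h b, h c] \<in> boundary_tuples q 3 N'" "f x \<in> centers K' (h a) (h b) (h c)"
      using f unfolding center_map_def by blast
    have "h' (h a) = a" "h' (h b) = b" "h' (h c) = c"
      using 1(1) inv by (auto simp: boundary_tuples_iff)
    then show "dist (g (f x)) x \<le> C" using C[OF 1(3,4), of "f x" x] 1(2) by simp
  qed
qed

lemma quasi_isometryI:
  assumes f: "\<And>x y. dist (f x) (f y) \<le> C * dist x y + C" and g: "\<And>x y. dist (g x) (g y) \<le> C' * dist x y + C'"
    and D: "\<And>x. dist (g (f x)) x \<le> D" "\<And>y. dist (f (g y)) y \<le> D'"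
  shows "quasi_isometry f"
proof -
  define M where "M = Max {1, C, C', D, D'}"
  have M: "1 \<le> M" "C \<le> M" "C' \<le> M" "D \<le> M" "D' \<le> M" by (simp_all add: M_def)
  have "(1 / M) * dist x y - 3 * M \<le> dist (f x) (f y) \<and> dist (f x) (f y) \<le> M * dist x y + 3 * M" for x y
  proof -
    have "dist x y \<le> dist (g (f x)) x + dist (g (f x)) (g (f y)) + dist (g (f y)) y" by metric
    also have "\<dots> \<le> M + (M * dist (f x) (f y) + M) + M"
      using D(1)[of x] D(1)[of y] g[of "f x" "f y"] M mult_right_mono[OF M(3), of "dist (f x) (f y)"]
      by (simp add: add_mono)
    finally have "dist x y \<le> M * (dist (f x) (f y) + 3)" by (simp add: algebra_simps)
    then have "(1 / M) * dist x y \<le> dist (f x) (f y) + 3" using M(1) by (simp add: field_simps)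
    moreover have "dist (f x) (f y) \<le> M * dist x y + M"
      using f[of x y] M mult_right_mono[OF M(2), of "dist x y"] by simp
    ultimately show ?thesis using M(1) by simp
  qed
  then have "qi_embedding_on M (3 * M) UNIV f" using M(1) by (simp add: qi_embedding_on_def)
  moreover have "\<forall>x. dist (g (f x)) x \<le> M" "\<forall>y. dist (f (g y)) y \<le> M" using D M order_trans by blast+
  ultimately show ?thesis
    unfolding quasi_isometry_def using M(1) by (metis order_trans zero_le_one)
qed

subsection \<open>The boundary map induced by the map on centers\<close>

lemma boundary_morse_pair:
  fixes p :: "'a::proper_geodesic_space"
  assumes "a \<in> morse_boundary p" "b \<in> morse_boundary p"
  obtains N where "morse_gauge N" "morse_pair N a b"
proof -
  obtain N where N: "morse_gauge N" "sees N 0 p a" using boundary_sees[OF assms(1)] .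
  obtain M where M: "morse_gauge M" "sees M 0 p b" using boundary_sees[OF assms(2)] .
  have "morse_pair (line_gauge (max_gauge N M) 0) a b"
    by (rule sees_imp_morse_pair[OF assms morse_gauge_max[OF N(1) M(1)] sees_max1[OF N(2)] sees_max2[OF M(2)]])
  then show ?thesis using that morse_gauge_line[OF morse_gauge_max[OF N(1) M(1)]] by blast
qed

text \<open>For \<open>x\<close> on the line some vertex \<open>c\<close> of its triple is adjacent
  to both \<open>a\<close> and \<open>b\<close>, so \<open>x\<close> is a center of the triple
  \<open>a\<close>, \<open>b\<close>, \<open>c\<close>. Then \<open>f x\<close> is near a center of
  the image triple, and such a center is near every line from \<open>h a\<close> to
  \<open>h b\<close>.\<close>

lemma center_map_line:
  fixes p :: "'a::proper_geodesic_space" and q :: "'b::proper_geodesic_space"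
  assumes kc: "center_constants p kc" "center_constants q kc"
    and h: "two_stable p q h" "quasi_mobius kc p q h" and f: "center_map p q h N K N' K' f"
    and ab: "a \<in> morse_boundary p" "b \<in> morse_boundary p" "a \<noteq> b"
    and \<eta>: "geo_line a b \<eta>" and \<theta>: "geo_line (h a) (h b) \<theta>"
  obtains C where "\<And>t. \<exists>s. dist (f (\<eta> t)) (\<theta> s) \<le> C"
proof -
  have N: "morse_gauge N" using f by (simp add: center_map_def)
  \<comment> \<open>This gauge depends on \<open>a\<close> and \<open>b\<close>, which is harmless:
    the final constant has to be uniform only along the line.\<close>
  obtain M where M: "morse_gauge M" "morse_pair M a b" using boundary_morse_pair[OF ab(1,2)] .
  define N4 where "N4 = max_gauge N M"
  define R where "R = \<bar>K\<bar>"
  define N5 where "N5 = line_gauge N4 (R + 1)"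
  have N4: "morse_gauge N4" unfolding N4_def by (rule morse_gauge_max[OF N M(1)])
  have N5: "morse_gauge N5" unfolding N5_def by (rule morse_gauge_line[OF N4]) (simp add: R_def)
  obtain N5' where N5': "morse_gauge N5'" "map h ` boundary_tuples p 2 N5 \<subseteq> boundary_tuples q 2 N5'"
    using h(1) N5 unfolding two_stable_def by blast
  define R' where "R' = R + 1 + travel N5 (kc N5)"
  have "0 < kc N5" using kc(1) N5 by (simp add: center_constants_def)
  then have R'0: "0 \<le> R'" using travel_ge[OF N5, of "kc N5"] by (simp add: R'_def R_def)
  obtain C where "\<forall>x x' y a b c. [a, b, c] \<in> boundary_tuples p 3 N5 \<longrightarrow> x' \<in> centers R' a b c \<longrightarrow>
    dist x x' \<le> 0 \<longrightarrow> y \<in> centers (kc N5') (h a) (h b) (h c) \<longrightarrow> dist (f x) y \<le> C"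
    using center_map_near_center[OF kc h f N5] ..
  note C = this[rule_format]
  show ?thesis
  proof (rule that)
    fix t
    define x where "x = \<eta> t"
    obtain a1 a2 a3 where a: "[a1, a2, a3] \<in> boundary_tuples p 3 N" "x \<in> centers K a1 a2 a3"
      using f unfolding center_map_def by blast
    define S where "S = {a, b, a1, a2, a3}"
    have S: "S \<subseteq> morse_boundary p" using a(1) ab by (auto simp: S_def boundary_tuples_iff)
    have xR: "x \<in> centers R a1 a2 a3" by (rule centers_mono[OF a(2)]) (simp add: R_def)
    have "sees N4 (R + 1) x u" if "u \<in> S" for u
    proof (cases "u \<in> {a1, a2, a3}")
      case True
      show ?thesis using centers_sees[OF a(1) xR True] unfolding N4_def by (rule sees_max1)
    next
      case False
      then have u: "u = a \<or> u = b" using that by (auto simp: S_def)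
      have m: "morse_geodesic M UNIV \<eta>" using M(2) \<eta> by (simp add: morse_pair_def)
      have "dist x (\<eta> t) \<le> R + 1" by (simp add: x_def R_def)
      then have "sees M (R + 1) x u" using geo_line_sees[OF \<eta> m] u by blast
      then show ?thesis unfolding N4_def by (rule sees_max2)
    qed
    then have mp: "morse_pair N5 u v" if "u \<in> S" "v \<in> S" for u v
      unfolding N5_def using sees_imp_morse_pair[OF _ _ N4] S that by blast
    define adj where "adj u v \<longleftrightarrow> u \<noteq> v \<and> near_line R' x u v" for u v
    have dis: "distinct [a1, a2, a3]" using a(1) by (simp add: boundary_tuples_iff)
    have three: "adj e a1 \<and> adj e a2 \<or> adj e a2 \<and> adj e a3 \<or> adj e a3 \<and> adj e a1" if e: "e \<in> S" for e
    proof (rule near_line_two_of_three[OF kc(1) N5 dis _ _ xR R'_def])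
      show "{a1, a2, a3, e} \<subseteq> morse_boundary p" using e S unfolding S_def by blast
      show "morse_pair N5 s t" if "s \<in> {a1, a2, a3, e}" "t \<in> {a1, a2, a3, e}" for s t
        using mp that e unfolding S_def by blast
    qed (rule adj_def)
    have "a \<in> S" "b \<in> S" by (auto simp: S_def)
    \<comment> \<open>Two subsets of a set of three elements, each with at least two elements, have
      a common element.\<close>
    from three[OF this(1)] three[OF this(2)] obtain c where c: "c \<in> {a1, a2, a3}" "adj a c" "adj b c"
      by blast
    have cS: "c \<in> S" using c(1) by (auto simp: S_def)
    have abc: "[a, b, c] \<in> boundary_tuples p 3 N5"
      using c(2,3) ab S mp[OF \<open>a \<in> S\<close> \<open>b \<in> S\<close>] mp[OF \<open>b \<in> S\<close> \<open>a \<in> S\<close>] mp[OF \<open>a \<in> S\<close> cS]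
        mp[OF cS \<open>a \<in> S\<close>] mp[OF \<open>b \<in> S\<close> cS] mp[OF cS \<open>b \<in> S\<close>] cS
      unfolding boundary_tuples_iff adj_def by (simp add: subset_iff)
    have "near_line R' x a b" by (rule near_lineI[OF \<eta>, of _ t]) (simp add: x_def R'0)
    then have xc: "x \<in> centers R' a b c"
      using c(2,3) near_line_commute unfolding centers_iff adj_def by blast
    have habc: "[h a, h b, h c] \<in> boundary_tuples q 3 N5'" using map_boundary_tuples[OF N5'(2) abc] by simp
    obtain y where y: "y \<in> centers (kc N5') (h a) (h b) (h c)" using centers_nonempty[OF kc(2) habc N5'(1)] .
    have 1: "dist (f x) y \<le> C" using C[OF abc xc _ y, of x] by simp
    have hb: "h a \<in> morse_boundary q" "h b \<in> morse_boundary q" "morse_pair N5' (h a) (h b)"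
      using habc by (auto simp: boundary_tuples_iff)
    have "near_line (kc N5') y (h a) (h b)" using y by (simp add: centers_iff)
    then obtain r where "dist y (\<theta> r) \<le> kc N5' + 4 + 3 * N5' 9 4"
      using near_line_any_line[OF hb(1,2) N5'(1) hb(3) _ \<theta>] by blast
    then have "dist (f x) (\<theta> r) \<le> C + (kc N5' + 4 + 3 * N5' 9 4)"
      using 1 dist_triangle[of "f x" "\<theta> r" y] by linarith
    then show "\<exists>s. dist (f (\<eta> t)) (\<theta> s) \<le> C + (kc N5' + 4 + 3 * N5' 9 4)" unfolding x_def ..
  qed
qed

lemma finite_hausdorff_rays:
  assumes "finite_hausdorff (\<gamma> ` {0..}) (\<rho> ` {0..})"
  shows "\<exists>D. \<forall>t\<ge>0. \<exists>v\<ge>0. dist (\<gamma> t) (\<rho> v) \<le> D"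
proof -
  obtain D where D: "(\<forall>x\<in>\<gamma> ` {0..}. \<exists>y\<in>\<rho> ` {0..}. dist x y \<le> D) \<and>
      (\<forall>y\<in>\<rho> ` {0..}. \<exists>x\<in>\<gamma> ` {0..}. dist y x \<le> D)"
    using assms unfolding finite_hausdorff_def ..
  show ?thesis by (rule exI[of _ D]) (use D in \<open>simp add: Ball_def Bex_def\<close>)
qed

text \<open>The image of the ray runs near two lines ending in \<open>h a\<close>. A point on the
  positive half of either line is near \<open>\<rho>\<close>, while a point on the negative halves
  of both is near rays to \<open>h b\<close> and \<open>h c\<close> and hence in a bounded
  region.\<close>

lemma center_map_ray:
  fixes p :: "'a::proper_geodesic_space" and q :: "'b::proper_geodesic_space"
  assumes kc: "center_constants p kc" "center_constants q kc"
    and h: "two_stable p q h" "quasi_mobius kc p q h" and f: "center_map p q h N K N' K' f"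
    and bij: "inj_on h (morse_boundary p)" "h ` morse_boundary p \<subseteq> morse_boundary q"
    and a: "a \<in> morse_boundary p" "\<gamma> \<in> a" "\<rho> \<in> h a"
  obtains C where "\<And>t. 0 \<le> t \<Longrightarrow> \<exists>v\<ge>0. dist (f (\<gamma> t)) (\<rho> v) \<le> C"
proof -
  obtain L where L: "\<And>x y. dist (f x) (f y) \<le> L * dist x y + L"
    using center_map_coarse_lipschitz[OF kc h f] by blast
  have L0: "0 \<le> L" using L[of p p] by simp
  obtain a1 a2 a3 where a123: "[a1, a2, a3] \<in> boundary_tuples p 3 N"
    using f unfolding center_map_def by blast
  then have "a1 \<in> morse_boundary p" "a2 \<in> morse_boundary p" "a3 \<in> morse_boundary p" "a1 \<noteq> a2" "a2 \<noteq> a3" "a3 \<noteq> a1"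
    by (auto simp: boundary_tuples_iff)
  then obtain b c where bc: "b \<in> morse_boundary p" "c \<in> morse_boundary p" "b \<noteq> c" "b \<noteq> a" "c \<noteq> a" by metis
  have hbd: "h a \<in> morse_boundary q" "h b \<in> morse_boundary q" "h c \<in> morse_boundary q" using bij bc a by auto
  have hne: "h b \<noteq> h c" "h b \<noteq> h a" "h c \<noteq> h a" using bij(1) bc a by (auto dest: inj_onD)
  \<comment> \<open>The constant \<open>E\<close> locates the image of the ray along the whole line,
    \<open>F\<close> only compares the positive half of that line with \<open>\<rho>\<close>; which
    half is met is left open.\<close>
  have side: "\<exists>\<theta> E F. geo_line (h e) (h a) \<theta> \<and> (\<forall>t\<ge>0. \<exists>s. dist (f (\<gamma> t)) (\<theta> s) \<le> E) \<and>
      (\<forall>s\<ge>0. \<exists>v\<ge>0. dist (\<theta> s) (\<rho> v) \<le> F)" if e: "e \<in> {b, c}" for e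
  proof -
    have e': "e \<in> morse_boundary p" "e \<noteq> a" "h e \<in> morse_boundary q" "h e \<noteq> h a" using e bc hbd hne by auto
    obtain \<eta> where \<eta>: "geo_line e a \<eta>" using geo_line_exists[OF e'(1) a(1) e'(2)] .
    obtain \<theta> where \<theta>: "geo_line (h e) (h a) \<theta>" using geo_line_exists[OF e'(3) hbd(1) e'(4)] .
    obtain C where C: "\<And>t. \<exists>s. dist (f (\<eta> t)) (\<theta> s) \<le> C"
      using center_map_line[OF kc h f e'(1) a(1) e'(2) \<eta> \<theta>] by blast
    have "finite_hausdorff (\<gamma> ` {0..}) (\<eta> ` {0..})"
      using tends_to_finite_hausdorff[OF a(1) tends_to_ray[OF a(2)] geo_line_right[OF \<eta>]] .
    from finite_hausdorff_rays[OF this]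
    obtain D where D: "\<And>t. 0 \<le> t \<Longrightarrow> \<exists>s\<ge>0. dist (\<gamma> t) (\<eta> s) \<le> D" by blast
    have "finite_hausdorff (\<theta> ` {0..}) (\<rho> ` {0..})"
      using tends_to_finite_hausdorff[OF hbd(1) geo_line_right[OF \<theta>] tends_to_ray[OF a(3)]] .
    from finite_hausdorff_rays[OF this]
    obtain F where F: "\<And>s. 0 \<le> s \<Longrightarrow> \<exists>v\<ge>0. dist (\<theta> s) (\<rho> v) \<le> F" by blast
    have "\<exists>s. dist (f (\<gamma> t)) (\<theta> s) \<le> (L * D + L) + C" if t: "0 \<le> t" for t
    proof -
      obtain s where s: "dist (\<gamma> t) (\<eta> s) \<le> D" using D[OF t] by blast
      obtain r where r: "dist (f (\<eta> s)) (\<theta> r) \<le> C" using C by blast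
      have "dist (f (\<gamma> t)) (f (\<eta> s)) \<le> L * D + L"
        using L[of "\<gamma> t" "\<eta> s"] mult_left_mono[OF s L0] by linarith
      then show ?thesis using r dist_triangle[of "f (\<gamma> t)" "\<theta> r" "f (\<eta> s)"] by (intro exI[of _ r]) linarith
    qed
    then show ?thesis using \<theta> F by blast
  qed
  obtain \<theta>1 E1 F1 where 1: "geo_line (h b) (h a) \<theta>1" "\<And>t. 0 \<le> t \<Longrightarrow> \<exists>s. dist (f (\<gamma> t)) (\<theta>1 s) \<le> E1"
      "\<And>s. 0 \<le> s \<Longrightarrow> \<exists>v\<ge>0. dist (\<theta>1 s) (\<rho> v) \<le> F1" using side[of b] by blast
  obtain \<theta>2 E2 F2 where 2: "geo_line (h c) (h a) \<theta>2" "\<And>t. 0 \<le> t \<Longrightarrow> \<exists>s. dist (f (\<gamma> t)) (\<theta>2 s) \<le> E2"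
      "\<And>s. 0 \<le> s \<Longrightarrow> \<exists>v\<ge>0. dist (\<theta>2 s) (\<rho> v) \<le> F2" using side[of c] by blast
  obtain \<theta>3 where 3: "geo_line (h b) (h c) \<theta>3" using geo_line_exists[OF hbd(2,3) hne(1)] .
  obtain M1 where M1: "morse_gauge M1" "morse_pair M1 (h b) (h a)" using boundary_morse_pair[OF hbd(2,1)] .
  obtain M2 where M2: "morse_gauge M2" "morse_pair M2 (h c) (h a)" using boundary_morse_pair[OF hbd(3,1)] .
  define M where "M = max_gauge M1 M2"
  have M: "morse_gauge M" "morse_geodesic M UNIV \<theta>1" "morse_geodesic M UNIV \<theta>2"
    using morse_gauge_max[OF M1(1) M2(1)] morse_pair_max1[OF M1(2)] morse_pair_max2[OF M2(2)] 1(1) 2(1)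
    unfolding M_def morse_pair_def by blast+
  define x where "x = \<theta>1 0"
  define K0 where "K0 = Max {0, E1, E2, dist x (\<theta>2 0), dist x (\<theta>3 0)}"
  have K0: "0 \<le> K0" "E1 \<le> K0" "E2 \<le> K0" "dist x (\<theta>2 0) \<le> K0" "dist x (\<theta>3 0) \<le> K0" by (simp_all add: K0_def)
  define G where "G = 4 * K0 + 3 * travel M (2 * K0)"
  define B where "B = Max {E1 + F1, E2 + F2, G + dist x (\<rho> 0)}"
  have B: "E1 + F1 \<le> B" "E2 + F2 \<le> B" "G + dist x (\<rho> 0) \<le> B" by (simp_all add: B_def)
  show ?thesis
  proof (rule that)
    fix t :: real assume t: "0 \<le> t"
    define y where "y = f (\<gamma> t)"
    obtain s1 where s1: "dist y (\<theta>1 s1) \<le> E1" using 1(2)[OF t] unfolding y_def by blast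
    obtain s2 where s2: "dist y (\<theta>2 s2) \<le> E2" using 2(2)[OF t] unfolding y_def by blast
    consider "0 \<le> s1" | "0 \<le> s2" | "s1 \<le> 0" "s2 \<le> 0" by linarith
    then have "\<exists>v\<ge>0. dist y (\<rho> v) \<le> B"
    proof cases
      case 1
      then obtain v where "v \<ge> 0" "dist (\<theta>1 s1) (\<rho> v) \<le> F1" using \<open>\<And>s. 0 \<le> s \<Longrightarrow> \<exists>v\<ge>0. dist (\<theta>1 s) (\<rho> v) \<le> F1\<close> by blast
      then show ?thesis using s1 B(1) dist_triangle[of y "\<rho> v" "\<theta>1 s1"] by (intro exI[of _ v]) linarith
    next
      case 2
      then obtain v where "v \<ge> 0" "dist (\<theta>2 s2) (\<rho> v) \<le> F2" using \<open>\<And>s. 0 \<le> s \<Longrightarrow> \<exists>v\<ge>0. dist (\<theta>2 s) (\<rho> v) \<le> F2\<close> by blast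
      then show ?thesis using s2 B(2) dist_triangle[of y "\<rho> v" "\<theta>2 s2"] by (intro exI[of _ v]) linarith
    next
      \<comment> \<open>The line from \<open>h b\<close> to \<open>h c\<close> separates the two
        directions at \<open>x\<close>, so only points at bounded distance from \<open>x\<close> are
        near both negative halves.\<close>
      case 3
      have "dist x y \<le> G"
        unfolding G_def
        by (rule near_two_rays_bounded[OF hbd(2,3) M(1) \<open>geo_line (h b) (h c) \<theta>3\<close> K0(5)
              geo_line_left_ray(3)[OF 1(1) M(2)] _ geo_line_left_ray(2)[OF 1(1)]
              geo_line_left_ray(3)[OF 2(1) M(3)] _ geo_line_left_ray(2)[OF 2(1)], of 0 0 "-s1" _ "-s2"])
           (use K0 s1 s2 3 in \<open>auto simp: x_def\<close>)
      then show ?thesis using B(3) dist_triangle[of y "\<rho> 0" x] by (intro exI[of _ 0]) (simp add: dist_commute)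
    qed
    then show "\<exists>v\<ge>0. dist (f (\<gamma> t)) (\<rho> v) \<le> B" by (simp add: y_def)
  qed
qed

lemma boundary_nonempty: "a \<in> morse_boundary p \<Longrightarrow> \<exists>\<gamma>. \<gamma> \<in> a"
  using morse_boundary_ray by blast

lemma quasi_mobius_induced:
  fixes p :: "'a::proper_geodesic_space" and q :: "'b::proper_geodesic_space"
  assumes mc: "morse_center_space p" "morse_center_space q"
    and kc: "center_constants p kc" "center_constants q kc"
    and h: "two_stable p q h" "quasi_mobius kc p q h" and h': "two_stable q p h'" "quasi_mobius kc q p h'"
    and bd: "\<And>a. a \<in> morse_boundary p \<Longrightarrow> h a \<in> morse_boundary q \<and> h' (h a) = a"
      "\<And>b. b \<in> morse_boundary q \<Longrightarrow> h' b \<in> morse_boundary p \<and> h (h' b) = b"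
  shows "\<exists>f. quasi_isometry f \<and> induced_by p q h f"
proof -
  obtain N K N' K' f where f: "center_map p q h N K N' K' f" using center_map_exists[OF mc(1) kc(2) h(1)] .
  obtain M A M' A' g where g: "center_map q p h' M A M' A' g" using center_map_exists[OF mc(2) kc(1) h'(1)] .
  obtain L where L: "\<And>x y. dist (f x) (f y) \<le> L * dist x y + L" using center_map_coarse_lipschitz[OF kc h f] by blast
  obtain L' where L': "\<And>x y. dist (g x) (g y) \<le> L' * dist x y + L'"
    using center_map_coarse_lipschitz[OF kc(2,1) h' g] by blast
  obtain D where D: "\<And>x. dist (g (f x)) x \<le> D" using center_map_inverse[OF kc h' f g] bd by blast
  obtain D' where D': "\<And>y. dist (f (g y)) y \<le> D'" using center_map_inverse[OF kc(2,1) h g f] bd by blast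
  have L0: "0 \<le> L" using L[of p p] by simp
  have inj: "inj_on h (morse_boundary p)" "h ` morse_boundary p \<subseteq> morse_boundary q"
    "inj_on h' (morse_boundary q)" "h' ` morse_boundary q \<subseteq> morse_boundary p"
    using bd by (metis inj_onI, blast, metis inj_onI, blast)
  have fh: "finite_hausdorff (f ` \<gamma> ` {0..}) (\<rho> ` {0..})"
    if a: "a \<in> morse_boundary p" "\<gamma> \<in> a" "\<rho> \<in> h a" for a \<gamma> \<rho>
  proof -
    have ha: "h a \<in> morse_boundary q" "\<gamma> \<in> h' (h a)" using bd a by auto
    obtain C where C: "\<And>t. 0 \<le> t \<Longrightarrow> \<exists>v\<ge>0. dist (f (\<gamma> t)) (\<rho> v) \<le> C"
      using center_map_ray[OF kc h f inj(1,2) a] by blast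
    obtain E where E: "\<And>v. 0 \<le> v \<Longrightarrow> \<exists>t\<ge>0. dist (g (\<rho> v)) (\<gamma> t) \<le> E"
      using center_map_ray[OF kc(2,1) h' g inj(3,4) ha(1) a(3) ha(2)] by blast
    \<comment> \<open>The half of the Hausdorff bound that requires all of \<open>\<rho>\<close> to
      be reached comes from \<open>g\<close>: a point of \<open>\<rho>\<close> is sent near
      \<open>\<gamma>\<close> and brought back by \<open>f\<close>.\<close>
    have E': "\<exists>t\<ge>0. dist (\<rho> v) (f (\<gamma> t)) \<le> D' + (L * E + L)" if v: "0 \<le> v" for v
    proof -
      obtain t where t: "t \<ge> 0" "dist (g (\<rho> v)) (\<gamma> t) \<le> E" using E[OF v] by blast
      have "dist (f (g (\<rho> v))) (f (\<gamma> t)) \<le> L * E + L"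
        using L[of "g (\<rho> v)" "\<gamma> t"] mult_left_mono[OF t(2) L0] by linarith
      then show ?thesis
        using t(1) D'[of "\<rho> v"] dist_triangle[of "\<rho> v" "f (\<gamma> t)" "f (g (\<rho> v))"]
        by (intro exI[of _ t]) (simp add: dist_commute)
    qed
    show ?thesis
      unfolding finite_hausdorff_def
    proof (intro exI[of _ "max C (D' + (L * E + L))"] conjI ballI)
      fix z assume "z \<in> f ` \<gamma> ` {0..}"
      then obtain t where "0 \<le> t" "z = f (\<gamma> t)" by auto
      then show "\<exists>b\<in>\<rho> ` {0..}. dist z b \<le> max C (D' + (L * E + L))"
        using C[of t] by (auto simp: le_max_iff_disj)
    next
      fix z assume "z \<in> \<rho> ` {0..}"
      then obtain v where "0 \<le> v" "z = \<rho> v" by auto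
      then show "\<exists>b\<in>f ` \<gamma> ` {0..}. dist z b \<le> max C (D' + (L * E + L))"
        using E'[of v] by (auto simp: le_max_iff_disj)
    qed
  qed
  have "h a = induced_boundary_map q f a" if a: "a \<in> morse_boundary p" for a
  proof (intro set_eqI iffI)
    have ha: "h a \<in> morse_boundary q" using bd a by blast
    obtain \<gamma>0 where \<gamma>0: "\<gamma>0 \<in> a" using boundary_nonempty[OF a] by blast
    obtain \<rho>0 where \<rho>0: "\<rho>0 \<in> h a" using boundary_nonempty[OF ha] by blast
    fix \<rho>
    show "\<rho> \<in> induced_boundary_map q f a" if "\<rho> \<in> h a"
      using boundary_ray[OF ha that] fh[OF a \<gamma>0 that] \<gamma>0 unfolding induced_boundary_map_def by blast
    show "\<rho> \<in> h a" if "\<rho> \<in> induced_boundary_map q f a"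
    proof -
      from that obtain \<gamma> where \<gamma>: "geodesic_ray q \<rho>" "\<gamma> \<in> a" "finite_hausdorff (f ` \<gamma> ` {0..}) (\<rho> ` {0..})"
        unfolding induced_boundary_map_def by blast
      have "finite_hausdorff (\<rho>0 ` {0..}) (\<rho> ` {0..})"
        by (rule finite_hausdorff_trans[OF finite_hausdorff_sym[OF fh[OF a \<gamma>(2) \<rho>0]] \<gamma>(3)])
      then show ?thesis by (rule boundary_memI[OF ha \<rho>0 \<gamma>(1)])
    qed
  qed
  then show ?thesis
    using quasi_isometryI[OF L L' D D'] unfolding induced_by_def by blast
qed

subsection \<open>Boundary maps induced by quasi-isometries\<close>

lemma finite_hausdorff_image:
  assumes "qi_embedding_on L e UNIV f" "finite_hausdorff A B"
  shows "finite_hausdorff (f ` A) (f ` B)"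
proof -
  have L: "L \<ge> 1" and f: "\<And>x y. dist (f x) (f y) \<le> L * dist x y + e"
    using assms(1) by (auto simp: qi_embedding_on_def)
  obtain D where D: "(\<forall>a\<in>A. \<exists>b\<in>B. dist a b \<le> D) \<and> (\<forall>b\<in>B. \<exists>a\<in>A. dist b a \<le> D)"
    using assms(2) unfolding finite_hausdorff_def ..
  have fD: "dist (f x) (f y) \<le> L * D + e" if "dist x y \<le> D" for x y
    using f[of x y] mult_left_mono[OF that, of L] L by linarith
  show ?thesis
    unfolding finite_hausdorff_def
  proof (intro exI[of _ "L * D + e"] conjI ballI)
    fix z assume "z \<in> f ` A"
    then obtain a where a: "a \<in> A" "z = f a" by blast
    then obtain b where "b \<in> B" "dist a b \<le> D" using D by blast
    then show "\<exists>b\<in>f ` B. dist z b \<le> L * D + e" using fD a by blast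
  next
    fix z assume "z \<in> f ` B"
    then obtain b where b: "b \<in> B" "z = f b" by blast
    then obtain a where "a \<in> A" "dist b a \<le> D" using D by blast
    then show "\<exists>a\<in>f ` A. dist z a \<le> L * D + e" using fD b by blast
  qed
qed

lemma finite_hausdorff_near_id:
  assumes "\<And>x. dist (k x) x \<le> D"
  shows "finite_hausdorff (k ` A) A"
  unfolding finite_hausdorff_def
proof (intro exI[of _ D] conjI ballI)
  fix z assume "z \<in> k ` A"
  then obtain a where "a \<in> A" "z = k a" by blast
  then show "\<exists>b\<in>A. dist z b \<le> D" using assms by blast
next
  fix z assume "z \<in> A"
  then show "\<exists>b\<in>k ` A. dist z b \<le> D" using assms[of z] by (intro bexI[of _ "k z"]) (auto simp: dist_commute)
qed

lemma induced_tends_to_inverse: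
  assumes "qi_embedding_on L e UNIV g" "\<And>x. dist (g (f x)) x \<le> D"
    and "b = induced_boundary_map q f a" "tends_to A b"
  shows "tends_to (g ` A) a"
proof -
  from assms(4) obtain \<rho> where \<rho>: "\<rho> \<in> b" "finite_hausdorff A (\<rho> ` {0..})"
    unfolding tends_to_def by blast
  from \<rho>(1) obtain \<gamma> where \<gamma>: "\<gamma> \<in> a" "finite_hausdorff (f ` \<gamma> ` {0..}) (\<rho> ` {0..})"
    unfolding assms(3) induced_boundary_map_def by blast
  have "finite_hausdorff (g ` \<rho> ` {0..}) (g ` f ` \<gamma> ` {0..})"
    by (rule finite_hausdorff_image[OF assms(1) finite_hausdorff_sym[OF \<gamma>(2)]])
  moreover have "finite_hausdorff (g ` f ` \<gamma> ` {0..}) (\<gamma> ` {0..})"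
    using finite_hausdorff_near_id[of "\<lambda>x. g (f x)" D "\<gamma> ` {0..}"] assms(2) by (simp add: image_image)
  ultimately have "finite_hausdorff (g ` A) (\<gamma> ` {0..})"
    using finite_hausdorff_image[OF assms(1) \<rho>(2)] finite_hausdorff_trans by meson
  then show ?thesis using \<gamma>(1) unfolding tends_to_def by blast
qed

lemma induced_tends_to:
  assumes "qi_embedding_on L e UNIV f" and a: "a \<in> morse_boundary p" "b \<in> morse_boundary q"
    and "b = induced_boundary_map q f a" "tends_to A a"
  shows "tends_to (f ` A) b"
proof -
  obtain \<rho> where \<rho>: "\<rho> \<in> b" using boundary_nonempty[OF a(2)] by blast
  from \<rho> obtain \<gamma> where \<gamma>: "\<gamma> \<in> a" "finite_hausdorff (f ` \<gamma> ` {0..}) (\<rho> ` {0..})"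
    unfolding assms(4) induced_boundary_map_def by blast
  have "finite_hausdorff A (\<gamma> ` {0..})"
    by (rule tends_to_finite_hausdorff[OF a(1) assms(5) tends_to_ray[OF \<gamma>(1)]])
  then have "finite_hausdorff (f ` A) (\<rho> ` {0..})"
    using finite_hausdorff_image[OF assms(1)] \<gamma>(2) finite_hausdorff_trans by blast
  then show ?thesis using \<rho> unfolding tends_to_def by blast
qed

lemma quasi_inverse_qi_embedding:
  assumes f: "qi_embedding_on L e UNIV f" and D: "\<And>y. dist (f (g y)) y \<le> D"
  shows "qi_embedding_on L (L * (2 * D + e)) UNIV g"
proof -
  have L: "L \<ge> 1" "e \<ge> 0" and f: "\<And>x y. dist x y \<le> L * (dist (f x) (f y) + e)"
    "\<And>x y. dist (f x) (f y) \<le> L * dist x y + e"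
    using f by (auto simp: qi_embedding_on_def field_simps)
  have D0: "0 \<le> D" using D zero_le_dist order_trans by blast
  have "(1 / L) * dist x y - L * (2 * D + e) \<le> dist (g x) (g y) \<and>
      dist (g x) (g y) \<le> L * dist x y + L * (2 * D + e)" for x y
  proof
    have "\<bar>dist (f (g x)) (f (g y)) - dist x y\<bar> \<le> 2 * D" using D[of x] D[of y] by metric
    then have b: "dist (f (g x)) (f (g y)) \<le> dist x y + 2 * D" "dist x y \<le> dist (f (g x)) (f (g y)) + 2 * D"
      by auto
    have "dist (g x) (g y) \<le> L * (dist (f (g x)) (f (g y)) + e)" by (rule f)
    also have "\<dots> \<le> L * (dist x y + 2 * D + e)" using b L by (intro mult_left_mono) auto
    finally show "dist (g x) (g y) \<le> L * dist x y + L * (2 * D + e)" by (simp add: algebra_simps)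
    \<comment> \<open>The lower bound alone would need only \<open>2 * D + e\<close>; it is enlarged
      to share the additive constant of the upper bound.\<close>
    have "1 * (2 * D + e) \<le> (L * L) * (2 * D + e)"
      using L D0 mult_mono[of 1 L 1 L] by (intro mult_right_mono) auto
    then have "dist x y \<le> L * (dist (g x) (g y) + L * (2 * D + e))"
      using b(2) f(2)[of "g x" "g y"] by (simp add: algebra_simps)
    then show "(1 / L) * dist x y - L * (2 * D + e) \<le> dist (g x) (g y)" using L by (simp add: field_simps)
  qed
  then show ?thesis using L D0 by (simp add: qi_embedding_on_def)
qed

section \<open>Morse lines and centers under a quasi-isometry\<close>

text \<open>\<open>C\<close> is the distance within which the image of the line, a quasi-geodesic
  with constants \<open>K\<close> and \<open>k\<close>, follows a Morse line. The value of
  \<open>N\<close> bounds the image of the tested quasi-geodesic, and the outer \<open>K\<close>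
  together with the last \<open>k\<close> undo the distortion by \<open>g\<close>.\<close>

definition pullback_gauge :: "real \<Rightarrow> real \<Rightarrow> gauge \<Rightarrow> gauge" where
  "pullback_gauge K k N = (let C = N (9 * K) (k + 4) + 1 in
     (\<lambda>L e. K * (N (K * L) (K * e + k + 2 * C) + 4 * C + 1 + k)))"

lemma morse_gauge_pullback:
  assumes "morse_gauge N" "1 \<le> K" "0 \<le> k"
  shows "morse_gauge (pullback_gauge K k N)"
proof -
  define C where "C = N (9 * K) (k + 4) + 1"
  have C: "0 \<le> C" using assms by (simp add: C_def morse_gauge_def)
  have "0 \<le> K * (N (K * L) (K * e + k + 2 * C) + 4 * C + 1 + k)" if "1 \<le> L" "0 \<le> e" for L e
  proof -
    have "1 \<le> K * L" using mult_mono[of 1 K 1 L] assms that by simp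
    then have "0 \<le> N (K * L) (K * e + k + 2 * C)" using assms that C by (simp add: morse_gauge_def)
    then show ?thesis using assms C by simp
  qed
  then show ?thesis by (simp add: morse_gauge_def pullback_gauge_def C_def Let_def)
qed

text \<open>A quasi-geodesic with ends on \<open>\<theta>\<close> is tested in the other space: its
  image under \<open>g\<close> has ends near \<open>\<eta>\<close> and so stays near
  \<open>\<eta>\<close>, which in turn lies near the image of \<open>\<theta>\<close>.\<close>

lemma morse_pullback:
  fixes \<theta> :: "real \<Rightarrow> 'b::proper_geodesic_space" and \<eta> :: "real \<Rightarrow> 'a::proper_geodesic_space"
  assumes N: "morse_gauge N" and \<eta>: "morse_geodesic N UNIV \<eta>" and g: "qi_embedding_on K k UNIV g"
    and \<theta>: "geodesic_on UNIV \<theta>"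
    and fh: "finite_hausdorff (g ` \<theta> ` {..0}) (\<eta> ` {..0})" "finite_hausdorff (g ` \<theta> ` {0..}) (\<eta> ` {0..})"
  shows "morse_geodesic (pullback_gauge K k N) UNIV \<theta>"
proof (rule morse_geodesicI[OF \<theta>])
  fix L e a b \<sigma> s1 s2 r
  assume \<sigma>: "quasi_geodesic L e {a..b} \<sigma>" and s12: "s1 \<le> s2" and ab: "\<sigma> a = \<theta> s1" "\<sigma> b = \<theta> s2"
    and r: "r \<in> {a..b}"
  define C where "C = N (9 * K) (k + 4) + 1"
  define \<zeta> where "\<zeta> = (\<lambda>t. g (\<theta> t))"
  have gL: "1 \<le> K" "0 \<le> k" "\<And>x y. dist x y \<le> K * (dist (g x) (g y) + k)"
    using g by (auto simp: qi_embedding_on_def field_simps)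
  have \<zeta>: "quasi_geodesic K k UNIV \<zeta>"
    using quasi_geodesic_compose[OF geodesic_on_imp_quasi_geodesic[OF \<theta>] g] by (simp add: \<zeta>_def)
  have fh': "finite_hausdorff (\<zeta> ` {..0}) (\<eta> ` {..0})" "finite_hausdorff (\<zeta> ` {0..}) (\<eta> ` {0..})"
    using fh by (simp_all add: \<zeta>_def image_image)
  note line = morse_line_near_quasi_line[OF N \<eta> \<zeta> fh' C_def]
  \<comment> \<open>Wherever the splitting parameter in \<open>line\<close> lies, the two halves
    together cover every \<open>s\<close>.\<close>
  have near: "\<exists>t. dist (\<zeta> s) (\<eta> t) \<le> C" for s using line[of 0] by (meson linear)
  obtain t1 where t1: "dist (\<zeta> s1) (\<eta> t1) \<le> C" using near by blast
  obtain t2 where t2: "dist (\<zeta> s2) (\<eta> t2) \<le> C" using near by blast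
  have g\<sigma>: "quasi_geodesic (K * L) (K * e + k) {a..b} (\<lambda>t. g (\<sigma> t))" by (rule quasi_geodesic_compose[OF \<sigma> g])
  have "\<exists>v\<in>{min t1 t2..max t1 t2}. dist (g (\<sigma> r)) (\<eta> v) \<le> N (K * L) (K * e + k + 2 * C) + C + 1"
    by (rule morse_near[OF \<eta> N _ _ g\<sigma>]) (use t1 t2 ab r in \<open>auto simp: \<zeta>_def\<close>)
  then obtain v where v: "v \<in> {min t1 t2..max t1 t2}"
    "dist (g (\<sigma> r)) (\<eta> v) \<le> N (K * L) (K * e + k + 2 * C) + C + 1" by blast
  have d: "dist (\<eta> s) (\<eta> t) = \<bar>s - t\<bar>" for s t
    using geodesic_on_dist[OF morse_geodesicD_geodesic[OF \<eta>]] by simp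
  have close: "\<bar>t - w\<bar> \<le> 2 * C" if "dist (\<zeta> s) (\<eta> t) \<le> C" "dist (\<zeta> s) (\<eta> w) \<le> C" for s t w
  proof -
    have "dist (\<eta> t) (\<eta> w) \<le> 2 * C" using that by metric
    then show ?thesis by (simp add: d)
  qed
  have reach: "dist (\<eta> v) (\<zeta> s) \<le> 3 * C" if "dist (\<zeta> s) (\<eta> t) \<le> C" "\<bar>v - t\<bar> \<le> 2 * C" for s t
    using that dist_triangle[of "\<eta> v" "\<zeta> s" "\<eta> t"] d[of v t] by (simp add: dist_commute)
  obtain s where s: "dist (\<eta> v) (\<zeta> s) \<le> 3 * C" "\<And>r. r \<le> s \<Longrightarrow> \<exists>w\<le>v. dist (\<zeta> r) (\<eta> w) \<le> C"
    "\<And>r. r \<ge> s \<Longrightarrow> \<exists>w\<ge>v. dist (\<zeta> r) (\<eta> w) \<le> C" using line[of v] by blast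
  have "\<exists>s'\<in>{s1..s2}. dist (\<eta> v) (\<zeta> s') \<le> 3 * C"
  proof -
    consider "s \<in> {s1..s2}" | "s < s1" | "s2 < s" by fastforce
    then show ?thesis
    proof cases
      case 1
      then show ?thesis using s(1) by blast
    next
      \<comment> \<open>The splitting parameter lies before the segment, so both ends of the segment
        have nearby points of \<open>\<eta>\<close> beyond \<open>v\<close>. As \<open>v\<close>
        lies between \<open>t1\<close> and \<open>t2\<close>, one of these is within
        \<open>2 * C\<close> of \<open>v\<close>, and the corresponding end of the segment serves.
        The next case is symmetric.\<close>
      case 2
      obtain w1 where w1: "w1 \<ge> v" "dist (\<zeta> s1) (\<eta> w1) \<le> C" using s(3)[of s1] 2 by auto
      obtain w2 where w2: "w2 \<ge> v" "dist (\<zeta> s2) (\<eta> w2) \<le> C" using s(3)[of s2] 2 s12 by auto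
      have "t1 \<le> v \<or> t2 \<le> v" using v(1) by auto
      then have "\<bar>v - t1\<bar> \<le> 2 * C \<or> \<bar>v - t2\<bar> \<le> 2 * C"
        using close[OF t1 w1(2)] close[OF t2 w2(2)] w1(1) w2(1) by linarith
      then show ?thesis using reach[OF t1] reach[OF t2] s12 by auto
    next
      case 3
      obtain w1 where w1: "w1 \<le> v" "dist (\<zeta> s1) (\<eta> w1) \<le> C" using s(2)[of s1] 3 s12 by auto
      obtain w2 where w2: "w2 \<le> v" "dist (\<zeta> s2) (\<eta> w2) \<le> C" using s(2)[of s2] 3 by auto
      have "v \<le> t1 \<or> v \<le> t2" using v(1) by auto
      then have "\<bar>v - t1\<bar> \<le> 2 * C \<or> \<bar>v - t2\<bar> \<le> 2 * C"
        using close[OF t1 w1(2)] close[OF t2 w2(2)] w1(1) w2(1) by linarith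
      then show ?thesis using reach[OF t1] reach[OF t2] s12 by auto
    qed
  qed
  then obtain s' where s': "s' \<in> {s1..s2}" "dist (\<eta> v) (\<zeta> s') \<le> 3 * C" by blast
  have "dist (g (\<sigma> r)) (g (\<theta> s')) \<le> N (K * L) (K * e + k + 2 * C) + 4 * C + 1"
    using v(2) s'(2) dist_triangle[of "g (\<sigma> r)" "g (\<theta> s')" "\<eta> v"] by (simp add: \<zeta>_def)
  then have "K * (dist (g (\<sigma> r)) (g (\<theta> s')) + k) \<le> K * (N (K * L) (K * e + k + 2 * C) + 4 * C + 1 + k)"
    using gL by (intro mult_left_mono) auto
  then have "dist (\<sigma> r) (\<theta> s') \<le> pullback_gauge K k N L e"
    using gL(3)[of "\<sigma> r" "\<theta> s'"] by (simp add: pullback_gauge_def C_def Let_def)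
  then show "\<exists>v\<in>{s1..s2}. dist (\<sigma> r) (\<theta> v) \<le> pullback_gauge K k N L e" using s'(1) by blast
qed

text \<open>A line between image points is carried by \<open>g\<close> near a line between the
  original points, whose gauge is known; \<open>morse_pullback\<close> then yields a gauge for the
  image line.\<close>

lemma induced_two_stable:
  fixes p :: "'a::proper_geodesic_space" and q :: "'b::proper_geodesic_space"
  assumes g: "qi_embedding_on K k UNIV g" and D: "\<And>x. dist (g (f x)) x \<le> D"
    and ind: "induced_by p q h f" and h: "inj_on h (morse_boundary p)" "h ` morse_boundary p \<subseteq> morse_boundary q"
  shows "two_stable p q h"
  unfolding two_stable_def
proof (intro allI impI exI[of _ "pullback_gauge K k _"] conjI)
  fix N assume N: "morse_gauge N"
  then show "morse_gauge (pullback_gauge K k N)"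
    using g by (intro morse_gauge_pullback) (auto simp: qi_embedding_on_def)
  have pair: "morse_pair (pullback_gauge K k N) (h a) (h b)"
    if ab: "a \<in> morse_boundary p" "b \<in> morse_boundary p" "a \<noteq> b" "morse_pair N a b" for a b
    unfolding morse_pair_def
  proof (intro allI impI)
    fix \<theta> assume \<theta>: "geo_line (h a) (h b) \<theta>"
    obtain \<eta> where \<eta>: "geo_line a b \<eta>" using geo_line_exists[OF ab(1-3)] .
    have hab: "h a = induced_boundary_map q f a" "h b = induced_boundary_map q f b"
      using ind ab by (auto simp: induced_by_def)
    have t: "tends_to (g ` \<theta> ` {..0}) a" "tends_to (g ` \<theta> ` {0..}) b"
      using induced_tends_to_inverse[OF g D hab(1) geo_line_left[OF \<theta>]]
        induced_tends_to_inverse[OF g D hab(2) geo_line_right[OF \<theta>]] .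
    show "morse_geodesic (pullback_gauge K k N) UNIV \<theta>"
    proof (rule morse_pullback[OF N _ g geo_line_geodesic[OF \<theta>]])
      show "morse_geodesic N UNIV \<eta>" using ab(4) \<eta> by (simp add: morse_pair_def)
      show "finite_hausdorff (g ` \<theta> ` {..0}) (\<eta> ` {..0})"
        by (rule tends_to_finite_hausdorff[OF ab(1) t(1) geo_line_left[OF \<eta>]])
      show "finite_hausdorff (g ` \<theta> ` {0..}) (\<eta> ` {0..})"
        by (rule tends_to_finite_hausdorff[OF ab(2) t(2) geo_line_right[OF \<eta>]])
    qed
  qed
  show "map h ` boundary_tuples p 2 N \<subseteq> boundary_tuples q 2 (pullback_gauge K k N)"
  proof
    fix bs assume "bs \<in> map h ` boundary_tuples p 2 N"
    then obtain as where as: "as \<in> boundary_tuples p 2 N" "bs = map h as" by blast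
    then have "length as = 2" by (simp add: boundary_tuples_iff)
    then obtain a b where [simp]: "as = [a, b]" by (auto simp: numeral_2_eq_2 length_Suc_conv)
    have ab: "a \<noteq> b" "a \<in> morse_boundary p" "b \<in> morse_boundary p" "morse_pair N a b" "morse_pair N b a"
      using as(1) unfolding boundary_tuples_iff by (simp_all, metis)
    have "h a \<noteq> h b" using h(1) ab by (auto dest: inj_onD)
    then show "bs \<in> boundary_tuples q 2 (pullback_gauge K k N)"
      using as(2) pair[of a b] pair[of b a] ab h(2) unfolding boundary_tuples_iff by (simp add: image_subset_iff)
  qed
qed

text \<open>The image of a line under \<open>f\<close> is a quasi-geodesic with the ends of a Morse
  line, so \<open>morse_line_near_quasi_line\<close> keeps it close; the first two summands bound
  the displacement of \<open>x\<close> under \<open>f\<close>.\<close>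

lemma induced_near_line:
  fixes p :: "'a::proper_geodesic_space" and q :: "'b::proper_geodesic_space"
  assumes f: "qi_embedding_on L e UNIV f" and ind: "induced_by p q h f"
    and ab: "a \<in> morse_boundary p" "b \<in> morse_boundary p"
    and hab: "h a \<in> morse_boundary q" "h b \<in> morse_boundary q" "h a \<noteq> h b"
    and N: "morse_gauge N" "morse_pair N (h a) (h b)" and x: "near_line K x a b"
  shows "near_line (L * (K + 1) + e + (N (9 * L) (e + 4) + 1)) (f x) (h a) (h b)"
proof -
  have fL: "1 \<le> L" "\<And>x y. dist (f x) (f y) \<le> L * dist x y + e" using f by (auto simp: qi_embedding_on_def)
  obtain \<eta> t where \<eta>: "geo_line a b \<eta>" "dist x (\<eta> t) \<le> K + 1" using near_lineD[OF x] by blast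
  obtain \<theta> where \<theta>: "geo_line (h a) (h b) \<theta>" using geo_line_exists[OF hab] .
  have ih: "h a = induced_boundary_map q f a" "h b = induced_boundary_map q f b"
    using ind ab by (auto simp: induced_by_def)
  define \<zeta> where "\<zeta> = (\<lambda>t. f (\<eta> t))"
  have \<zeta>: "quasi_geodesic L e UNIV \<zeta>"
    using quasi_geodesic_compose[OF geodesic_on_imp_quasi_geodesic[OF geo_line_geodesic[OF \<eta>(1)]] f]
    by (simp add: \<zeta>_def)
  have m: "morse_geodesic N UNIV \<theta>" using N(2) \<theta> by (simp add: morse_pair_def)
  have "finite_hausdorff (f ` \<eta> ` {..0}) (\<theta> ` {..0})"
    by (rule tends_to_finite_hausdorff[OF hab(1)
          induced_tends_to[OF f ab(1) hab(1) ih(1) geo_line_left[OF \<eta>(1)]] geo_line_left[OF \<theta>]])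
  moreover have "finite_hausdorff (f ` \<eta> ` {0..}) (\<theta> ` {0..})"
    by (rule tends_to_finite_hausdorff[OF hab(2)
          induced_tends_to[OF f ab(2) hab(2) ih(2) geo_line_right[OF \<eta>(1)]] geo_line_right[OF \<theta>]])
  ultimately have fh: "finite_hausdorff (\<zeta> ` {..0}) (\<theta> ` {..0})" "finite_hausdorff (\<zeta> ` {0..}) (\<theta> ` {0..})"
    by (simp_all add: \<zeta>_def image_image)
  obtain v where v: "dist (\<zeta> t) (\<theta> v) \<le> N (9 * L) (e + 4) + 1"
    using morse_line_near_quasi_line[OF N(1) m \<zeta> fh refl, of 0] by (meson linear)
  have "dist (f x) (\<zeta> t) \<le> L * (K + 1) + e"
    unfolding \<zeta>_def using fL(2)[of x "\<eta> t"] mult_left_mono[OF \<eta>(2), of L] fL(1) by linarith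
  then have "dist (f x) (\<theta> v) \<le> L * (K + 1) + e + (N (9 * L) (e + 4) + 1)"
    using v dist_triangle[of "f x" "\<theta> v" "\<zeta> t"] by linarith
  then show ?thesis by (rule near_lineI[OF \<theta>])
qed

text \<open>Every center of an image triple is within a fixed distance \<open>C\<close> of the
  \<open>f\<close>-image of any center of the original triple. Image diameters are therefore bounded
  through the distortion of \<open>f\<close>.\<close>

lemma induced_quasi_mobius:
  fixes p :: "'a::proper_geodesic_space" and q :: "'b::proper_geodesic_space"
  assumes kc: "center_constants p kc" and f: "qi_embedding_on L e UNIV f" and ind: "induced_by p q h f"
  shows "quasi_mobius kc p q h"
  unfolding quasi_mobius_def
proof (intro allI impI)
  fix N N' assume *: "morse_gauge N \<and> morse_gauge N' \<and> map h ` boundary_tuples p 2 N \<subseteq> boundary_tuples q 2 N'"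
  then have N: "morse_gauge N" "morse_gauge N'" and st: "map h ` boundary_tuples p 2 N \<subseteq> boundary_tuples q 2 N'"
    by blast+
  have fL: "1 \<le> L" "0 \<le> e" "\<And>x y. dist (f x) (f y) \<le> L * dist x y + e"
    using f by (auto simp: qi_embedding_on_def)
  define K where "K = max (kc N') (L * (kc N + 1) + e + (N' (9 * L) (e + 4) + 1))"
  define C where "C = \<bar>center_diam N' K\<bar>"
  have near: "dist (f x) y \<le> C"
    if t: "[a, b, c] \<in> boundary_tuples p 3 N" and x: "x \<in> centers (kc N) a b c"
      and y: "y \<in> centers (kc N') (h a) (h b) (h c)" for a b c x y
  proof -
    have ht: "[h a, h b, h c] \<in> boundary_tuples q 3 N'" using map_boundary_tuples[OF st t] by simp
    have bd: "a \<in> morse_boundary p" "b \<in> morse_boundary p" "c \<in> morse_boundary p"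
      using t by (auto simp: boundary_tuples_iff)
    have hbd: "h a \<in> morse_boundary q" "h b \<in> morse_boundary q" "h c \<in> morse_boundary q"
      "h a \<noteq> h b" "h b \<noteq> h c" "h c \<noteq> h a"
      "morse_pair N' (h a) (h b)" "morse_pair N' (h b) (h c)" "morse_pair N' (h c) (h a)"
      using ht by (auto simp: boundary_tuples_iff)
    have nx: "near_line (kc N) x a b" "near_line (kc N) x b c" "near_line (kc N) x c a"
      using x by (auto simp: centers_iff)
    have "f x \<in> centers (L * (kc N + 1) + e + (N' (9 * L) (e + 4) + 1)) (h a) (h b) (h c)"
      unfolding centers_iff
      using induced_near_line[OF f ind bd(1,2) hbd(1,2,4) N(2) hbd(7) nx(1)]
        induced_near_line[OF f ind bd(2,3) hbd(2,3,5) N(2) hbd(8) nx(2)]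
        induced_near_line[OF f ind bd(3,1) hbd(3,1,6) N(2) hbd(9) nx(3)] by blast
    then have "f x \<in> centers K (h a) (h b) (h c)" unfolding K_def by (rule centers_mono) simp
    moreover have "y \<in> centers K (h a) (h b) (h c)" unfolding K_def by (rule centers_mono[OF y]) simp
    ultimately have "dist (f x) y \<le> center_diam N' K" by (rule centers_dist_le[OF ht N(2)])
    then show ?thesis by (simp add: C_def)
  qed
  \<comment> \<open>\<open>L\<close> and \<open>e\<close> come from \<open>f\<close>, and
    \<open>2 * C\<close> from replacing two image centers by images of centers.\<close>
  define \<psi> where "\<psi> t = L * t + (e + 2 * C)" for t :: real
  have C0: "0 \<le> C" by (simp add: C_def)
  have cr: "cross_ratio kc N' (h a) (h b) (h c) (h d) \<le> \<psi> (cross_ratio kc N a b c d)"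
    if q4: "[a, b, c, d] \<in> boundary_tuples p 4 N" for a b c d
  proof -
    have t: "[a, b, c] \<in> boundary_tuples p 3 N" "[a, d, c] \<in> boundary_tuples p 3 N"
      using q4 by (auto intro!: boundary_tuples_subset[OF q4] simp: boundary_tuples_iff)
    define U where "U = centers (kc N) a b c \<union> centers (kc N) a d c"
    obtain z where z: "z \<in> centers (kc N) a b c" using centers_nonempty[OF kc t(1) N(1)] .
    obtain z' where z': "z' \<in> centers (kc N) a d c" using centers_nonempty[OF kc t(2) N(1)] .
    have "bounded (centers (kc N) a b c)"
      unfolding bounded_def using centers_dist_le[OF t(1) N(1) z] by blast
    moreover have "bounded (centers (kc N) a d c)"
      unfolding bounded_def using centers_dist_le[OF t(2) N(1) z'] by blast
    ultimately have U: "bounded U" unfolding U_def by simp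
    have cover: "\<exists>x\<in>U. dist (f x) y \<le> C" if y: "y \<in> centers (kc N') (h a) (h b) (h c) \<union> centers (kc N') (h a) (h d) (h c)" for y
      using y near[OF t(1) z, of y] near[OF t(2) z', of y] z z' unfolding U_def by blast
    show ?thesis
      unfolding cross_ratio_def U_def[symmetric]
    proof (rule diameter_le_dist)
      have "0 \<le> diameter U" by (rule diameter_ge_0[OF U])
      then show "0 \<le> \<psi> (diameter U)" using fL C0 by (simp add: \<psi>_def)
      fix y y' assume "y \<in> centers (kc N') (h a) (h b) (h c) \<union> centers (kc N') (h a) (h d) (h c)"
        "y' \<in> centers (kc N') (h a) (h b) (h c) \<union> centers (kc N') (h a) (h d) (h c)"
      then obtain x x' where x: "x \<in> U" "dist (f x) y \<le> C" and x': "x' \<in> U" "dist (f x') y' \<le> C"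
        using cover by blast
      have "dist (f x) (f x') \<le> L * diameter U + e"
        using fL(3)[of x x'] mult_left_mono[OF diameter_bounded_bound[OF U x(1) x'(1)], of L] fL(1) by linarith
      moreover have "dist y y' \<le> dist (f x) y + dist (f x) (f x') + dist (f x') y'" by metric
      ultimately show "dist y y' \<le> \<psi> (diameter U)" using x x' by (simp add: \<psi>_def)
    qed
  qed
  show "\<exists>\<psi> :: real \<Rightarrow> real. continuous_on {0..} \<psi> \<and> mono_on {0..} \<psi> \<and> \<psi> ` {0..} \<subseteq> {0..} \<and>
        (\<forall>a b c d. [a, b, c, d] \<in> boundary_tuples p 4 N \<longrightarrow>
           cross_ratio kc N' (h a) (h b) (h c) (h d) \<le> \<psi> (cross_ratio kc N a b c d))"
  proof (intro exI[of _ \<psi>] conjI allI impI)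
    show "continuous_on {0..} \<psi>" unfolding \<psi>_def by (intro continuous_intros)
    show "mono_on {0..} \<psi>" using fL by (auto intro!: mono_onI mult_left_mono simp: \<psi>_def)
    show "\<psi> ` {0..} \<subseteq> {0..}" using fL C0 by (auto simp: \<psi>_def)
  qed (rule cr)
qed

section \<open>The inverse boundary map and the equivalence\<close>

lemma induced_by_inverse:
  fixes p :: "'a::proper_geodesic_space" and q :: "'b::proper_geodesic_space"
  assumes g: "qi_embedding_on K k UNIV g" and D: "\<And>x. dist (g (f x)) x \<le> D" and ind: "induced_by p q h f"
    and h': "\<And>b. b \<in> morse_boundary q \<Longrightarrow> h' b \<in> morse_boundary p \<and> h (h' b) = b"
  shows "induced_by q p h' g"
  unfolding induced_by_def
proof (intro ballI set_eqI iffI)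
  fix b \<gamma> assume b: "b \<in> morse_boundary q"
  define a where "a = h' b"
  have a: "a \<in> morse_boundary p" "h a = b" using h'[OF b] by (auto simp: a_def)
  have ha: "h a = induced_boundary_map q f a" using ind a by (simp add: induced_by_def)
  have t: "tends_to (g ` \<rho> ` {0..}) a" if "\<rho> \<in> b" for \<rho>
    by (rule induced_tends_to_inverse[OF g D ha]) (use tends_to_ray[OF that] a in simp)
  show "\<gamma> \<in> induced_boundary_map p g b" if "\<gamma> \<in> h' b"
  proof -
    obtain \<rho> where \<rho>: "\<rho> \<in> b" using boundary_nonempty[OF b] by blast
    have \<gamma>: "\<gamma> \<in> a" using that by (simp add: a_def)
    have "finite_hausdorff (g ` \<rho> ` {0..}) (\<gamma> ` {0..})"
      by (rule tends_to_finite_hausdorff[OF a(1) t[OF \<rho>] tends_to_ray[OF \<gamma>]])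
    then show ?thesis using \<rho> boundary_ray[OF a(1) \<gamma>] unfolding induced_boundary_map_def by blast
  qed
  show "\<gamma> \<in> h' b" if "\<gamma> \<in> induced_boundary_map p g b"
  proof -
    from that obtain \<rho> where \<rho>: "geodesic_ray p \<gamma>" "\<rho> \<in> b" "finite_hausdorff (g ` \<rho> ` {0..}) (\<gamma> ` {0..})"
      unfolding induced_boundary_map_def by blast
    obtain \<gamma>0 where \<gamma>0: "\<gamma>0 \<in> a" using boundary_nonempty[OF a(1)] by blast
    have "finite_hausdorff (\<gamma>0 ` {0..}) (g ` \<rho> ` {0..})"
      by (rule tends_to_finite_hausdorff[OF a(1) tends_to_ray[OF \<gamma>0] t[OF \<rho>(2)]])
    then have "finite_hausdorff (\<gamma>0 ` {0..}) (\<gamma> ` {0..})" using \<rho>(3) finite_hausdorff_trans by blast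
    then show ?thesis using boundary_memI[OF a(1) \<gamma>0 \<rho>(1)] by (simp add: a_def)
  qed
qed

theorem corollary5p7:
  fixes p :: "'x::proper_geodesic_space" and q :: "'y::proper_geodesic_space"
    and HX :: "('x, 'i, 'c) hhs" and HY :: "('y, 'j, 'd) hhs"
    and kc :: "gauge \<Rightarrow> real"
    and h :: "'x ideal \<Rightarrow> 'y ideal" and h' :: "'y ideal \<Rightarrow> 'x ideal"
  assumes "morse_center_space p" and "morse_center_space q"
    and "maximal_almost_hhs HX" and "maximal_almost_hhs HY"
    and "center_constants p kc" and "center_constants q kc"
    and "homeomorphic_maps (morse_topology p) (morse_topology q) h h'"
  shows "(\<exists>f :: 'x \<Rightarrow> 'y. quasi_isometry f \<and> induced_by p q h f) \<longleftrightarrow>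
         (two_stable p q h \<and> quasi_mobius kc p q h) \<and>
         (two_stable q p h' \<and> quasi_mobius kc q p h')"
proof -
  have cont: "continuous_map (morse_topology p) (morse_topology q) h"
    "continuous_map (morse_topology q) (morse_topology p) h'"
    and inv: "\<And>a. a \<in> morse_boundary p \<Longrightarrow> h' (h a) = a" "\<And>b. b \<in> morse_boundary q \<Longrightarrow> h (h' b) = b"
    using assms(7) unfolding homeomorphic_maps_def topspace_morse_topology by blast+
  have sub: "h ` morse_boundary p \<subseteq> morse_boundary q" "h' ` morse_boundary q \<subseteq> morse_boundary p"
    using continuous_map_image_subset_topspace[OF cont(1)] continuous_map_image_subset_topspace[OF cont(2)]
    unfolding topspace_morse_topology .
  have inj: "inj_on h (morse_boundary p)" "inj_on h' (morse_boundary q)"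
    using inv by (metis inj_onI)+
  have bd: "\<And>a. a \<in> morse_boundary p \<Longrightarrow> h a \<in> morse_boundary q \<and> h' (h a) = a"
    "\<And>b. b \<in> morse_boundary q \<Longrightarrow> h' b \<in> morse_boundary p \<and> h (h' b) = b"
    using sub inv by blast+
  show ?thesis
  proof
    assume "\<exists>f :: 'x \<Rightarrow> 'y. quasi_isometry f \<and> induced_by p q h f"
    then obtain f :: "'x \<Rightarrow> 'y" where f: "quasi_isometry f" "induced_by p q h f" by blast
    then obtain L e g D where *: "qi_embedding_on L e UNIV f" "\<And>x. dist (g (f x)) x \<le> D" "\<And>y. dist (f (g y)) y \<le> D"
      unfolding quasi_isometry_def by blast
    note g = quasi_inverse_qi_embedding[OF *(1,3)]
    \<comment> \<open>Knowing that \<open>h'\<close> is induced by \<open>g\<close> makes the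
      situation symmetric, so the same two lemmas serve \<open>h'\<close> with \<open>f\<close> and
      \<open>g\<close> exchanged.\<close>
    note ind = induced_by_inverse[OF g *(2) f(2) bd(2)]
    show "(two_stable p q h \<and> quasi_mobius kc p q h) \<and> (two_stable q p h' \<and> quasi_mobius kc q p h')"
      using induced_two_stable[OF g *(2) f(2) inj(1) sub(1)] induced_quasi_mobius[OF assms(5) *(1) f(2)]
        induced_two_stable[OF *(1,3) ind inj(2) sub(2)] induced_quasi_mobius[OF assms(6) g ind] by blast
  next
    assume "(two_stable p q h \<and> quasi_mobius kc p q h) \<and> (two_stable q p h' \<and> quasi_mobius kc q p h')"
    then show "\<exists>f :: 'x \<Rightarrow> 'y. quasi_isometry f \<and> induced_by p q h f"
      using quasi_mobius_induced[OF assms(1,2,5,6) _ _ _ _ bd] by blast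
  qed
qed

end
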